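(* Let $d=2$ and let $0\le k<1$. Let $\Lambda(k,\ell)=\ell+\tfrac12\ell^2+\mu(k,\ell)$, where $\mu(k,\ell)$ is the leading eigenvalue of $K_{12}^2-k^2A_{12}^2$ on $V_\ell$. Then, as $\ell\to 0$, $$ \Lambda(k,\ell)=\gamma_1(k)\,\ell+\frac{\gamma_2(k)}{2}\,\ell^2+o(\ell^2), $$ where $$ \gamma_1(k)=2\,\frac{\mathsf{E}}{\mathsf{K}}-1 $$ and $$ \frac{\gamma_2(k)}{2}=\frac32-k^2-\frac{\mathsf{E}}{\mathsf{K}}+\frac{2\pi^2}{\mathsf{K}^2}\sum_{j=1}^\infty\left(\frac{q^{2j}}{1-q^{4j}}\right)^2-\frac{6\pi^2}{\mathsf{K}^2}\sum_{j=1}^\infty\left(\frac{q^{2j-1}}{1-q^{4j-2}}\right)^2 . $$ Here $\mathsf{K}=\mathsf{K}(k)$ and $\mathsf{E}=\mathsf{E}(k)$ are the complete elliptic integrals of the first and second kind with modulus $k$, and $q$ is the corresponding nome.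
   Context: For real $\ell$, $V_\ell$ is the space of smooth functions $v$ on $\mathbb{R}^2\setminus\{0\}$ with $v(rx)=|r|^\ell v(x)$ for all real $r\ne0$. On $V_\ell$, $K_{12}=x_1\partial_{x_2}-x_2\partial_{x_1}$ and $A_{12}=x_1\partial_{x_1}-x_2\partial_{x_2}$. For $k\geq 0$, an eigenvalue of $K_{12}^2-k^2A_{12}^2$ is a number $\mu$ for which there is a non-zero $v\in V_\ell$ with $\mu v=(K_{12}^2-k^2A_{12}^2)v$, and $\mu(k,\ell)$ denotes the largest one (the eigenvalue maximising $\ell+\ell^2/2+\mu$). Restricting functions to the unit circle, parametrised by $x_1=\sin\theta$, $x_2=\cos\theta$, one has $K_{12}=-\frac{d}{d\theta}$ and $A_{12}=-\ell\cos(2\theta)+\sin(2\theta)\frac{d}{d\theta}$, so that the eigenvalue equation reads $$ \mu v=[1-k^2\sin^2(2\theta)]v''+(\ell-1)k^2\sin(4\theta)v'-k^2\ell[2\sin^2(2\theta)+\ell\cos^2(2\theta)]v , $$ and $\mu(k,\ell)$ is the largest $\mu$ for which this equation has a non-zero even $(\pi/2)$-periodic solution. Elliptic integrals (modulus convention): $\mathsf{K}(k)=\int_0^{\pi/2}\frac{dt}{\sqrt{1-k^2\sin^2t}}$, $\mathsf{E}(k)=\int_0^{\pi/2}\sqrt{1-k^2\sin^2t}\,dt$; nome $q=\exp[-\pi\,\mathsf{K}(k')/\mathsf{K}(k)]$ with $k'=\sqrt{1-k^2}$ (so $q=0$ when $k=0$). *)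

theory Defs
  imports "HOL-Analysis.Analysis" "HOL-Library.Landau_Symbols"
begin

text \<open>\<open>C\<^sup>n\<close> on an open set, by iterating directional derivatives. Since only points of
  \<open>S\<close> and neighbourhoods of them matter, the values of \<open>f\<close> outside the open set \<open>S\<close> are irrelevant.\<close>

primrec Cn_on :: "nat \<Rightarrow> 'a::real_normed_vector set \<Rightarrow> ('a \<Rightarrow> 'b::real_normed_vector) \<Rightarrow> bool" where
  "Cn_on 0 S f \<longleftrightarrow> continuous_on S f"
| "Cn_on (Suc n) S f \<longleftrightarrow>
     (\<forall>x\<in>S. f differentiable (at x)) \<and> (\<forall>h. Cn_on n S (\<lambda>x. frechet_derivative f (at x) h))"

definition smooth_on :: "'a::real_normed_vector set \<Rightarrow> ('a \<Rightarrow> 'b::real_normed_vector) \<Rightarrow> bool" where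
  "smooth_on S f \<longleftrightarrow> (\<forall>n. Cn_on n S f)"

definition partial :: "2 \<Rightarrow> (real^2 \<Rightarrow> real) \<Rightarrow> real^2 \<Rightarrow> real" where
  "partial i v x = frechet_derivative v (at x) (axis i 1)"

definition K12 :: "(real^2 \<Rightarrow> real) \<Rightarrow> real^2 \<Rightarrow> real" where
  "K12 v x = x$1 * partial 2 v x - x$2 * partial 1 v x"

definition A12 :: "(real^2 \<Rightarrow> real) \<Rightarrow> real^2 \<Rightarrow> real" where
  "A12 v x = x$1 * partial 1 v x - x$2 * partial 2 v x"

text \<open>Functions on the punctured plane are represented by total functions whose value at the
  origin is disregarded; accordingly all conditions below are imposed only away from the origin.\<close>

definition V :: "real \<Rightarrow> (real^2 \<Rightarrow> real) set" where
  "V l = {v. smooth_on (- {0}) v \<and> (\<forall>r x. r \<noteq> 0 \<longrightarrow> x \<noteq> 0 \<longrightarrow> v (r *\<^sub>R x) = \<bar>r\<bar> powr l * v x)}"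

definition is_eigenvalue :: "real \<Rightarrow> real \<Rightarrow> real \<Rightarrow> bool" where
  "is_eigenvalue k l m \<longleftrightarrow>
     (\<exists>v\<in>V l. (\<exists>x. x \<noteq> 0 \<and> v x \<noteq> 0) \<and>
       (\<forall>x. x \<noteq> 0 \<longrightarrow> m * v x = K12 (K12 v) x - k\<^sup>2 * A12 (A12 v) x))"

definition leading_eigenvalue :: "real \<Rightarrow> real \<Rightarrow> real" where
  "leading_eigenvalue k l = (GREATEST m. is_eigenvalue k l m)"

definition Lam :: "real \<Rightarrow> real \<Rightarrow> real" where
  "Lam k l = l + l\<^sup>2 / 2 + leading_eigenvalue k l"

definition ellipticK :: "real \<Rightarrow> real" where
  "ellipticK k = integral {0..pi/2} (\<lambda>t. 1 / sqrt (1 - k\<^sup>2 * (sin t)\<^sup>2))"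

definition ellipticE :: "real \<Rightarrow> real" where
  "ellipticE k = integral {0..pi/2} (\<lambda>t. sqrt (1 - k\<^sup>2 * (sin t)\<^sup>2))"

text \<open>The case \<open>k = 0\<close> is separate because the complementary integral diverges there
  (and a divergent integral has the value \<open>0\<close> in HOL).\<close>

definition nome :: "real \<Rightarrow> real" where
  "nome k = (if k = 0 then 0 else exp (- pi * ellipticK (sqrt (1 - k\<^sup>2)) / ellipticK k))"

definition gamma1 :: "real \<Rightarrow> real" where
  "gamma1 k = 2 * (ellipticE k / ellipticK k) - 1"

text \<open>In the two series the summation index is shifted to start at \<open>0\<close>.\<close>

definition gamma2 :: "real \<Rightarrow> real" where
  "gamma2 k = 2 * (3/2 - k\<^sup>2 - ellipticE k / ellipticK k
     + 2 * pi\<^sup>2 / (ellipticK k)\<^sup>2 * (\<Sum>j. (nome k ^ (2*(j+1)) / (1 - nome k ^ (4*(j+1))))\<^sup>2)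
     - 6 * pi\<^sup>2 / (ellipticK k)\<^sup>2 * (\<Sum>j. (nome k ^ (2*j+1) / (1 - nome k ^ (4*j+2)))\<^sup>2))"

end

theory Submission
  imports Defs
begin

text \<open>A function in \<open>V l\<close> is \<open>|x|\<^sup>l\<close> times a \<open>\<pi>\<close>-periodic function of the angle \<open>\<theta>\<close>. By the maximum
  principle an eigenvalue with a positive eigenfunction is the largest one, and for small \<open>l\<close> such an
  eigenfunction is \<open>exp f(2\<theta>)\<close>: in the variable \<open>\<phi> = 2\<theta>\<close>, with \<open>\<sigma> = (1 - k\<^sup>2 sin\<^sup>2 \<phi>)\<^bsup>1/2\<^esup>\<close> and
  \<open>f' = g / \<sigma>\<close>, the eigenvalue equation becomes the Riccati equation \<open>\<sigma> g' = \<mu>/4 - Q(g)\<close>, which is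
  solved by a contraction, \<open>\<mu>/4\<close> being the mean of \<open>Q(g)\<close> with respect to \<open>d\<phi>/\<sigma>\<close>. Expanding the
  fixed point, \<open>g = - l Z/2 + O(l\<^sup>2)\<close> with \<open>Z\<close> the Jacobi zeta function, gives the coefficients of \<open>\<mu>\<close>
  as means of \<open>dn\<^sup>2\<close> and of \<open>Z\<^sup>2 - 2 Y Z\<close>, where \<open>Y = k\<^sup>2 sn cn/dn\<close>.

  The Fourier coefficients of \<open>dn\<^sup>2\<close> are found by moving the line of integration up to the pole at
  \<open>i K'\<close>. Multiplying \<open>dn\<^sup>2(z)\<close> by \<open>1 - cos \<zeta>\<close>, where \<open>\<zeta> = \<pi>(z - i K')/K\<close>, removes the pole; since the
  limit function is real and even, the coefficients are \<open>C n / sinh (n \<pi> K'/K)\<close>, and the constant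
  \<open>C\<close> is read off from the value of the limit function at the pole. Then \<open>Z\<close> has sine coefficients
  proportional to \<open>q\<^sup>n/(1 - q\<^bsup>2n\<^esup>)\<close>, those of \<open>Y\<close> follow from a half-period shift, and Parseval's identity
  produces the two series.\<close>

section \<open>Primitives and iterated differentiability\<close>

text \<open>No elliptic function is inverted: each is written in the amplitude \<open>t\<close>,
  where the elliptic variable \<open>u\<close> has \<open>d/du = \<sigma> d/dt\<close>, and
  integrals in \<open>u\<close> get the weight \<open>1/\<sigma>\<close>. The factor \<sigma> in
  \<open>f' = g / \<sigma>\<close> is chosen to cancel the one term \<open>Y g\<close> that carries
  no factor \<open>l\<close>; the rest of the Riccati equation is O(l), with Lipschitz constant
  O(l), on a ball of radius O(l), so it contracts. The line of integration is moved without
  contours. Real and imaginary part of \<open>dn\<^sup>2\<close> satisfy the Cauchy-Riemann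
  equations in the two amplitudes, and integration by parts makes these a linear system in the
  height for the Fourier coefficients. The obstacle is the double pole on the limit line: only after
  multiplication by \<open>1 - cos \<zeta>\<close> is there a bound and hence a limit, and this
  factor acts on the frequency \<open>n\<close> as a second difference. That the limit is real thus
  says only that \<open>A n sinh (n y0)\<close> has vanishing second differences, so it is linear in
  \<open>n\<close> with an unknown slope. The cosine series of the limit function, evaluated at the
  pole, yields the slope. For \<open>k = 0\<close> the pole has moved to infinity, and this case is
  separate.\<close>

definition primitive :: "(real \<Rightarrow> real) \<Rightarrow> real \<Rightarrow> real" where
  "primitive h x = integral {0..x} h - integral {x..0} h"

lemma primitive_nonneg: "0 \<le> x \<Longrightarrow> primitive h x = integral {0..x} h"
  by (cases "x = 0") (auto simp: primitive_def)

lemma primitive_0 [simp]: "primitive h 0 = 0"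
  by (simp add: primitive_def)

lemma DERIV_primitive:
  assumes "continuous_on UNIV h"
  shows "(primitive h has_real_derivative h x) (at x)"
proof -
  define a where "a = min 0 x - 1"
  define b where "b = max 0 x + 1"
  have ab: "a < 0" "a < x" "x < b" "0 < b" by (auto simp: a_def b_def)
  have int: "h integrable_on {c..d}" for c d
    by (intro integrable_continuous_real continuous_on_subset[OF assms]) auto
  have "((\<lambda>t. integral {a..t} h) has_real_derivative h x) (at x within {a..b})"
    using ab by (intro integral_has_real_derivative continuous_on_subset[OF assms]) auto
  then have "((\<lambda>t. integral {a..t} h) has_real_derivative h x) (at x)"
    using ab at_within_Icc_at[of a x b] by simp
  then have d: "((\<lambda>t. integral {a..t} h - integral {a..0} h) has_real_derivative h x) (at x)"
    by (auto intro!: derivative_eq_intros)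
  have eq: "primitive h t = integral {a..t} h - integral {a..0} h" if "t \<in> {a<..<b}" for t
  proof (cases "0 \<le> t")
    case True
    then show ?thesis
      using ab that Henstock_Kurzweil_Integration.integral_combine[where a=a and c=0 and b=t and f=h] int by (simp add: primitive_nonneg)
  next
    case False
    then show ?thesis
      using ab that Henstock_Kurzweil_Integration.integral_combine[where a=a and c=t and b=0 and f=h] int by (simp add: primitive_def)
  qed
  show ?thesis
    by (rule has_field_derivative_transform_within_open[OF d, of "{a<..<b}"]) (use ab eq in auto)
qed

lemma DERIV_primitive_chain [derivative_intros]:
  assumes "continuous_on UNIV h" "(g has_real_derivative g') (at x within S)"
  shows "((\<lambda>x. primitive h (g x)) has_real_derivative h (g x) * g') (at x within S)"
  using DERIV_chain2[OF DERIV_primitive[OF assms(1)] assms(2)] .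

lemma continuous_primitive: "continuous_on UNIV h \<Longrightarrow> continuous_on S (primitive h)"
  by (meson DERIV_isCont DERIV_primitive continuous_at_imp_continuous_on)

lemma primitive_odd:
  assumes "continuous_on UNIV h" "\<And>x. h (- x) = h x"
  shows "primitive h (- x) = - primitive h x"
proof -
  have "((\<lambda>x. primitive h (- x) + primitive h x) has_real_derivative 0) (at x)" for x
    using assms(2) by (auto intro!: derivative_eq_intros assms(1))
  from DERIV_isconst_all[of "\<lambda>x. primitive h (- x) + primitive h x" x 0] this show ?thesis by simp
qed

lemma primitive_even:
  assumes "continuous_on UNIV h" "\<And>x. h (- x) = - h x"
  shows "primitive h (- x) = primitive h x"
proof -
  have "((\<lambda>x. primitive h (- x) - primitive h x) has_real_derivative 0) (at x)" for x
    using assms(2) by (auto intro!: derivative_eq_intros assms(1))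
  from DERIV_isconst_all[of "\<lambda>x. primitive h (- x) - primitive h x" x 0] this show ?thesis by simp
qed

text \<open>The increment over a period has zero derivative, so one value settles it. The window
  from -pi/2 to pi/2 suits parity: for an even primitive the last hypothesis is automatic, for an
  odd one it says that the primitive vanishes at pi/2.\<close>

lemma primitive_periodic:
  assumes "continuous_on UNIV h" "\<And>x. h (x + pi) = h x" "primitive h (pi/2) = primitive h (- pi/2)"
  shows "primitive h (x + pi) = primitive h x"
proof -
  have "((\<lambda>x. primitive h (x + pi) - primitive h x) has_real_derivative 0) (at x)" for x
    using assms(2) by (auto intro!: derivative_eq_intros assms(1))
  then have "primitive h (x + pi) - primitive h x = primitive h (- pi/2 + pi) - primitive h (- pi/2)"
    by (intro DERIV_isconst_all) auto
  moreover have "- pi/2 + pi = pi/2" by simp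
  ultimately show ?thesis using assms(3) by simp
qed

lemma periodic_bound:
  fixes f :: "real \<Rightarrow> real"
  assumes "\<And>x. f (x + pi) = f x" "\<And>x. \<bar>x\<bar> \<le> pi/2 \<Longrightarrow> \<bar>f x\<bar> \<le> C"
  shows "\<bar>f x\<bar> \<le> C"
proof -
  have nat: "f (y + real n * pi) = f y" for n y
  proof (induction n)
    case (Suc n)
    then show ?case using assms(1)[of "y + real n * pi"] by (simp add: algebra_simps)
  qed simp
  have int: "f (y + of_int m * pi) = f y" for m y
  proof (cases "0 \<le> m")
    case True
    then show ?thesis using nat[of y "nat m"] by simp
  next
    case False
    then show ?thesis using nat[of "y + of_int m * pi" "nat (- m)"] by (simp add: algebra_simps)
  qed
  define m where "m = \<lfloor>x / pi + 1/2\<rfloor>"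
  have "of_int m \<le> x / pi + 1/2" "x / pi + 1/2 < of_int m + 1" by (auto simp: m_def)
  then have "of_int m * pi \<le> x + pi/2" "x + pi/2 < of_int m * pi + pi"
    by (auto simp: field_simps)
  then have "\<bar>x - of_int m * pi\<bar> \<le> pi/2" unfolding abs_le_iff by linarith
  from assms(2)[OF this] int[of "x - of_int m * pi" m] show ?thesis by simp
qed

text \<open>The counterpart of \<open>Cn_on\<close> on the line, without continuity of the last
  derivative; continuity is obtained from one derivative more. The derivative is quantified
  existentially so that closure properties follow by exhibiting a formula.\<close>

primrec ndiff :: "nat \<Rightarrow> (real \<Rightarrow> real) \<Rightarrow> bool" where
  "ndiff 0 g \<longleftrightarrow> True"
| "ndiff (Suc n) g \<longleftrightarrow> (\<exists>g'. (\<forall>t. (g has_real_derivative g' t) (at t)) \<and> ndiff n g')"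

lemma ndiffI: "(\<And>t. (g has_real_derivative g' t) (at t)) \<Longrightarrow> ndiff n g' \<Longrightarrow> ndiff (Suc n) g"
  by auto

lemma ndiff_mono: "ndiff n g \<Longrightarrow> m \<le> n \<Longrightarrow> ndiff m g"
proof (induction n arbitrary: m g)
  case (Suc n)
  then show ?case by (cases m) auto
qed simp

lemma ndiff_const: "ndiff n (\<lambda>t. c)"
proof (induction n arbitrary: c)
  case (Suc n)
  then show ?case by (intro ndiffI[where g' = "\<lambda>t. 0"]) auto
qed simp

lemma ndiff_add: "ndiff n f \<Longrightarrow> ndiff n g \<Longrightarrow> ndiff n (\<lambda>t. f t + g t)"
proof (induction n arbitrary: f g)
  case (Suc n)
  then obtain f' g' where
    "\<And>t. (f has_real_derivative f' t) (at t)" "\<And>t. (g has_real_derivative g' t) (at t)"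
    "ndiff n f'" "ndiff n g'" by auto
  with Suc.IH show ?case
    by (intro ndiffI[where g' = "\<lambda>t. f' t + g' t"]) (auto intro!: derivative_eq_intros)
qed simp

lemma ndiff_mult: "ndiff n f \<Longrightarrow> ndiff n g \<Longrightarrow> ndiff n (\<lambda>t. f t * g t)"
proof (induction n arbitrary: f g)
  case (Suc n)
  then obtain f' g' where d:
    "\<And>t. (f has_real_derivative f' t) (at t)" "\<And>t. (g has_real_derivative g' t) (at t)"
    "ndiff n f'" "ndiff n g'" by auto
  have "ndiff n f" "ndiff n g" using Suc.prems ndiff_mono le_SucI by blast+
  with Suc.IH d show ?case
    by (intro ndiffI[where g' = "\<lambda>t. f' t * g t + g' t * f t"])
      (auto intro!: derivative_eq_intros ndiff_add)
qed simp

lemma ndiff_cmult: "ndiff n g \<Longrightarrow> ndiff n (\<lambda>t. c * g t)"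
  by (rule ndiff_mult[OF ndiff_const])

lemma ndiff_minus: "ndiff n g \<Longrightarrow> ndiff n (\<lambda>t. - g t)"
  using ndiff_cmult[of n g "-1"] by simp

lemma ndiff_diff: "ndiff n f \<Longrightarrow> ndiff n g \<Longrightarrow> ndiff n (\<lambda>t. f t - g t)"
  using ndiff_add[OF _ ndiff_minus, of n f g] by simp

lemma ndiff_sin_cos: "ndiff n sin" "ndiff n cos"
proof (induction n)
  case (Suc n)
  show "ndiff (Suc n) sin" by (rule ndiffI[OF _ Suc(2)]) (rule DERIV_sin)
  show "ndiff (Suc n) cos" by (rule ndiffI[OF _ ndiff_minus[OF Suc(1)]]) (rule DERIV_cos)
qed auto

lemma ndiff_power: "ndiff n g \<Longrightarrow> ndiff n (\<lambda>t. g t ^ m)"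
  by (induction m) (auto intro: ndiff_const ndiff_mult)

lemma ndiff_scale: "ndiff n g \<Longrightarrow> ndiff n (\<lambda>t. g (c * t))"
proof (induction n arbitrary: g)
  case (Suc n)
  then obtain g' where d: "\<And>t. (g has_real_derivative g' t) (at t)" "ndiff n g'" by auto
  have "((\<lambda>t. g (c * t)) has_real_derivative g' (c * t) * c) (at t)" for t
    by (rule DERIV_chain2[OF d(1)]) (auto intro!: derivative_eq_intros)
  then show ?case by (rule ndiffI) (rule ndiff_mult[OF Suc.IH[OF d(2)] ndiff_const])
qed simp

lemma ndiff_exp: "ndiff n g \<Longrightarrow> ndiff n (\<lambda>t. exp (g t))"
proof (induction n arbitrary: g)
  case (Suc n)
  then obtain g' where d: "\<And>t. (g has_real_derivative g' t) (at t)" "ndiff n g'" by auto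
  have "ndiff n (\<lambda>t. exp (g t))" using Suc ndiff_mono le_SucI by blast
  then have "ndiff n (\<lambda>t. exp (g t) * g' t)" using d(2) ndiff_mult by blast
  then show ?case by (intro ndiffI) (auto intro!: derivative_eq_intros d(1))
qed simp

lemma ndiff_powr:
  assumes "\<And>t. g t > 0"
  shows "ndiff n g \<Longrightarrow> ndiff n (\<lambda>t. g t powr a)"
proof (induction n arbitrary: a)
  case (Suc n)
  then obtain g' where d: "\<And>t. (g has_real_derivative g' t) (at t)" "ndiff n g'" by auto
  have "ndiff n (\<lambda>t. g t powr (a - 1))" using Suc ndiff_mono le_SucI by blast
  then have "ndiff n (\<lambda>t. a * g t powr (a - 1) * g' t)"
    using d(2) by (intro ndiff_mult ndiff_const) auto
  moreover have "((\<lambda>t. g t powr a) has_real_derivative a * g t powr (a - 1) * g' t) (at t)" for t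
    using assms[of t] d(1)[of t]
    by (auto intro!: derivative_eq_intros simp: powr_diff field_simps)
  ultimately show ?case by (intro ndiffI)
qed simp

section \<open>Polar coordinates\<close>

text \<open>The second coordinate is the real part because the circle is parametrised by
  \<open>x$1 = sin t\<close>, \<open>x$2 = cos t\<close>.\<close>

definition angle :: "real^2 \<Rightarrow> real" where
  "angle x = Arg (Complex (x$2) (x$1))"

definition circ :: "real \<Rightarrow> real^2" where
  "circ t = (\<chi> i. if i = 1 then sin t else cos t)"

lemma circ_simps [simp]: "circ t $ 1 = sin t" "circ t $ 2 = cos t"
  by (auto simp: circ_def)

lemma norm_real2: "norm x = cmod (Complex (x$2) (x$1))" for x :: "real^2"
  by (simp add: norm_vec_def L2_set_def sum_2 cmod_def add.commute)

lemma norm_circ [simp]: "norm (circ t) = 1"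
  by (simp add: norm_real2 cmod_def)

lemma circ_nz [simp]: "circ t \<noteq> 0"
  using norm_circ[of t] by (metis norm_zero zero_neq_one)

lemma Complex_nz: "x \<noteq> 0 \<Longrightarrow> Complex (x$2) (x$1) \<noteq> 0" for x :: "real^2"
  by (metis norm_eq_zero norm_real2)

lemma polar_components: "x$1 = norm x * sin (angle x)" "x$2 = norm x * cos (angle x)" for x :: "real^2"
proof -
  let ?z = "Complex (x$2) (x$1)"
  have "x$1 = Im (rcis (cmod ?z) (Arg ?z))" "x$2 = Re (rcis (cmod ?z) (Arg ?z))"
    unfolding rcis_cmod_Arg by simp_all
  then show "x$1 = norm x * sin (angle x)" "x$2 = norm x * cos (angle x)"
    by (simp_all add: norm_real2 angle_def)
qed

lemma polar: "x = norm x *\<^sub>R circ (angle x)"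
  by (simp add: vec_eq_iff forall_2 polar_components[symmetric])

definition polar_form :: "real \<Rightarrow> (real \<Rightarrow> real) \<Rightarrow> (real^2 \<Rightarrow> real) \<Rightarrow> bool" where
  "polar_form a g v \<longleftrightarrow> (\<forall>x. x \<noteq> 0 \<longrightarrow> v x = norm x powr a * g (angle x))"

text \<open>\<open>angle\<close> has a branch cut, so angles are compared only through
  \<open>cis\<close>; periodic functions do not notice the difference.\<close>

lemma periodic_of_cis_eq:
  fixes g :: "real \<Rightarrow> real"
  assumes "\<And>t. g (t + 2 * pi) = g t" "cis a = cis b"
  shows "g a = g b"
proof -
  have nat: "g (y + 2 * pi * real n) = g y" for n y
  proof (induction n)
    case (Suc n)
    then show ?case using assms(1)[of "y + 2 * pi * real n"] by (simp add: algebra_simps)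
  qed simp
  have "sin a = sin b" "cos a = cos b" using assms(2) by (auto simp: complex_eq_iff)
  then obtain n :: int where n: "a = b + 2 * pi * of_int n" using sin_cos_eq_iff by blast
  show ?thesis
  proof (cases "0 \<le> n")
    case True
    then show ?thesis using nat[of b "nat n"] n by simp
  next
    case False
    then show ?thesis using nat[of a "nat (- n)"] n by simp
  qed
qed

lemma angle_scaleR_circ: "r > 0 \<Longrightarrow> cis (angle (r *\<^sub>R circ t)) = cis t"
proof -
  assume "r > 0"
  then have "Complex (r * cos t) (r * sin t) = of_real r * cis t"
    by (simp add: complex_eq_iff)
  moreover have "sgn (of_real r * cis t) = cis t"
    using \<open>r > 0\<close> by (simp add: sgn_mult sgn_eq norm_mult)
  ultimately show ?thesis
    using \<open>r > 0\<close> by (simp add: angle_def cis_Arg)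
qed

lemma angle_circ: "cis (angle (circ t)) = cis t"
  using angle_scaleR_circ[of 1 t] by simp

text \<open>\<open>angle\<close> jumps at the cut but \<open>g\<close> composed with it does not:
  near \<open>x\<close> the angle may be replaced by a branch \<open>t\<close> of the argument that
  is differentiable at \<open>x\<close>.\<close>

lemma has_derivative_angle:
  fixes g :: "real \<Rightarrow> real"
  assumes per: "\<And>t. g (t + 2 * pi) = g t" and d: "\<And>t. (g has_real_derivative g' t) (at t)"
    and "x \<noteq> 0"
  shows "((\<lambda>x. g (angle x)) has_derivative
     (\<lambda>h. g' (angle x) * (cos (angle x) * h$1 - sin (angle x) * h$2) / norm x)) (at x)"
proof -
  define z where "z = (\<lambda>x::real^2. Complex (x$2) (x$1))"
  have zd: "(z has_derivative z) (at x)"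
  proof -
    have "bounded_linear z"
      unfolding z_def Complex_eq
      by (intro bounded_linear_add bounded_linear_const_mult
          bounded_linear_compose[OF bounded_linear_of_real bounded_linear_vec_nth])
    then show ?thesis by (rule bounded_linear_imp_has_derivative)
  qed
  have z0: "z y \<noteq> 0" if "y \<noteq> 0" for y using Complex_nz[OF that] by (simp add: z_def)
  \<comment> \<open>\<open>Ln\<close> is differentiable off the nonpositive reals, so
    \<open>z\<close> is turned by half a turn if \<open>z x\<close> lies there; \<open>c\<close>
    undoes the turn.\<close>
  obtain s :: real where s: "s = 1 \<or> s = -1" "of_real s * z x \<notin> \<real>\<^sub>\<le>\<^sub>0"
  proof (cases "z x \<in> \<real>\<^sub>\<le>\<^sub>0")
    case True
    then have "- z x \<notin> \<real>\<^sub>\<le>\<^sub>0" using z0[OF \<open>x \<noteq> 0\<close>]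
      by (auto simp: complex_nonpos_Reals_iff complex_eq_iff)
    then show ?thesis using that[of "-1"] by simp
  next
    case False
    then show ?thesis using that[of 1] by simp
  qed
  define c where "c = (if s = 1 then 0 else pi)"
  define t where "t = (\<lambda>y. Im (Ln (of_real s * z y)) + c)"
  have cis_t: "cis (t y) = cis (angle y)" if "y \<noteq> 0" for y
  proof -
    have "cis (Im (Ln (of_real s * z y))) = sgn (of_real s * z y)"
      using z0[OF that] s(1) by (subst Arg_eq_Im_Ln[symmetric]) (auto intro!: cis_Arg)
    also have "\<dots> = of_real s * sgn (z y)" using s(1) by auto
    finally have "cis (t y) = sgn (z y)"
      using s(1) by (auto simp: t_def c_def cis_mult[symmetric])
    also have "\<dots> = cis (angle y)" using z0[OF that] by (simp add: angle_def z_def cis_Arg)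
    finally show ?thesis .
  qed
  have zx: "z x = norm x * cis (angle x)"
  proof -
    show ?thesis using polar_components[of x] by (simp add: complex_eq_iff z_def)
  qed
  have td: "(t has_derivative (\<lambda>h. (cos (angle x) * h$1 - sin (angle x) * h$2) / norm x)) (at x)"
  proof -
    have "((\<lambda>y. of_real s * z y) has_derivative (\<lambda>h. of_real s * z h)) (at x)"
      by (intro has_derivative_mult_right zd)
    moreover have "(Ln has_derivative (*) (inverse (of_real s * z x))) (at (of_real s * z x))"
      using has_field_derivative_Ln[OF s(2)] by (simp add: has_field_derivative_def)
    ultimately have "((\<lambda>y. Ln (of_real s * z y)) has_derivative
        (\<lambda>h. inverse (of_real s * z x) * (of_real s * z h))) (at x)"
      using has_derivative_compose by blast
    then have "(t has_derivative (\<lambda>h. Im (inverse (of_real s * z x) * (of_real s * z h)))) (at x)"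
      unfolding t_def by (auto intro!: derivative_eq_intros)
    moreover have "Im (inverse (of_real s * z x) * (of_real s * z h))
        = (cos (angle x) * h$1 - sin (angle x) * h$2) / norm x" for h
    proof -
      have "inverse (of_real s * z x) * (of_real s * z h) = inverse (z x) * z h"
        using s(1) by auto
      also have "\<dots> = of_real (1 / norm x) * (cis (- angle x) * z h)"
        by (simp add: zx divide_inverse mult.assoc)
      finally show ?thesis
        by (simp add: z_def Im_divide_of_real field_simps)
    qed
    ultimately show ?thesis by (simp only:)
  qed
  have "((\<lambda>y. g (t y)) has_derivative
     (\<lambda>h. g' (t x) * ((cos (angle x) * h$1 - sin (angle x) * h$2) / norm x))) (at x)"
    using has_derivative_compose[OF td, of g "(*) (g' (t x))"] d[of "t x"]
    by (simp add: has_field_derivative_def)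
  moreover have "g' (t x) = g' (angle x)"
  proof (rule periodic_of_cis_eq[OF _ cis_t[OF \<open>x \<noteq> 0\<close>]])
    fix u
    have "((\<lambda>u. g (u + 2 * pi)) has_real_derivative g' (u + 2 * pi) * 1) (at u)"
      by (rule DERIV_chain2[OF d]) (auto intro!: derivative_eq_intros)
    then show "g' (u + 2 * pi) = g' u" using d[of u] per DERIV_unique by fastforce
  qed
  ultimately have "((\<lambda>y. g (t y)) has_derivative
     (\<lambda>h. g' (angle x) * (cos (angle x) * h$1 - sin (angle x) * h$2) / norm x)) (at x)"
    by simp
  then show ?thesis
    by (rule has_derivative_transform_within_open[of _ _ _ _ "- {0}"])
      (use \<open>x \<noteq> 0\<close> cis_t in \<open>auto intro!: periodic_of_cis_eq[of g, OF per]\<close>)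
qed

lemma periodic_derivative:
  fixes g :: "real \<Rightarrow> real"
  assumes per: "\<And>t. g (t + c) = g t" and d: "\<And>t. (g has_real_derivative g' t) (at t)"
  shows "g' (u + c) = g' u"
proof -
  have "((\<lambda>u. g (u + c)) has_real_derivative g' (u + c) * 1) (at u)"
    by (rule DERIV_chain2[OF d]) (auto intro!: derivative_eq_intros)
  then show ?thesis using d[of u] per DERIV_unique by fastforce
qed

lemma has_derivative_polar:
  fixes g :: "real \<Rightarrow> real"
  assumes per: "\<And>t. g (t + 2 * pi) = g t" and d: "\<And>t. (g has_real_derivative g' t) (at t)"
    and v: "polar_form a g v" and "x \<noteq> 0"
  shows "(v has_derivative (\<lambda>h. norm x powr (a - 1) *
     (a * (sin (angle x) * h$1 + cos (angle x) * h$2) * g (angle x)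
      + g' (angle x) * (cos (angle x) * h$1 - sin (angle x) * h$2)))) (at x)"
proof -
  have n: "norm x > 0" using \<open>x \<noteq> 0\<close> by simp
  have pw: "norm x powr a = norm x * norm x powr (a - 1)" using n by (simp add: powr_diff)
  have x: "sgn x \<bullet> h = sin (angle x) * h$1 + cos (angle x) * h$2" for h
  proof -
    show ?thesis using n polar_components[of x]
      by (simp add: sgn_div_norm inner_vec_def sum_2 field_simps)
  qed
  have "(norm has_derivative (\<lambda>h. sgn x \<bullet> h)) (at x)"
    using has_derivative_norm[OF \<open>x \<noteq> 0\<close>] by (simp add: inner_commute)
  then have "((\<lambda>x. norm x powr a) has_derivative (\<lambda>h. a * norm x powr (a - 1) * (sgn x \<bullet> h))) (at x)"
    using n by (auto intro!: derivative_eq_intros simp: powr_diff field_simps)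
  then have "((\<lambda>x. norm x powr a * g (angle x)) has_derivative (\<lambda>h. norm x powr (a - 1) *
     (a * (sin (angle x) * h$1 + cos (angle x) * h$2) * g (angle x)
      + g' (angle x) * (cos (angle x) * h$1 - sin (angle x) * h$2)))) (at x)"
    by (rule has_derivative_eq_rhs[OF has_derivative_mult[OF _ has_derivative_angle[OF per d \<open>x \<noteq> 0\<close>]]])
      (use n in \<open>simp add: fun_eq_iff x pw field_simps\<close>)
  then show ?thesis
    by (rule has_derivative_transform_within_open[of _ _ _ _ "- {0}"]) (use \<open>x \<noteq> 0\<close> v in \<open>auto simp: polar_form_def\<close>)
qed

lemma frechet_polar:
  fixes g :: "real \<Rightarrow> real"
  assumes "\<And>t. g (t + 2 * pi) = g t" "\<And>t. (g has_real_derivative g' t) (at t)"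
    "polar_form a g v" "x \<noteq> 0"
  shows "frechet_derivative v (at x) h = norm x powr (a - 1) *
     (a * (sin (angle x) * h$1 + cos (angle x) * h$2) * g (angle x)
      + g' (angle x) * (cos (angle x) * h$1 - sin (angle x) * h$2))"
  by (subst frechet_derivative_at[OF has_derivative_polar[of g g' a v, OF assms], symmetric]) simp

text \<open>A directional derivative of a polar form is a polar form of degree one less, with an
  angular part that uses one derivative of \<open>g\<close>; so the induction varies
  \<open>g\<close>, \<open>a\<close> and \<open>v\<close> together. The extra derivative in
  \<open>Suc n\<close> pays for continuity at the bottom.\<close>

lemma Cn_on_polar:
  assumes "ndiff (Suc n) g" "\<And>t. g (t + 2 * pi) = g t"
    "polar_form a g v"
  shows "Cn_on n (- {0}) v"
  using assms
proof (induction n arbitrary: g a v)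
  case 0
  then obtain g' where d: "\<And>t. (g has_real_derivative g' t) (at t)" by auto
  have "continuous (at x) v" if "x \<noteq> 0" for x
    using has_derivative_continuous[OF has_derivative_polar[of g g' a v, OF 0(2) d 0(3) that]] .
  then show ?case by (auto intro: continuous_at_imp_continuous_on)
next
  case (Suc n)
  then obtain g' where d: "\<And>t. (g has_real_derivative g' t) (at t)" and g': "ndiff (Suc n) g'"
    by (metis ndiff.simps(2))
  have g: "ndiff (Suc n) g" using Suc.prems(1) ndiff_mono le_SucI by blast
  note D = has_derivative_polar[of g g' a v, OF Suc.prems(2) d Suc.prems(3)]
  have "Cn_on n (- {0}) (\<lambda>x. frechet_derivative v (at x) h)" for h
  proof (rule Suc.IH)
    show "ndiff (Suc n) (\<lambda>t. a * (sin t * h$1 + cos t * h$2) * g t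
      + g' t * (cos t * h$1 - sin t * h$2))"
      by (intro ndiff_add ndiff_mult ndiff_diff ndiff_const ndiff_sin_cos g g')
    show "a * (sin (t + 2 * pi) * h$1 + cos (t + 2 * pi) * h$2) * g (t + 2 * pi)
      + g' (t + 2 * pi) * (cos (t + 2 * pi) * h$1 - sin (t + 2 * pi) * h$2)
      = a * (sin t * h$1 + cos t * h$2) * g t + g' t * (cos t * h$1 - sin t * h$2)" for t
      using Suc.prems(2) periodic_derivative[of g "2 * pi" g', OF Suc.prems(2) d] by simp
    show "polar_form (a - 1) (\<lambda>t. a * (sin t * h$1 + cos t * h$2) * g t
      + g' t * (cos t * h$1 - sin t * h$2)) (\<lambda>x. frechet_derivative v (at x) h)"
      using frechet_polar[of g g' a v, OF Suc.prems(2) d Suc.prems(3)] by (simp add: polar_form_def)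
  qed
  moreover have "v differentiable at x" if "x \<noteq> 0" for x
    using D[OF that] differentiable_def by blast
  ultimately show ?case by simp
qed

lemma K12_A12_polar:
  fixes g :: "real \<Rightarrow> real"
  assumes "\<And>t. g (t + 2 * pi) = g t" "\<And>t. (g has_real_derivative g' t) (at t)"
    "polar_form a g v" "x \<noteq> 0"
  shows "K12 v x = norm x powr a * (- g' (angle x))"
    and "A12 v x = norm x powr a * (- a * cos (2 * angle x) * g (angle x) + sin (2 * angle x) * g' (angle x))"
proof -
  note F = frechet_polar[of g g' a v, OF assms]
  have n: "norm x > 0" using \<open>x \<noteq> 0\<close> by simp
  define t where "t = angle x"
  have x: "x$1 = norm x * sin t" "x$2 = norm x * cos t"
    using polar_components[of x] by (simp_all add: t_def)
  have pw: "norm x powr a = norm x * norm x powr (a - 1)" using n by (simp add: powr_diff)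
  have p: "partial 1 v x = norm x powr (a - 1) * (a * sin t * g t + g' t * cos t)"
    "partial 2 v x = norm x powr (a - 1) * (a * cos t * g t - g' t * sin t)"
    by (auto simp: partial_def F t_def axis_def)
  have "K12 v x = norm x powr a * (- g' t * ((sin t)\<^sup>2 + (cos t)\<^sup>2))"
    unfolding K12_def p x pw by algebra
  then show "K12 v x = norm x powr a * (- g' (angle x))" by (simp add: t_def)
  have "A12 v x = norm x powr a * (- a * ((cos t)\<^sup>2 - (sin t)\<^sup>2) * g t + 2 * sin t * cos t * g' t)"
    unfolding A12_def p x pw by algebra
  then show "A12 v x = norm x powr a * (- a * cos (2 * angle x) * g (angle x) + sin (2 * angle x) * g' (angle x))"
    by (simp add: t_def cos_double sin_double)
qed

text \<open>Both operators keep the degree, so they can be iterated on angular parts;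
  \<open>b\<close> is the angular part of \<open>A12 v\<close>. The residual is a power of the norm
  times \<open>R (angle x)\<close>, and every angle occurs on the unit circle.\<close>

lemma eigen_polar:
  fixes g :: "real \<Rightarrow> real"
  assumes per: "\<And>t. g (t + 2 * pi) = g t" and d: "\<And>t. (g has_real_derivative g' t) (at t)"
    and d2: "\<And>t. (g' has_real_derivative g'' t) (at t)"
    and v: "polar_form l g v"
  shows "(\<forall>x. x \<noteq> 0 \<longrightarrow> m * v x = K12 (K12 v) x - k\<^sup>2 * A12 (A12 v) x) \<longleftrightarrow>
    (\<forall>t. m * g t = (1 - k\<^sup>2 * (sin (2*t))\<^sup>2) * g'' t + (l - 1) * k\<^sup>2 * sin (4*t) * g' t
       - k\<^sup>2 * l * (2 * (sin (2*t))\<^sup>2 + l * (cos (2*t))\<^sup>2) * g t)"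
proof -
  have per': "g' (t + 2 * pi) = g' t" for t by (rule periodic_derivative[OF per d])
  have per'': "g'' (t + 2 * pi) = g'' t" for t by (rule periodic_derivative[OF per' d2])
  have trig: "sin (2 * (t + 2 * pi)) = sin (2 * t)" "cos (2 * (t + 2 * pi)) = cos (2 * t)"
    "sin (4 * (t + 2 * pi)) = sin (4 * t)" for t :: real
    using sin.plus_of_nat[of "2 * t" 2] cos.plus_of_nat[of "2 * t" 2] sin.plus_of_nat[of "4 * t" 4]
    by (simp_all add: algebra_simps)
  have KK: "K12 (K12 v) x = norm x powr l * g'' (angle x)" if "x \<noteq> 0" for x
  proof -
    have "K12 (K12 v) x = norm x powr l * (- (- g'' (angle x)))"
    proof (rule K12_A12_polar(1)[of "\<lambda>t. - g' t" "\<lambda>t. - g'' t"])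
      show "polar_form l (\<lambda>t. - g' t) (K12 v)"
        using K12_A12_polar(1)[of g, OF per d v] by (simp add: polar_form_def)
    qed (auto simp: per' that intro!: derivative_eq_intros d2)
    then show ?thesis by simp
  qed
  define b where "b = (\<lambda>t. - l * cos (2 * t) * g t + sin (2 * t) * g' t)"
  define b' where "b' = (\<lambda>t. 2 * l * sin (2 * t) * g t - l * cos (2 * t) * g' t + 2 * cos (2 * t) * g' t
     + sin (2 * t) * g'' t)"
  have bd: "(b has_real_derivative b' t) (at t)" for t
    unfolding b_def b'_def by (auto intro!: derivative_eq_intros d d2 simp: algebra_simps)
  have AA: "A12 (A12 v) x = norm x powr l * (- l * cos (2 * angle x) * b (angle x) + sin (2 * angle x) * b' (angle x))"
    if "x \<noteq> 0" for x
  proof (rule K12_A12_polar(2)[OF _ bd _ that])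
    show "polar_form l b (A12 v)"
      using K12_A12_polar(2)[of g, OF per d v] by (simp add: polar_form_def b_def)
    show "b (t + 2 * pi) = b t" for t
      by (simp only: b_def per per' trig)
  qed
  define R where "R = (\<lambda>t. (1 - k\<^sup>2 * (sin (2*t))\<^sup>2) * g'' t + (l - 1) * k\<^sup>2 * sin (4*t) * g' t
       - k\<^sup>2 * l * (2 * (sin (2*t))\<^sup>2 + l * (cos (2*t))\<^sup>2) * g t - m * g t)"
  have R: "K12 (K12 v) x - k\<^sup>2 * A12 (A12 v) x - m * v x = norm x powr l * R (angle x)" if "x \<noteq> 0" for x
  proof -
    have s4: "sin (4 * t) = 2 * sin (2 * t) * cos (2 * t)" for t :: real
      using sin_double[of "2 * t"] by simp
    show ?thesis
      unfolding KK[OF that] AA[OF that] v[unfolded polar_form_def, rule_format, OF that] b_def b'_def R_def s4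
      by (simp add: algebra_simps power2_eq_square)
  qed
  have "(\<forall>x. x \<noteq> 0 \<longrightarrow> m * v x = K12 (K12 v) x - k\<^sup>2 * A12 (A12 v) x) \<longleftrightarrow> (\<forall>x. x \<noteq> 0 \<longrightarrow> R (angle x) = 0)"
    using R by fastforce
  also have "\<dots> \<longleftrightarrow> (\<forall>t. R t = 0)"
  proof safe
    fix t
    assume "\<forall>x. x \<noteq> 0 \<longrightarrow> R (angle x) = 0"
    then have "R (angle (circ t)) = 0" by simp
    moreover have "R (angle (circ t)) = R t"
      by (rule periodic_of_cis_eq[OF _ angle_circ]) (simp only: R_def per per' per'' trig)
    ultimately show "R t = 0" by simp
  qed simp
  finally show ?thesis by (simp add: R_def) (smt (verit))
qed

text \<open>The angular part is the restriction to the circle. It is extracted with two derivatives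
  because the maximum principle compares solutions of second-order equations.\<close>

lemma V_polar:
  assumes "w \<in> V l"
  obtains g g' g'' where "\<And>t. g (t + pi) = g t" "\<And>t. (g has_real_derivative g' t) (at t)"
    "\<And>t. (g' has_real_derivative g'' t) (at t)"
    "polar_form l g w"
proof -
  have sm: "Cn_on n (- {0}) w" for n using assms by (auto simp: V_def smooth_on_def)
  have hom: "\<And>r x. r \<noteq> 0 \<Longrightarrow> x \<noteq> 0 \<Longrightarrow> w (r *\<^sub>R x) = \<bar>r\<bar> powr l * w x"
    using assms by (auto simp: V_def)
  have circd: "(circ has_derivative (\<lambda>h. h *\<^sub>R (circ (t + pi/2)))) (at t)" for t
  proof -
    have circ: "circ t = sin t *\<^sub>R axis 1 1 + cos t *\<^sub>R axis 2 1" for t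
      by (simp add: vec_eq_iff forall_2 axis_def)
    show ?thesis
      unfolding circ by (auto intro!: derivative_eq_intros simp: sin_add cos_add algebra_simps)
  qed
  have chain: "((\<lambda>t. u (circ t)) has_real_derivative frechet_derivative u (at (circ t)) (circ (t + pi/2))) (at t)"
    if "u differentiable (at (circ t))" for u :: "real^2 \<Rightarrow> real" and t
  proof -
    have "(u has_derivative frechet_derivative u (at (circ t))) (at (circ t))"
      using that frechet_derivative_works by blast
    from has_derivative_compose[OF circd this]
    show ?thesis
      unfolding has_field_derivative_def
      by (rule has_derivative_eq_rhs)
        (use linear_frechet_derivative[OF that] in \<open>auto simp: linear_scale mult.commute\<close>)
  qed
  have lin: "frechet_derivative w (at (circ t)) h = h$1 * frechet_derivative w (at (circ t)) (axis 1 1)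
     + h$2 * frechet_derivative w (at (circ t)) (axis 2 1)" for t h
  proof -
    have h: "h = (h$1) *\<^sub>R axis 1 1 + (h$2) *\<^sub>R axis 2 1"
      by (simp add: vec_eq_iff forall_2 axis_def)
    have "w differentiable (at (circ t))" using sm[of "Suc 0"] by simp
    from linear_frechet_derivative[OF this] show ?thesis
      by (subst h) (simp add: linear_add linear_scale)
  qed
  define D where "D = (\<lambda>h x. frechet_derivative w (at x) h)"
  have d1: "((\<lambda>t. w (circ t)) has_real_derivative cos t * D (axis 1 1) (circ t) - sin t * D (axis 2 1) (circ t)) (at t)" for t
    using chain[of w t] lin[of t "circ (t + pi/2)"] sm[of "Suc 0"] by (simp add: D_def sin_add cos_add)
  have d2: "\<exists>y. ((\<lambda>t. cos t * D (axis 1 1) (circ t) - sin t * D (axis 2 1) (circ t)) has_real_derivative y) (at t)" for t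
  proof -
    have "Cn_on (Suc 0) (- {0}) (D h)" for h
      using sm[of "Suc (Suc 0)"] unfolding D_def Cn_on.simps(2)[of "Suc 0"] by blast
    then have "D h differentiable (at (circ t))" for h by simp
    from chain[OF this] show ?thesis by (fast intro: derivative_eq_intros)
  qed
  then obtain g'' where d2: "\<And>t. ((\<lambda>t. cos t * D (axis 1 1) (circ t) - sin t * D (axis 2 1) (circ t)) has_real_derivative g'' t) (at t)"
    by metis
  show thesis
  proof (rule that[OF _ d1 d2])
    show "w (circ (t + pi)) = w (circ t)" for t
    proof -
      \<comment> \<open>Homogeneity with \<open>r = -1\<close> is what makes the period pi instead
        of 2 pi.\<close>
      have "circ (t + pi) = (- 1) *\<^sub>R circ t" by (simp add: vec_eq_iff forall_2)
      then show ?thesis using hom[of "- 1" "circ t"] by simp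
    qed
    show "polar_form l (\<lambda>t. w (circ t)) w"
      unfolding polar_form_def by (metis hom[of "norm _" "circ (angle _)"] polar abs_norm_cancel circ_nz norm_eq_zero)
  qed
qed

lemma polar_in_V:
  assumes "\<And>n. ndiff n g" and per: "\<And>t. g (t + pi) = g t"
    and v: "polar_form l g v"
  shows "v \<in> V l"
proof -
  have per2: "g (t + 2 * pi) = g t" for t
    using per[of "t + pi"] per[of t] by (simp add: algebra_simps)
  have "smooth_on (- {0}) v"
    unfolding smooth_on_def by (auto intro: Cn_on_polar[OF assms(1) per2 v])
  moreover have "v (r *\<^sub>R x) = \<bar>r\<bar> powr l * v x" if "r \<noteq> 0" "x \<noteq> 0" for r x
  proof -
    define t where "t = angle x"
    have x: "x = norm x *\<^sub>R circ t" using polar[of x] by (simp add: t_def)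
    have neg: "circ (t + pi) = - circ t" by (simp add: vec_eq_iff forall_2)
    have "g (angle (r *\<^sub>R x)) = g t"
    proof (cases "r > 0")
      case True
      then have "cis (angle ((r * norm x) *\<^sub>R circ t)) = cis t"
        using that by (intro angle_scaleR_circ) simp
      then have "cis (angle (r *\<^sub>R x)) = cis t" using x by (metis scaleR_scaleR)
      then show ?thesis by (rule periodic_of_cis_eq[of g, OF per2])
    next
      case False
      \<comment> \<open>A negative \<open>r\<close> is split into a positive radius and a half turn
        of the angle, which \<open>g\<close> does not see.\<close>
      then have "cis (angle ((- r * norm x) *\<^sub>R circ (t + pi))) = cis (t + pi)"
        using that by (intro angle_scaleR_circ) (simp add: mult_neg_pos)
      moreover have "(- r * norm x) *\<^sub>R circ (t + pi) = r *\<^sub>R x"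
        using x by (simp add: neg) (metis scaleR_scaleR)
      ultimately have "cis (angle (r *\<^sub>R x)) = cis (t + pi)" by simp
      then have "g (angle (r *\<^sub>R x)) = g (t + pi)" by (rule periodic_of_cis_eq[of g, OF per2])
      then show ?thesis using per by simp
    qed
    then show ?thesis using that using v by (simp add: polar_form_def t_def powr_mult)
  qed
  ultimately show ?thesis by (auto simp: V_def)
qed

section \<open>The maximum principle and the weighted mean\<close>

text \<open>At a maximum of \<open>|w/v|\<close> the first derivative of \<open>w/v\<close> vanishes
  and, up to sign, the second is at most zero. Eliminating \<open>c\<close> between the two
  equations expresses \<open>m - m0\<close>, times a positive number, through these
  derivatives.\<close>

lemma max_principle:
  fixes v w :: "real \<Rightarrow> real"
  assumes dv: "\<And>t. (v has_real_derivative v' t) (at t)" "\<And>t. (v' has_real_derivative v'' t) (at t)"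
    and dw: "\<And>t. (w has_real_derivative w' t) (at t)" "\<And>t. (w' has_real_derivative w'' t) (at t)"
    and per: "\<And>t. v (t + pi) = v t" "\<And>t. w (t + pi) = w t"
    and pos: "\<And>t. v t > 0" "\<And>t. a t > 0"
    and ev: "\<And>t. m0 * v t = a t * v'' t + b t * v' t + c t * v t"
    and ew: "\<And>t. m * w t = a t * w'' t + b t * w' t + c t * w t"
    and "w t0 \<noteq> 0"
  shows "m \<le> m0"
proof -
  have "continuous_on {- pi/2..pi/2} (\<lambda>t. \<bar>w t / v t\<bar>)"
    using pos(1) by (intro continuous_intros)
      (auto intro!: DERIV_continuous_on DERIV_subset[OF dv(1)] DERIV_subset[OF dw(1)] simp: less_imp_neq[symmetric])
  then have "\<exists>x\<in>{- pi/2..pi/2}. \<forall>y\<in>{- pi/2..pi/2}. \<bar>w y / v y\<bar> \<le> \<bar>w x / v x\<bar>"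
    by (intro continuous_attains_sup) auto
  then obtain t1 where t1: "\<forall>y\<in>{- pi/2..pi/2}. \<bar>w y / v y\<bar> \<le> \<bar>w t1 / v t1\<bar>" by blast
  have max: "\<bar>w t / v t\<bar> \<le> \<bar>w t1 / v t1\<bar>" for t
  proof (rule periodic_bound[of "\<lambda>t. w t / v t"])
    show "\<bar>w t / v t\<bar> \<le> \<bar>w t1 / v t1\<bar>" if "\<bar>t\<bar> \<le> pi/2" for t
      using that by (intro t1[rule_format]) (auto simp: abs_le_iff)
  qed (use per in simp)
  have "0 < \<bar>w t0 / v t0\<bar>" using pos(1)[of t0] \<open>w t0 \<noteq> 0\<close> by simp
  with max[of t0] have "w t1 \<noteq> 0" by auto
  define e where "e = sgn (w t1)"
  have e: "e * w t1 > 0" "\<bar>e\<bar> = 1" using \<open>w t1 \<noteq> 0\<close> by (auto simp: e_def sgn_if)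
  \<comment> \<open>The sign \<open>e\<close> makes the extremum at \<open>t1\<close> a positive
    maximum. \<open>N\<close>, the signed Wronskian, is the numerator of the derivative of
    \<open>z\<close>.\<close>
  define z where "z = (\<lambda>t. e * w t / v t)"
  define N where "N = (\<lambda>t. e * (w' t * v t - w t * v' t))"
  have zmax: "z t \<le> z t1" for t
  proof -
    have "z t \<le> \<bar>w t / v t\<bar>"
      using e(2) abs_ge_self[of "z t"] by (simp add: z_def abs_mult)
    also have "\<dots> \<le> \<bar>w t1 / v t1\<bar>" by (rule max)
    also have "\<dots> = z t1" using e pos(1)[of t1] \<open>w t1 \<noteq> 0\<close>
      by (auto simp: z_def abs_mult e_def sgn_if)
    finally show ?thesis .
  qed
  have dz: "(z has_real_derivative N t / (v t)\<^sup>2) (at t)" for t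
    unfolding z_def N_def using pos(1)[of t]
    by (auto intro!: derivative_eq_intros dv dw simp: field_simps power2_eq_square)
  have dN: "(N has_real_derivative e * (w'' t * v t - w t * v'' t)) (at t)" for t
    unfolding N_def by (auto intro!: derivative_eq_intros dv dw simp: algebra_simps)
  have "N t1 / (v t1)\<^sup>2 = 0"
    by (rule DERIV_local_max[OF dz, of 1]) (auto intro: zmax)
  then have N0: "N t1 = 0" using pos(1)[of t1] by auto
  \<comment> \<open>Second-order condition read off from the numerator alone: were it false,
    \<open>N\<close> would be positive just to the right of \<open>t1\<close>, and \<open>z\<close>
    would increase beyond its maximum.\<close>
  have N'0: "e * (w'' t1 * v t1 - w t1 * v'' t1) \<le> 0"
  proof (rule ccontr)
    assume "\<not> ?thesis"
    then obtain d where d: "d > 0" "\<And>h. h > 0 \<Longrightarrow> h < d \<Longrightarrow> N (t1 + h) > N t1"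
      using DERIV_pos_inc_right[OF dN[of t1]] by auto
    have "z t1 < z (t1 + d/2)"
    proof (rule DERIV_pos_imp_increasing_open[of t1 "t1 + d/2" z])
      show "\<exists>y. (z has_real_derivative y) (at x) \<and> y > 0" if "t1 < x" "x < t1 + d/2" for x
        using dz[of x] d(2)[of "x - t1"] d(1) that N0 pos(1)[of x] by (intro exI[of _ "N x / (v x)\<^sup>2"]) auto
      show "continuous_on {t1..t1 + d/2} z"
        by (auto intro!: DERIV_continuous_on DERIV_subset[OF dz])
    qed (use d in auto)
    then show False using zmax[of "t1 + d/2"] by simp
  qed
  have "(m - m0) * (e * w t1 * v t1) = e * v t1 * (m * w t1) - e * w t1 * (m0 * v t1)"
    by (simp add: algebra_simps)
  also have "\<dots> = a t1 * (e * (w'' t1 * v t1 - w t1 * v'' t1)) + b t1 * N t1"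
    unfolding ev ew by (simp add: N_def algebra_simps)
  finally have eq: "(m - m0) * (e * w t1 * v t1) = a t1 * (e * (w'' t1 * v t1 - w t1 * v'' t1))"
    by (simp add: N0)
  have "(m - m0) * (e * w t1 * v t1) \<le> 0"
    unfolding eq using N'0 pos(2)[of t1] by (simp add: mult_le_0_iff)
  moreover have "0 < e * w t1 * v t1" using e(1) pos(1)[of t1] by simp
  ultimately show ?thesis using mult_pos_pos[of "m - m0" "e * w t1 * v t1"] by linarith
qed

locale modulus =
  fixes k :: real
  assumes k0: "0 \<le> k" and k1: "k < 1"
begin

text \<open>With \<open>t\<close> the amplitude of \<open>u\<close>, \<open>P\<close> is
  \<open>dn\<^sup>2\<close> and \<sigma> is dn, and \<open>Y\<close> is minus the derivative of
  \<sigma> in \<open>t\<close>. \<open>mean\<close> averages over \<open>u\<close> from 0 to K,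
  which for even pi-periodic functions is the average over a full period.\<close>

definition P where "P t = 1 - k\<^sup>2 * (sin t)\<^sup>2"
definition \<sigma> where "\<sigma> t = sqrt (P t)"
definition Y where "Y t = k\<^sup>2 * sin t * cos t / \<sigma> t"
definition k' where "k' = sqrt (1 - k\<^sup>2)"
definition KK where "KK = ellipticK k"
definition EE where "EE = ellipticE k"
definition mean where "mean h = integral {0..pi/2} (\<lambda>t. h t / \<sigma> t) / KK"

lemma k2: "0 \<le> k\<^sup>2" "k\<^sup>2 < 1"
  using k0 k1 by (auto simp: power2_eq_square intro: mult_strict_mono[of k 1 k 1, simplified])

lemma k'_pos: "0 < k'" and k'_le: "k' \<le> 1" and k'_sq: "k'\<^sup>2 = 1 - k\<^sup>2"
  using k2 by (auto simp: k'_def)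

lemma P_bounds: "1 - k\<^sup>2 \<le> P t" "P t \<le> 1" "0 < P t"
proof -
  have "k\<^sup>2 * (sin t)\<^sup>2 \<le> k\<^sup>2 * 1" by (intro mult_left_mono) (auto simp: abs_square_le_1)
  then show "1 - k\<^sup>2 \<le> P t" by (simp add: P_def)
  with k2 show "0 < P t" by linarith
  show "P t \<le> 1" by (simp add: P_def)
qed

lemma sigma_bounds: "0 < \<sigma> t" "\<sigma> t \<le> 1" "k' \<le> \<sigma> t" and sigma_sq: "(\<sigma> t)\<^sup>2 = P t"
  using P_bounds[of t] by (auto simp: \<sigma>_def k'_def)

lemma sigma_nz [simp]: "\<sigma> t \<noteq> 0" "P t \<noteq> 0"
  using sigma_bounds(1)[of t] P_bounds(3)[of t] by auto

lemma sym [simp]: "P (- t) = P t" "\<sigma> (- t) = \<sigma> t" "Y (- t) = - Y t"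
  "P (t + pi) = P t" "\<sigma> (t + pi) = \<sigma> t" "Y (t + pi) = Y t"
  by (auto simp: P_def \<sigma>_def Y_def)

lemma DERIV_P [derivative_intros]:
  "(g has_real_derivative g') (at x within S) \<Longrightarrow>
   ((\<lambda>x. P (g x)) has_real_derivative (- 2 * k\<^sup>2 * sin (g x) * cos (g x)) * g') (at x within S)"
  unfolding P_def by (auto intro!: derivative_eq_intros)

lemma DERIV_sigma [derivative_intros]:
  assumes "(g has_real_derivative g') (at x within S)"
  shows "((\<lambda>x. \<sigma> (g x)) has_real_derivative - Y (g x) * g') (at x within S)"
proof -
  have "((\<lambda>x. sqrt (P (g x))) has_real_derivative
      (- 2 * k\<^sup>2 * sin (g x) * cos (g x)) * g' * (inverse (sqrt (P (g x))) / 2)) (at x within S)"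
    using P_bounds(3)[of "g x"] by (auto intro!: derivative_eq_intros assms)
  then show ?thesis by (simp add: \<sigma>_def[abs_def] Y_def field_simps)
qed

lemma cont_P [continuous_intros]: "continuous_on S g \<Longrightarrow> continuous_on S (\<lambda>x. P (g x))" for g :: "'a::t2_space \<Rightarrow> real"
  unfolding P_def by (intro continuous_intros)

lemma cont_sigma [continuous_intros]: "continuous_on S g \<Longrightarrow> continuous_on S (\<lambda>x. \<sigma> (g x))" for g :: "'a::t2_space \<Rightarrow> real"
  unfolding \<sigma>_def by (intro continuous_intros)

lemma cont_Y [continuous_intros]: "continuous_on S g \<Longrightarrow> continuous_on S (\<lambda>x. Y (g x))" for g :: "'a::t2_space \<Rightarrow> real"
  unfolding Y_def by (intro continuous_intros) auto

lemma Y_bound: "\<bar>Y t\<bar> \<le> 1 / k'"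
proof -
  have "k\<^sup>2 * \<bar>sin t\<bar> * \<bar>cos t\<bar> \<le> 1 * 1 * 1"
    using k2 by (intro mult_mono) auto
  then show ?thesis
    using sigma_bounds[of t] k'_pos by (auto simp: Y_def abs_mult intro!: frac_le)
qed

lemma KK_eq: "KK = integral {0..pi/2} (\<lambda>t. 1 / \<sigma> t)"
  by (simp add: KK_def ellipticK_def \<sigma>_def P_def)

lemma EE_eq: "EE = integral {0..pi/2} \<sigma>"
  by (simp add: EE_def ellipticE_def \<sigma>_def[abs_def] P_def)

lemma weighted_integrable: "continuous_on UNIV h \<Longrightarrow> (\<lambda>t. h t / \<sigma> t) integrable_on {a..b}"
  by (intro integrable_continuous_real continuous_intros) (auto elim: continuous_on_subset)

lemma KK_pos: "KK > 0"
proof -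
  have "integral {0..pi/2} (\<lambda>t. 1) \<le> integral {0..pi/2} (\<lambda>t. 1 / \<sigma> t)"
    using sigma_bounds by (intro integral_le weighted_integrable) (auto simp: continuous_intros)
  then show ?thesis using pi_gt_zero by (simp add: KK_eq del: pi_gt_zero)
qed

lemma mean_const: "mean (\<lambda>t. c) = c"
proof -
  have "integral {0..pi/2} (\<lambda>t. c / \<sigma> t) = c * KK"
    unfolding KK_eq by (subst integral_mult_right[symmetric]) simp
  then show ?thesis using KK_pos by (simp add: mean_def)
qed

lemma mean_add:
  "continuous_on UNIV h \<Longrightarrow> continuous_on UNIV g \<Longrightarrow> mean (\<lambda>t. h t + g t) = mean h + mean g"
  unfolding mean_def add_divide_distrib by (subst integral_add) (auto intro: weighted_integrable simp: add_divide_distrib)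

lemma mean_diff:
  "continuous_on UNIV h \<Longrightarrow> continuous_on UNIV g \<Longrightarrow> mean (\<lambda>t. h t - g t) = mean h - mean g"
  unfolding mean_def diff_divide_distrib by (subst integral_diff) (auto intro: weighted_integrable simp: diff_divide_distrib)

lemma mean_cmult: "mean (\<lambda>t. c * h t) = c * mean h"
  unfolding mean_def by (simp add: mult.assoc flip: times_divide_eq_right)

lemma mean_mono: "continuous_on UNIV h \<Longrightarrow> continuous_on UNIV g \<Longrightarrow> (\<And>t. h t \<le> g t) \<Longrightarrow> mean h \<le> mean g"
  unfolding mean_def using KK_pos sigma_bounds(1)
  by (intro divide_right_mono integral_le weighted_integrable) (auto intro!: divide_right_mono less_imp_le)

lemma mean_bound:
  assumes "continuous_on UNIV h" "\<And>t. \<bar>h t\<bar> \<le> C"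
  shows "\<bar>mean h\<bar> \<le> C"
  using mean_mono[of h "\<lambda>t. C"] mean_mono[of "\<lambda>t. - C" h] assms
  by (auto simp: mean_const abs_le_iff intro: order_trans) (smt (verit))+

text \<open>Solves \<open>\<sigma> g' = mean h - h\<close> with value 0 at 0. For even pi-periodic
  \<open>h\<close>, subtracting the mean is exactly what makes the solution vanish at pi/2 and,
  being odd, close up to a periodic function.\<close>

definition sol where "sol h = primitive (\<lambda>t. (mean h - h t) / \<sigma> t)"

text \<open>Bounds \<open>sol\<close>: the numerator is at most twice the bound of \<open>h\<close>,
  the weight at most \<open>1/k'\<close>, and a point of the period window is at most pi/2 away from
  the zero at 0.\<close>

definition L where "L = pi / k'"

lemma L_pos: "L > 0" by (simp add: L_def k'_pos)

context
  fixes h :: "real \<Rightarrow> real"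
  assumes cont: "continuous_on UNIV h" and even: "\<And>t. h (- t) = h t" and per: "\<And>t. h (t + pi) = h t"
begin

lemma sol_cont0: "continuous_on UNIV (\<lambda>t. (mean h - h t) / \<sigma> t)"
  by (intro continuous_intros cont) auto

lemma DERIV_sol: "(sol h has_real_derivative (mean h - h t) / \<sigma> t) (at t)"
  unfolding sol_def by (rule DERIV_primitive[OF sol_cont0])

lemma sol_odd: "sol h (- t) = - sol h t"
  unfolding sol_def by (rule primitive_odd[OF sol_cont0]) (simp add: even)

lemma sol_end: "sol h (pi/2) = 0"
proof -
  have "sol h (pi/2) = integral {0..pi/2} (\<lambda>t. mean h / \<sigma> t - h t / \<sigma> t)"
    by (simp add: sol_def primitive_nonneg diff_divide_distrib)
  also have "\<dots> = KK * mean (\<lambda>t. mean h - h t)"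
    using KK_pos by (simp add: mean_def diff_divide_distrib)
  also have "\<dots> = 0"
    using mean_diff[OF _ cont, of "\<lambda>t. mean h"] by (simp add: mean_const)
  finally show ?thesis .
qed

lemma sol_per: "sol h (t + pi) = sol h t"
  unfolding sol_def
proof (rule primitive_periodic[OF sol_cont0])
  show "primitive (\<lambda>t. (mean h - h t) / \<sigma> t) (pi / 2) = primitive (\<lambda>t. (mean h - h t) / \<sigma> t) (- pi / 2)"
    using sol_end sol_odd[of "pi/2"] by (simp add: sol_def)
qed (simp add: per)

lemma sol_cont: "continuous_on S (sol h)"
  unfolding sol_def by (rule continuous_primitive[OF sol_cont0])

lemma sol_bound:
  assumes "\<And>t. \<bar>h t\<bar> \<le> C"
  shows "\<bar>sol h t\<bar> \<le> L * C"
proof (rule periodic_bound[of "sol h", OF sol_per])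
  fix x :: real
  assume x: "\<bar>x\<bar> \<le> pi/2"
  have C: "0 \<le> C" using assms[of 0] by linarith
  have d: "\<bar>(mean h - h t) / \<sigma> t\<bar> \<le> 2 * C / k'" for t
    using mean_bound[OF cont assms] assms[of t] sigma_bounds(1,3)[of t] k'_pos C
    by (auto simp: abs_divide intro!: frac_le)
  have "\<bar>sol h x - sol h 0\<bar> \<le> 2 * C / k' * \<bar>x - 0\<bar>"
    using field_differentiable_bound[of UNIV "sol h" "\<lambda>t. (mean h - h t) / \<sigma> t" "2 * C / k'" 0 x] DERIV_sol d
    by auto
  also have "\<dots> \<le> 2 * C / k' * (pi/2)" using x C k'_pos by (intro mult_left_mono) auto
  finally show "\<bar>sol h x\<bar> \<le> L * C" by (simp add: L_def sol_def mult.commute)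
qed

end

lemma sol_diff:
  assumes "continuous_on UNIV h" "continuous_on UNIV g"
  shows "sol (\<lambda>t. h t - g t) t = sol h t - sol g t"
proof -
  have c: "continuous_on UNIV (\<lambda>t. (mean f - f t) / \<sigma> t)" if "continuous_on UNIV f" for f
    by (intro continuous_intros that) auto
  let ?f = "\<lambda>t. sol (\<lambda>t. h t - g t) t - (sol h t - sol g t)"
  have "(?f has_real_derivative 0) (at t)" for t
    unfolding sol_def
    by (auto intro!: derivative_eq_intros c assms continuous_intros simp: mean_diff assms diff_divide_distrib)
  from DERIV_isconst_all[of ?f t 0, OF allI[OF this]] show ?thesis by (simp add: sol_def)
qed

lemma sol_cmult:
  assumes "continuous_on UNIV h"
  shows "sol (\<lambda>t. c * h t) t = c * sol h t"
proof -
  have c: "continuous_on UNIV (\<lambda>t. (mean f - f t) / \<sigma> t)" if "continuous_on UNIV f" for f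
    by (intro continuous_intros that) auto
  let ?f = "\<lambda>t. sol (\<lambda>t. c * h t) t - c * sol h t"
  have "(?f has_real_derivative 0) (at t)" for t
    unfolding sol_def
    by (auto intro!: derivative_eq_intros c assms continuous_intros simp: mean_cmult algebra_simps diff_divide_distrib)
  from DERIV_isconst_all[of ?f t 0, OF allI[OF this]] show ?thesis by (simp add: sol_def)
qed

text \<open>With \<open>v = exp (f (2\<theta>))\<close> and \<open>f' = g / \<sigma>\<close> one has
  \<open>P f'' = \<sigma> g' + Y g\<close>, while the first-order term of the eigenvalue equation
  contributes \<open>(l - 1) Y g\<close> after division by 4. The two sum to
  \<open>\<sigma> g' + l Y g\<close>; \<open>Q\<close> collects everything but
  \<open>\<sigma> g'\<close>.\<close>

definition Q where
  "Q l g t = (g t)\<^sup>2 + l * Y t * g t - l/2 * (k\<^sup>2 * (sin t)\<^sup>2) - l\<^sup>2/4 * (k\<^sup>2 * (cos t)\<^sup>2)"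

text \<open>A ball among the odd pi-periodic continuous functions. As \<open>Y\<close> is odd, odd
  \<open>g\<close> makes \<open>Q l g\<close> even, and \<open>sol\<close> leads back to odd
  functions.\<close>

definition adm where
  "adm C g \<longleftrightarrow> continuous_on UNIV g \<and> (\<forall>t. g (- t) = - g t) \<and> (\<forall>t. g (t + pi) = g t) \<and> (\<forall>t. \<bar>g t\<bar> \<le> C)"

lemma Q_sym:
  assumes "adm C g"
  shows "continuous_on UNIV (Q l g)" "Q l g (- t) = Q l g t" "Q l g (t + pi) = Q l g t"
  using assms unfolding Q_def[abs_def] adm_def by (auto intro!: continuous_intros)

end

section \<open>The positive eigenfunction\<close>

text \<open>Makes pointwise conditions closed in the sup norm, hence the set of admissible functions
  complete.\<close>

lemma isCont_eval_bcontfun: "continuous_on UNIV (\<lambda>x :: real \<Rightarrow>\<^sub>C real. x t)"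
proof (rule continuous_on_iff[THEN iffD2], intro ballI allI impI)
  fix x :: "real \<Rightarrow>\<^sub>C real" and e :: real
  assume "e > 0"
  then show "\<exists>d>0. \<forall>x'\<in>UNIV. dist x' x < d \<longrightarrow> dist (x' t) (x t) < e"
    using dist_fun_lt_imp_dist_val_lt by blast
qed

context modulus
begin

text \<open>Only the \<open>sin\<close> term is linear in \<open>l\<close>, and it costs at most
  half of \<open>|l|\<close>; under the smallness condition the quadratic terms fit into the other
  half. Together with \<open>sol_bound\<close> the radius \<open>L * |l|\<close> reproduces
  itself.\<close>

lemma Q_bound:
  assumes g: "adm (L * \<bar>l\<bar>) g" and l: "\<bar>l\<bar> * (4 * (L\<^sup>2 + L/k' + 1)) \<le> 1"
  shows "\<bar>Q l g t\<bar> \<le> \<bar>l\<bar>"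
proof -
  have gt: "\<bar>g t\<bar> \<le> L * \<bar>l\<bar>" using g by (simp add: adm_def)
  have "(g t)\<^sup>2 \<le> (L * \<bar>l\<bar>)\<^sup>2" using gt by (rule abs_le_square_iff[THEN iffD1, OF order_trans]) simp
  moreover have "\<bar>l * Y t * g t\<bar> \<le> \<bar>l\<bar> * (1/k') * (L * \<bar>l\<bar>)"
    unfolding abs_mult using gt Y_bound[of t] k'_pos by (intro mult_mono) auto
  moreover have "0 \<le> k\<^sup>2 * (sin t)\<^sup>2" "k\<^sup>2 * (sin t)\<^sup>2 \<le> 1" "0 \<le> k\<^sup>2 * (cos t)\<^sup>2" "k\<^sup>2 * (cos t)\<^sup>2 \<le> 1"
    using k2 k0 k1 by (auto intro!: mult_le_one simp: abs_square_le_1)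
  then have "\<bar>l/2 * (k\<^sup>2 * (sin t)\<^sup>2)\<bar> \<le> \<bar>l\<bar>/2" "\<bar>l\<^sup>2/4 * (k\<^sup>2 * (cos t)\<^sup>2)\<bar> \<le> l\<^sup>2/4"
    by (auto simp: abs_mult intro!: mult_left_le)
  ultimately have "\<bar>Q l g t\<bar> \<le> (L * \<bar>l\<bar>)\<^sup>2 + \<bar>l\<bar> * (1/k') * (L * \<bar>l\<bar>) + \<bar>l\<bar>/2 + l\<^sup>2/4"
    unfolding Q_def by (smt (verit) zero_le_power2)
  also have "\<dots> = \<bar>l\<bar> * (\<bar>l\<bar> * (L\<^sup>2 + L/k') + 1/2 + \<bar>l\<bar>/4)"
    by (simp add: power2_eq_square algebra_simps abs_mult_self_eq)
  also have "\<dots> \<le> \<bar>l\<bar> * 1"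
  proof (rule mult_left_mono)
    have "0 \<le> \<bar>l\<bar> * (L\<^sup>2 + L/k')" using L_pos k'_pos by simp
    moreover have "\<bar>l\<bar> * (4 * (L\<^sup>2 + L/k' + 1)) = 4 * (\<bar>l\<bar> * (L\<^sup>2 + L/k')) + 4 * \<bar>l\<bar>"
      by (simp add: algebra_simps)
    ultimately show "\<bar>l\<bar> * (L\<^sup>2 + L/k') + 1/2 + \<bar>l\<bar>/4 \<le> 1" using l by linarith
  qed simp
  finally show ?thesis by simp
qed

lemma sol_Q_adm:
  assumes g: "adm (L * \<bar>l\<bar>) g" and l: "\<bar>l\<bar> * (4 * (L\<^sup>2 + L/k' + 1)) \<le> 1"
  shows "adm (L * \<bar>l\<bar>) (sol (Q l g))"
  using sol_cont[OF Q_sym[OF g], where S = UNIV] sol_odd[OF Q_sym[OF g]] sol_per[OF Q_sym[OF g]]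
    sol_bound[OF Q_sym[OF g] Q_bound[OF assms]]
  by (simp add: adm_def)

text \<open>The difference factors as \<open>(g + h + l Y) (g - h)\<close>, and the first factor is
  O(l).\<close>

lemma Q_lipschitz:
  assumes g: "adm (L * \<bar>l\<bar>) g" and h: "adm (L * \<bar>l\<bar>) h" and e: "\<And>t. \<bar>g t - h t\<bar> \<le> e"
  shows "\<bar>Q l g t - Q l h t\<bar> \<le> \<bar>l\<bar> * (2 * L + 1/k') * e"
proof -
  have "Q l g t - Q l h t = (g t + h t + l * Y t) * (g t - h t)"
    by (simp add: Q_def algebra_simps power2_eq_square)
  moreover have "\<bar>g t\<bar> \<le> L * \<bar>l\<bar>" "\<bar>h t\<bar> \<le> L * \<bar>l\<bar>" using g h by (auto simp: adm_def)
  moreover have "\<bar>l * Y t\<bar> \<le> \<bar>l\<bar> * (1/k')"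
    unfolding abs_mult using Y_bound by (intro mult_left_mono) auto
  ultimately have "\<bar>g t + h t + l * Y t\<bar> \<le> \<bar>l\<bar> * (2 * L + 1/k')"
    by (simp add: algebra_simps)
  then have "\<bar>g t + h t + l * Y t\<bar> * \<bar>g t - h t\<bar> \<le> \<bar>l\<bar> * (2 * L + 1/k') * e"
    using e[of t] by (intro mult_mono) auto
  then show ?thesis by (simp add: \<open>Q l g t - Q l h t = _\<close> abs_mult)
qed

lemma fixed_point_exists:
  "\<exists>l0>0. \<forall>l. \<bar>l\<bar> \<le> l0 \<longrightarrow> (\<exists>g. adm (L * \<bar>l\<bar>) g \<and> (\<forall>t. g t = sol (Q l g) t))"
proof -
  \<comment> \<open>Sum of two requirements: the first part keeps the ball invariant, the second
    makes the contraction factor at most 1/2.\<close>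
  define c where "c = 4 * (L\<^sup>2 + L/k' + 1) + 2 * L * (2 * L + 1/k')"
  have c: "c > 0" using L_pos k'_pos by (simp add: c_def add_pos_pos)
  have "\<exists>g. adm (L * \<bar>l\<bar>) g \<and> (\<forall>t. g t = sol (Q l g) t)" if "\<bar>l\<bar> \<le> 1 / c" for l
  proof -
    have lc: "\<bar>l\<bar> * c \<le> 1" using c that by (simp add: field_simps)
    have l1: "\<bar>l\<bar> * (4 * (L\<^sup>2 + L/k' + 1)) \<le> 1" and l2: "L * (\<bar>l\<bar> * (2 * L + 1/k')) \<le> 1/2"
    proof -
      have "0 \<le> \<bar>l\<bar> * (4 * (L\<^sup>2 + L/k' + 1))" "0 \<le> L * (\<bar>l\<bar> * (2 * L + 1/k'))"
        using L_pos k'_pos by auto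
      moreover have "\<bar>l\<bar> * c = \<bar>l\<bar> * (4 * (L\<^sup>2 + L/k' + 1)) + 2 * (L * (\<bar>l\<bar> * (2 * L + 1/k')))"
        by (simp add: c_def algebra_simps)
      ultimately show "\<bar>l\<bar> * (4 * (L\<^sup>2 + L/k' + 1)) \<le> 1" "L * (\<bar>l\<bar> * (2 * L + 1/k')) \<le> 1/2"
        using lc by linarith+
    qed
    define A where "A = {x :: real \<Rightarrow>\<^sub>C real. adm (L * \<bar>l\<bar>) x}"
    define T where "T = (\<lambda>x :: real \<Rightarrow>\<^sub>C real. Bcontfun (sol (Q l x)))"
    have T: "apply_bcontfun (T x) = sol (Q l x)" if "x \<in> A" for x
    proof -
      have "adm (L * \<bar>l\<bar>) (sol (Q l x))" using that sol_Q_adm[OF _ l1] by (simp add: A_def)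
      then have "sol (Q l x) \<in> bcontfun" by (intro bcontfun_normI[where b = "L * \<bar>l\<bar>"]) (auto simp: adm_def)
      then show ?thesis by (simp add: T_def Bcontfun_inverse)
    qed
    have "complete A"
      unfolding complete_eq_closed
      unfolding A_def adm_def
      by (auto intro!: closed_Collect_conj closed_Collect_all closed_Collect_le closed_Collect_eq
          continuous_intros isCont_eval_bcontfun)
    have "0 \<in> A" using L_pos by (simp add: A_def adm_def)
    have TA: "T ` A \<subseteq> A" using T sol_Q_adm[OF _ l1] by (auto simp: A_def)
    have dT: "dist (T x) (T y) \<le> 1/2 * dist x y" if "x \<in> A" "y \<in> A" for x y
    proof (rule dist_bound)
      fix t
      have xy: "adm (L * \<bar>l\<bar>) x" "adm (L * \<bar>l\<bar>) y" using that by (auto simp: A_def)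
      have "\<bar>x t - y t\<bar> \<le> dist x y" for t using dist_bounded[of x t y] by (simp add: dist_real_def)
      from Q_lipschitz[OF xy this] have b: "\<bar>Q l x t - Q l y t\<bar> \<le> \<bar>l\<bar> * (2 * L + 1/k') * dist x y" for t .
      have "\<bar>sol (\<lambda>t. Q l x t - Q l y t) t\<bar> \<le> L * (\<bar>l\<bar> * (2 * L + 1/k') * dist x y)"
        by (rule sol_bound[OF _ _ _ b]) (use Q_sym[OF xy(1)] Q_sym[OF xy(2)] in \<open>auto intro: continuous_intros\<close>)
      also have "\<dots> \<le> 1/2 * dist x y"
        using mult_right_mono[OF l2, of "dist x y"] by (simp add: mult.assoc)
      finally show "dist (T x t) (T y t) \<le> 1/2 * dist x y"
        using that by (simp add: T dist_real_def sol_diff[OF Q_sym(1)[OF xy(1)] Q_sym(1)[OF xy(2)]])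
    qed
    have "\<exists>!x\<in>A. T x = x"
      using \<open>0 \<in> A\<close> by (intro Banach_fix[where c = "1/2"] \<open>complete A\<close> TA dT) auto
    then obtain x where "x \<in> A" "T x = x" by auto
    with T[OF \<open>x \<in> A\<close>] show "\<exists>g. adm (L * \<bar>l\<bar>) g \<and> (\<forall>t. g t = sol (Q l g) t)"
      by (intro exI[of _ "apply_bcontfun x"]) (simp add: A_def)
  qed
  then show ?thesis using c by (intro exI[of _ "1 / c"]) auto
qed

section \<open>Smoothness of the eigenfunction and maximality of its eigenvalue\<close>

lemma ndiff_sigma: "ndiff n P" "ndiff n \<sigma>" "ndiff n (\<lambda>t. inverse (\<sigma> t))" "ndiff n Y"
proof -
  show P: "ndiff n P"
    unfolding P_def[abs_def] by (intro ndiff_diff ndiff_mult ndiff_const ndiff_power ndiff_sin_cos)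
  have s: "\<sigma> = (\<lambda>t. P t powr (1/2))"
    using P_bounds(3) by (auto simp: fun_eq_iff \<sigma>_def powr_half_sqrt less_imp_le)
  have i: "(\<lambda>t. inverse (\<sigma> t)) = (\<lambda>t. P t powr (- (1/2)))"
    by (simp add: s powr_minus)
  show "ndiff n \<sigma>" unfolding s by (rule ndiff_powr[OF P_bounds(3) P])
  show i: "ndiff n (\<lambda>t. inverse (\<sigma> t))" unfolding i by (rule ndiff_powr[OF P_bounds(3) P])
  show "ndiff n Y"
    unfolding Y_def[abs_def] divide_inverse by (intro ndiff_mult i ndiff_const ndiff_sin_cos)
qed

text \<open>The fixed-point equation is a differential equation, so \<open>g\<close> is smooth by
  bootstrapping and the exponential of its weighted primitive is a positive eigenfunction. The
  factor 4 comes from two derivatives in the doubled angle.\<close>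

lemma leading_eigenvalue_eq:
  assumes g: "adm C g" and fp: "\<And>t. g t = sol (Q l g) t"
  shows "leading_eigenvalue k l = 4 * mean (Q l g)"
proof -
  define \<nu> where "\<nu> = mean (Q l g)"
  have "g = sol (Q l g)" using fp by auto
  then have dg: "(g has_real_derivative (\<nu> - Q l g t) * inverse (\<sigma> t)) (at t)" for t
    using DERIV_sol[OF Q_sym[OF g], of l t] by (simp add: \<nu>_def divide_inverse)
  have ndg: "ndiff n g" for n
  proof (induction n)
    case (Suc n)
    show ?case
      by (rule ndiffI[OF dg], unfold Q_def)
        (intro ndiff_diff ndiff_add ndiff_mult ndiff_power ndiff_const ndiff_sin_cos ndiff_sigma Suc)
  qed simp
  define f where "f = primitive (\<lambda>t. g t / \<sigma> t)"
  have cg: "continuous_on UNIV (\<lambda>t. g t / \<sigma> t)"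
    using g by (intro continuous_intros) (auto simp: adm_def)
  have df: "(f has_real_derivative g t / \<sigma> t) (at t)" for t
    unfolding f_def by (rule DERIV_primitive[OF cg])
  \<comment> \<open>The integral of the odd function \<open>g / \<sigma>\<close> over a period
    vanishes; in the form of evenness of \<open>f\<close> this gives the periodicity.\<close>
  have "f (- t) = f t" for t
    unfolding f_def by (rule primitive_even[OF cg]) (use g in \<open>simp add: adm_def\<close>)
  then have fper: "f (t + pi) = f t" for t
    unfolding f_def by (intro primitive_periodic[OF cg]) (use g in \<open>auto simp: adm_def\<close>)
  have "ndiff n f" for n
    by (rule ndiff_mono[of "Suc n"], rule ndiffI[OF df], unfold divide_inverse)
      (auto intro: ndiff_mult ndg ndiff_sigma)
  define v where "v = (\<lambda>t. exp (f (2 * t)))"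
  have ndv: "ndiff n v" for n
    unfolding v_def by (intro ndiff_exp ndiff_scale \<open>ndiff n f\<close>)
  have vper: "v (t + pi) = v t" for t
    using fper[of "2 * t"] fper[of "2 * t + pi"] by (simp add: v_def algebra_simps)
  define v' where "v' = (\<lambda>t. v t * (2 * (g (2 * t) / \<sigma> (2 * t))))"
  have dv: "(v has_real_derivative v' t) (at t)" for t
    unfolding v_def v'_def by (auto intro!: derivative_eq_intros DERIV_chain2[OF df])
  \<comment> \<open>The derivative of \<open>g / \<sigma>\<close> has been rewritten by the
    fixed-point equation as \<open>(\<nu> - Q + g Y) / P\<close>.\<close>
  define v'' where "v'' = (\<lambda>t. v t * ((2 * (g (2 * t) / \<sigma> (2 * t)))\<^sup>2
     + 4 * ((\<nu> - Q l g (2 * t) + g (2 * t) * Y (2 * t)) / P (2 * t))))"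
  have dv': "(v' has_real_derivative v'' t) (at t)" for t
    unfolding v'_def v''_def
    by (auto intro!: derivative_eq_intros dv DERIV_chain2[OF dg]
        simp: v'_def field_simps power2_eq_square sigma_sq[unfolded power2_eq_square, symmetric])
  define w where "w = (\<lambda>x. norm x powr l * v (angle x))"
  have pw: "polar_form l v w" by (simp add: polar_form_def w_def)
  have "w \<in> V l" by (rule polar_in_V[OF ndv vper pw])
  define c where "c = (\<lambda>t. - k\<^sup>2 * l * (2 * (sin (2*t))\<^sup>2 + l * (cos (2*t))\<^sup>2))"
  have ode: "4 * \<nu> * v t = P (2 * t) * v'' t + (l - 1) * k\<^sup>2 * sin (4 * t) * v' t + c t * v t" for t
  proof -
    have s4: "sin (4 * t) = 2 * sin (2 * t) * cos (2 * t)"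
      using sin_double[of "2 * t"] by simp
    have "P (2 * t) * v'' t = v t * (4 * (g (2 * t))\<^sup>2 + 4 * (\<nu> - Q l g (2 * t) + g (2 * t) * Y (2 * t)))"
      unfolding v''_def by (simp add: field_simps sigma_sq[symmetric])
    moreover have "k\<^sup>2 * sin (4 * t) * v' t = v t * (4 * (Y (2 * t) * g (2 * t)))"
      unfolding v'_def s4 Y_def by simp
    ultimately show ?thesis
      unfolding mult.assoc[of "l - 1"] by (simp add: c_def Q_def power2_eq_square algebra_simps)
  qed
  have ode': "m * u t = P (2 * t) * u'' t + (l - 1) * k\<^sup>2 * sin (4 * t) * u' t + c t * u t \<longleftrightarrow>
      m * u t = (1 - k\<^sup>2 * (sin (2*t))\<^sup>2) * u'' t + (l - 1) * k\<^sup>2 * sin (4*t) * u' t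
       - k\<^sup>2 * l * (2 * (sin (2*t))\<^sup>2 + l * (cos (2*t))\<^sup>2) * u t" for m t and u u' u'' :: "real \<Rightarrow> real"
    by (simp add: P_def c_def algebra_simps)
  have vper2: "u (t + 2 * pi) = u t" if "\<And>t. u (t + pi) = u t" for u :: "real \<Rightarrow> real" and t
    using that[of t] that[of "t + pi"] by (simp add: algebra_simps)
  have "\<exists>x. x \<noteq> 0 \<and> w x \<noteq> 0"
    by (intro exI[of _ "circ 0"]) (simp add: w_def v_def)
  moreover have "\<forall>x. x \<noteq> 0 \<longrightarrow> 4 * \<nu> * w x = K12 (K12 w) x - k\<^sup>2 * A12 (A12 w) x"
    unfolding eigen_polar[OF vper2[of v, OF vper] dv dv' pw] using ode[unfolded ode'] by blast
  ultimately have "is_eigenvalue k l (4 * \<nu>)"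
    using \<open>w \<in> V l\<close> by (auto simp: is_eigenvalue_def)
  moreover have "m \<le> 4 * \<nu>" if m: "is_eigenvalue k l m" for m
  proof -
    obtain u x where u: "u \<in> V l" "x \<noteq> 0" "u x \<noteq> 0"
        "\<forall>x. x \<noteq> 0 \<longrightarrow> m * u x = K12 (K12 u) x - k\<^sup>2 * A12 (A12 u) x"
      using m by (auto simp: is_eigenvalue_def)
    obtain y y' y'' where y: "\<And>t. y (t + pi) = y t" "\<And>t. (y has_real_derivative y' t) (at t)"
        "\<And>t. (y' has_real_derivative y'' t) (at t)" "polar_form l y u"
      using V_polar[OF u(1)] by blast
    have "y (angle x) \<noteq> 0" using u(2,3) y(4) by (auto simp: polar_form_def)
    moreover have "\<And>t. m * y t = P (2 * t) * y'' t + (l - 1) * k\<^sup>2 * sin (4 * t) * y' t + c t * y t"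
      using u(4) unfolding eigen_polar[OF vper2[of y, OF y(1)] y(2,3,4)] ode' by blast
    ultimately show ?thesis
      using max_principle[OF dv dv' y(2,3) vper y(1) _ P_bounds(3) ode] by (auto simp: v_def)
  qed
  ultimately show ?thesis
    unfolding leading_eigenvalue_def \<nu>_def[symmetric] by (intro Greatest_equality) auto
qed

end

section \<open>Expansion of the leading eigenvalue\<close>

context modulus
begin

definition h1 where "h1 t = - (k\<^sup>2 * (sin t)\<^sup>2) / 2"

text \<open>\<open>h1\<close> is the coefficient of \<open>l\<close> in \<open>Q l g\<close> when
  \<open>g = O(l)\<close>, so \<open>sol h1\<close> is the linear part of the fixed point. The
  factor -2 turns it into the zeta function, characterised by
  \<open>\<sigma> Z' = dn\<^sup>2 - E/K\<close> and \<open>Z 0 = 0\<close>.\<close>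

definition Z where "Z t = - 2 * sol h1 t"

lemma h1_sym: "continuous_on UNIV h1" "h1 (- t) = h1 t" "h1 (t + pi) = h1 t"
  unfolding h1_def[abs_def] by (auto intro!: continuous_intros)

lemma h1_P: "h1 t = (P t - 1) / 2"
  by (simp add: h1_def P_def)

lemma mean_P: "mean P = EE / KK"
proof -
  have "(\<lambda>t. P t / \<sigma> t) = \<sigma>"
    by (simp add: fun_eq_iff sigma_sq[symmetric] power2_eq_square)
  then show ?thesis by (simp add: mean_def EE_eq)
qed

lemma cont_P_UNIV: "continuous_on UNIV P" "continuous_on UNIV Y" "continuous_on UNIV \<sigma>"
  using cont_P[of UNIV "\<lambda>x::real. x"] cont_Y[of UNIV "\<lambda>x::real. x"] cont_sigma[of UNIV "\<lambda>x::real. x"]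
  by auto

lemma mean_h1: "mean h1 = (EE / KK - 1) / 2"
proof -
  have "h1 = (\<lambda>t. 1/2 * (P t - 1))" by (simp add: fun_eq_iff h1_P)
  then show ?thesis
    using mean_cmult[of "1/2" "\<lambda>t. P t - 1"] mean_diff[OF cont_P_UNIV(1), of "\<lambda>t. 1"]
    by (simp add: mean_const mean_P)
qed

lemma h1_bound: "\<bar>h1 t\<bar> \<le> 1"
  using P_bounds[of t] k2 by (simp add: h1_P)

lemma DERIV_Z: "(Z has_real_derivative (P t - EE / KK) / \<sigma> t) (at t)"
proof -
  have "(Z has_real_derivative - 2 * ((mean h1 - h1 t) / \<sigma> t)) (at t)"
    unfolding Z_def[abs_def] by (rule DERIV_cmult[OF DERIV_sol[OF h1_sym]])
  then show ?thesis by (rule DERIV_cong) (simp add: mean_h1 h1_P field_simps)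
qed

lemma cont_Z: "continuous_on S Z"
  by (meson DERIV_isCont DERIV_Z continuous_at_imp_continuous_on)

lemma Z_0 [simp]: "Z 0 = 0" and Z_end [simp]: "Z (pi/2) = 0"
  using sol_end[OF h1_sym] by (auto simp: Z_def sol_def)

lemma mean_cos: "mean (\<lambda>t. k\<^sup>2 * (cos t)\<^sup>2 / 4) = (EE / KK - 1 + k\<^sup>2) / 4"
proof -
  have "(\<lambda>t. k\<^sup>2 * (cos t)\<^sup>2 / 4) = (\<lambda>t. 1/4 * (P t - (1 - k\<^sup>2)))"
    by (simp add: fun_eq_iff P_def cos_squared_eq field_simps)
  then show ?thesis
    using mean_cmult[of "1/4" "\<lambda>t. P t - (1 - k\<^sup>2)"] mean_diff[OF cont_P_UNIV(1), of "\<lambda>t. 1 - k\<^sup>2"]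
    by (simp add: mean_const mean_P)
qed

text \<open>A first-order approximation of \<open>g\<close> is enough: \<open>g - l * sol h1\<close>
  is \<open>sol\<close> of the quadratic part of \<open>Q\<close>, hence O(l^2), and since
  \<open>Q\<close> has a derivative of size O(l) in \<open>g\<close>, replacing \<open>g\<close> by
  \<open>l * sol h1\<close> changes the mean only by O(l^3).\<close>

lemma leading_eigenvalue_expansion:
  "\<exists>l0>0. \<exists>C>0. \<forall>l. \<bar>l\<bar> \<le> l0 \<longrightarrow>
     \<bar>leading_eigenvalue k l - ((2 * (EE / KK) - 2) * l
        + (mean (\<lambda>t. (Z t)\<^sup>2 - 2 * Y t * Z t) + 1 - k\<^sup>2 - EE / KK) * l\<^sup>2)\<bar> \<le> C * \<bar>l\<bar> ^ 3"
proof -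
  obtain l0 where l0: "l0 > 0" "\<And>l. \<bar>l\<bar> \<le> l0 \<Longrightarrow> \<exists>g. adm (L * \<bar>l\<bar>) g \<and> (\<forall>t. g t = sol (Q l g) t)"
    using fixed_point_exists by blast
  define c1 where "c1 = L\<^sup>2 + L/k' + 1/4"
  define C where "C = 4 * (L * c1 * (2 * L + 1/k'))"
  have c1: "c1 > 0" using L_pos k'_pos by (simp add: c1_def add_pos_pos)
  then have C: "C > 0" using L_pos k'_pos by (simp add: C_def add_pos_pos)
  have main: "\<bar>leading_eigenvalue k l - ((2 * (EE / KK) - 2) * l
        + (mean (\<lambda>t. (Z t)\<^sup>2 - 2 * Y t * Z t) + 1 - k\<^sup>2 - EE / KK) * l\<^sup>2)\<bar> \<le> C * \<bar>l\<bar> ^ 3"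
    if l: "\<bar>l\<bar> \<le> l0" for l
  proof -
    obtain g where g: "adm (L * \<bar>l\<bar>) g" and fp: "\<And>t. g t = sol (Q l g) t" using l0(2)[OF l] by blast
    have gb: "\<bar>g t\<bar> \<le> L * \<bar>l\<bar>" for t using g by (simp add: adm_def)
    have cg [continuous_intros]: "continuous_on UNIV g" using g by (simp add: adm_def)
    note [continuous_intros] = cont_P_UNIV h1_sym(1) sol_cont[OF h1_sym] Q_sym(1)[OF g]
    let ?g1 = "sol h1"
    let ?r = "\<lambda>t. Q l g t - l * h1 t"
    have r: "?r t = (g t)\<^sup>2 + l * Y t * g t - l\<^sup>2 * (k\<^sup>2 * (cos t)\<^sup>2 / 4)" for t
      by (simp add: Q_def h1_def algebra_simps)
    have rb: "\<bar>?r t\<bar> \<le> c1 * l\<^sup>2" for t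
    proof -
      have "(g t)\<^sup>2 \<le> (L * \<bar>l\<bar>)\<^sup>2" using gb by (rule abs_le_square_iff[THEN iffD1, OF order_trans]) simp
      moreover have "\<bar>l * Y t * g t\<bar> \<le> \<bar>l\<bar> * (1/k') * (L * \<bar>l\<bar>)"
        unfolding abs_mult using gb[of t] Y_bound[of t] k'_pos by (intro mult_mono) auto
      moreover have "k\<^sup>2 * (cos t)\<^sup>2 \<le> 1"
        using k0 k1 by (auto intro!: mult_le_one simp: abs_square_le_1)
      then have "\<bar>l\<^sup>2 * (k\<^sup>2 * (cos t)\<^sup>2 / 4)\<bar> \<le> l\<^sup>2 * (1/4)"
        unfolding abs_mult using k2 by (intro mult_mono) auto
      ultimately have "\<bar>?r t\<bar> \<le> (L * \<bar>l\<bar>)\<^sup>2 + \<bar>l\<bar> * (1/k') * (L * \<bar>l\<bar>) + l\<^sup>2 * (1/4)"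
        unfolding r by (smt (verit) zero_le_power2)
      also have "\<dots> = c1 * l\<^sup>2"
        by (simp add: c1_def power2_eq_square algebra_simps abs_mult_self_eq)
      finally show ?thesis .
    qed
    have d: "\<bar>g t - l * ?g1 t\<bar> \<le> L * (c1 * l\<^sup>2)" for t
    proof -
      have "g t - l * ?g1 t = sol (\<lambda>t. Q l g t - l * h1 t) t"
        unfolding fp[of t] by (subst sol_diff) (auto intro!: continuous_intros simp: sol_cmult h1_sym)
      moreover have "\<bar>sol ?r t\<bar> \<le> L * (c1 * l\<^sup>2)"
        by (rule sol_bound[OF _ _ _ rb]) (use h1_sym Q_sym[OF g] in \<open>auto intro!: continuous_intros\<close>)
      ultimately show ?thesis by simp
    qed
    \<comment> \<open>The difference of \<open>g\<^sup>2 + l Y g\<close> at \<open>g\<close> and at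
      \<open>l * sol h1\<close>, in factored form.\<close>
    let ?R = "\<lambda>t. (g t - l * ?g1 t) * (g t + l * ?g1 t + l * Y t)"
    have R: "\<bar>?R t\<bar> \<le> L * (c1 * l\<^sup>2) * (\<bar>l\<bar> * (2 * L + 1/k'))" for t
    proof -
      have "\<bar>l * ?g1 t\<bar> \<le> \<bar>l\<bar> * (L * 1)" "\<bar>l * Y t\<bar> \<le> \<bar>l\<bar> * (1/k')"
        unfolding abs_mult by (rule mult_left_mono[OF sol_bound[OF h1_sym h1_bound] abs_ge_zero],
            rule mult_left_mono[OF Y_bound abs_ge_zero])
      then have "\<bar>g t + l * ?g1 t + l * Y t\<bar> \<le> \<bar>l\<bar> * (2 * L + 1/k')"
        using gb[of t] by (simp add: algebra_simps)
      then show ?thesis unfolding abs_mult using d c1 L_pos by (intro mult_mono) auto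
    qed
    have eq: "Q l g t = l * h1 t + l\<^sup>2 * (1/4 * ((Z t)\<^sup>2 - 2 * Y t * Z t) - k\<^sup>2 * (cos t)\<^sup>2 / 4) + ?R t" for t
      by (simp add: Q_def h1_def Z_def field_simps power2_eq_square)
    have "mean (Q l g) = mean (\<lambda>t. l * h1 t + l\<^sup>2 * (1/4 * ((Z t)\<^sup>2 - 2 * Y t * Z t) - k\<^sup>2 * (cos t)\<^sup>2 / 4) + ?R t)"
      using eq by presburger
    also have "\<dots> = l * mean h1 + l\<^sup>2 * (1/4 * mean (\<lambda>t. (Z t)\<^sup>2 - 2 * Y t * Z t)
          - mean (\<lambda>t. k\<^sup>2 * (cos t)\<^sup>2 / 4)) + mean ?R"
      by (subst mean_add mean_diff mean_cmult; (intro continuous_intros cont_Z; simp)?)+ simp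
    finally have "leading_eigenvalue k l - ((2 * (EE / KK) - 2) * l
        + (mean (\<lambda>t. (Z t)\<^sup>2 - 2 * Y t * Z t) + 1 - k\<^sup>2 - EE / KK) * l\<^sup>2) = 4 * mean ?R"
      unfolding leading_eigenvalue_eq[OF g fp] mean_h1 mean_cos by algebra
    moreover have "\<bar>mean ?R\<bar> \<le> L * (c1 * l\<^sup>2) * (\<bar>l\<bar> * (2 * L + 1/k'))"
      by (rule mean_bound[OF _ R]) (auto intro!: continuous_intros)
    moreover have "4 * (L * (c1 * l\<^sup>2) * (\<bar>l\<bar> * (2 * L + 1/k'))) = C * \<bar>l\<bar> ^ 3"
    proof -
      have "l\<^sup>2 * \<bar>l\<bar> = \<bar>l\<bar> ^ 3" by (simp add: power3_eq_cube power2_eq_square flip: abs_mult)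
      then show ?thesis unfolding C_def by algebra
    qed
    ultimately show ?thesis by (simp add: abs_mult)
  qed
  show ?thesis using l0(1) C main by blast
qed

text \<open>The cubic error is absorbed by the little-o; the summands
  \<open>l + l\<^sup>2 / 2\<close> of \<open>Lam\<close> turn -2 into -1 and 1 into 3/2.\<close>

lemma Lam_expansion:
  assumes "mean (\<lambda>t. (Z t)\<^sup>2 - 2 * Y t * Z t) = S"
  shows "(\<lambda>l. Lam k l - ((2 * (EE / KK) - 1) * l + (3/2 - k\<^sup>2 - EE / KK + S) * l\<^sup>2)) \<in> o[at 0](\<lambda>l. l\<^sup>2)"
proof (rule landau_o.smallI)
  obtain l0 C where l0: "l0 > 0" "C > 0" "\<And>l. \<bar>l\<bar> \<le> l0 \<Longrightarrow>
     \<bar>leading_eigenvalue k l - ((2 * (EE / KK) - 2) * l + (S + 1 - k\<^sup>2 - EE / KK) * l\<^sup>2)\<bar> \<le> C * \<bar>l\<bar> ^ 3"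
    using leading_eigenvalue_expansion unfolding assms by blast
  fix c :: real
  assume "c > 0"
  define d where "d = min l0 (c / C)"
  have "d > 0" using l0 \<open>c > 0\<close> by (simp add: d_def)
  have "norm (Lam k l - ((2 * (EE / KK) - 1) * l + (3/2 - k\<^sup>2 - EE / KK + S) * l\<^sup>2)) \<le> c * norm (l\<^sup>2)"
    if "dist l 0 < d" for l
  proof -
    have l: "\<bar>l\<bar> \<le> l0" "C * \<bar>l\<bar> \<le> c" using that l0 by (auto simp: d_def field_simps)
    have "Lam k l - ((2 * (EE / KK) - 1) * l + (3/2 - k\<^sup>2 - EE / KK + S) * l\<^sup>2) =
      leading_eigenvalue k l - ((2 * (EE / KK) - 2) * l + (S + 1 - k\<^sup>2 - EE / KK) * l\<^sup>2)"
      by (simp add: Lam_def algebra_simps)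
    also have "\<bar>\<dots>\<bar> \<le> C * \<bar>l\<bar> ^ 3" by (rule l0(3)[OF l(1)])
    also have "\<dots> = (C * \<bar>l\<bar>) * l\<^sup>2" by (simp add: power3_eq_cube power2_eq_square abs_mult_self_eq)
    also have "\<dots> \<le> c * l\<^sup>2" by (rule mult_right_mono[OF l(2)]) simp
    finally show ?thesis by simp
  qed
  then show "\<forall>\<^sub>F l in at 0. norm (Lam k l - ((2 * (EE / KK) - 1) * l + (3/2 - k\<^sup>2 - EE / KK + S) * l\<^sup>2)) \<le> c * norm (l\<^sup>2)"
    using \<open>d > 0\<close> unfolding eventually_at by blast
qed

end

section \<open>Fourier analysis in the elliptic variable\<close>

lemma integral_series:
  fixes f :: "nat \<Rightarrow> real \<Rightarrow> real"
  assumes cont: "\<And>n. continuous_on {a..b} (f n)" and bd: "\<And>n x. x \<in> {a..b} \<Longrightarrow> \<bar>f n x\<bar> \<le> M n"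
    and "summable M"
  shows "continuous_on {a..b} (\<lambda>x. \<Sum>n. f n x)"
    and "(\<lambda>n. integral {a..b} (f n)) sums integral {a..b} (\<lambda>x. \<Sum>n. f n x)"
proof -
  have ul: "uniform_limit {a..b} (\<lambda>n x. \<Sum>i<n. f i x) (\<lambda>x. \<Sum>n. f n x) sequentially"
    using bd \<open>summable M\<close> by (intro Weierstrass_m_test) auto
  have c: "continuous_on {a..b} (\<lambda>x. \<Sum>i<n. f i x)" for n
    by (intro continuous_intros cont)
  show cl: "continuous_on {a..b} (\<lambda>x. \<Sum>n. f n x)"
    by (rule uniform_limit_theorem[OF _ ul]) (auto simp: c)
  obtain I J where IJ: "\<And>n. ((\<lambda>x. \<Sum>i<n. f i x) has_integral I n) {a..b}"
      "((\<lambda>x. \<Sum>n. f n x) has_integral J) {a..b}" "I \<longlonglongrightarrow> J"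
    using uniform_limit_integral[OF ul c] by (metis sequentially_bot)
  have "I = (\<lambda>n. \<Sum>i<n. integral {a..b} (f i))"
  proof
    show "I n = (\<Sum>i<n. integral {a..b} (f i))" for n
      using integral_unique[OF IJ(1)[of n]]
      by (subst (asm) integral_sum) (auto intro: integrable_continuous_real cont)
  qed
  then have "(\<lambda>n. integral {a..b} (f n)) sums J"
    using IJ(3) by (simp add: sums_def)
  then show "(\<lambda>n. integral {a..b} (f n)) sums integral {a..b} (\<lambda>x. \<Sum>n. f n x)"
    using integral_unique[OF IJ(2)] by simp
qed

context modulus
begin

text \<open>This is pi F(t, k) / K. It maps the quarter period onto \<open>{0..pi}\<close> and turns
  the weight \<open>1/\<sigma>\<close> into a constant, so the usual trigonometric orthogonality
  holds under \<open>J\<close>.\<close>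

definition X where "X t = pi / KK * primitive (\<lambda>t. 1 / \<sigma> t) t"

lemma KK_nz [simp]: "KK \<noteq> 0"
  using KK_pos by simp

definition J where "J h = integral {0..pi/2} (\<lambda>t. h t / \<sigma> t)"

lemma mean_J: "mean h = J h / KK"
  by (simp add: mean_def J_def)

lemma DERIV_X [derivative_intros]:
  assumes "(g has_real_derivative g') (at x within S)"
  shows "((\<lambda>x. X (g x)) has_real_derivative pi / (KK * \<sigma> (g x)) * g') (at x within S)"
proof -
  have "continuous_on UNIV (\<lambda>t. 1 / \<sigma> t)" by (intro continuous_intros) auto
  then show ?thesis
    unfolding X_def using KK_pos by (auto intro!: derivative_eq_intros assms simp: mult_ac)
qed

lemma cont_X [continuous_intros]: "continuous_on S g \<Longrightarrow> continuous_on S (\<lambda>x. X (g x))" for g :: "'a::t2_space \<Rightarrow> real"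
proof -
  have "continuous_on UNIV X"
    using DERIV_X[OF DERIV_ident] by (intro DERIV_continuous_on[where D = "\<lambda>x. pi / (KK * \<sigma> x) * 1"]) auto
  then show "continuous_on S g \<Longrightarrow> continuous_on S (\<lambda>x. X (g x))"
    by (rule continuous_on_compose2) auto
qed

lemma X_0 [simp]: "X 0 = 0" and X_end [simp]: "X (pi/2) = pi"
  using KK_pos by (auto simp: X_def primitive_nonneg KK_eq)

lemma X_strict_mono: "s < t \<Longrightarrow> X s < X t"
  by (rule DERIV_pos_imp_increasing[of s t X])
    (use DERIV_X[OF DERIV_ident] KK_pos sigma_bounds(1) in \<open>fastforce\<close>)+

lemma X_mono: "s \<le> t \<Longrightarrow> X s \<le> X t"
  using X_strict_mono[of s t] by (cases "s = t") auto

lemma X_range: "t \<in> {0..pi/2} \<Longrightarrow> 0 \<le> X t \<and> X t \<le> pi"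
  using X_mono[of 0 t] X_mono[of t "pi/2"] by simp

lemma J_integrable: "continuous_on {0..pi/2} h \<Longrightarrow> (\<lambda>t. h t / \<sigma> t) integrable_on {0..pi/2}"
  by (intro integrable_continuous_real continuous_intros) auto

lemma J_add: "continuous_on {0..pi/2} h \<Longrightarrow> continuous_on {0..pi/2} g \<Longrightarrow> J (\<lambda>t. h t + g t) = J h + J g"
  unfolding J_def add_divide_distrib by (rule integral_add) (auto intro: J_integrable)

lemma J_diff: "continuous_on {0..pi/2} h \<Longrightarrow> continuous_on {0..pi/2} g \<Longrightarrow> J (\<lambda>t. h t - g t) = J h - J g"
  unfolding J_def diff_divide_distrib by (rule integral_diff) (auto intro: J_integrable)

lemma J_cmult: "J (\<lambda>t. c * h t) = c * J h"
  unfolding J_def by (simp flip: times_divide_eq_right)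

lemma J_const: "J (\<lambda>t. c) = c * KK"
  using mean_const[of c] KK_pos by (simp add: mean_J field_simps)

lemma J_cong: "(\<And>t. t \<in> {0..pi/2} \<Longrightarrow> h t = g t) \<Longrightarrow> J h = J g"
  unfolding J_def by (rule integral_cong) auto

lemma J_series:
  assumes "\<And>n. continuous_on {0..pi/2} (f n)" "\<And>n x. x \<in> {0..pi/2} \<Longrightarrow> \<bar>f n x\<bar> \<le> M n" "summable M"
  shows "(\<lambda>n. J (f n)) sums J (\<lambda>x. \<Sum>n. f n x)"
proof -
  have "(\<lambda>n. integral {0..pi/2} (\<lambda>t. f n t / \<sigma> t)) sums integral {0..pi/2} (\<lambda>t. \<Sum>n. f n t / \<sigma> t)"
  proof (rule integral_series)
    show "continuous_on {0..pi/2} (\<lambda>t. f n t / \<sigma> t)" for n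
      by (intro continuous_intros assms) auto
    show "summable (\<lambda>n. M n / k')" by (rule summable_divide[OF assms(3)])
    show "\<bar>f n t / \<sigma> t\<bar> \<le> M n / k'" if "t \<in> {0..pi/2}" for n t
      using assms(2)[OF that, of n] sigma_bounds[of t] k'_pos by (auto simp: abs_divide intro!: frac_le)
  qed
  moreover have "(\<Sum>n. f n t / \<sigma> t) = (\<Sum>n. f n t) / \<sigma> t" if "t \<in> {0..pi/2}" for t
    using summable_rabs_comparison_test[of "\<lambda>n. f n t" M] assms that
    by (subst suminf_divide) (auto intro: summable_rabs_cancel summable_rabs_comparison_test)
  then have "integral {0..pi/2} (\<lambda>t. \<Sum>n. f n t / \<sigma> t) = J (\<lambda>t. \<Sum>n. f n t)"
    unfolding J_def by (rule integral_cong)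
  ultimately show ?thesis
    by (simp add: J_def)
qed

text \<open>Here \<open>u'\<close> and \<open>w'\<close> are derivatives in the elliptic variable,
  which absorbs the weight of \<open>J\<close>.\<close>

lemma J_parts:
  assumes du: "\<And>t. t \<in> {0..pi/2} \<Longrightarrow> (u has_real_derivative u' t / \<sigma> t) (at t within {0..pi/2})"
    and dw: "\<And>t. t \<in> {0..pi/2} \<Longrightarrow> (w has_real_derivative w' t / \<sigma> t) (at t within {0..pi/2})"
    and c: "continuous_on {0..pi/2} u'" "continuous_on {0..pi/2} w'"
    and bd: "u (pi/2) * w (pi/2) = u 0 * w 0"
  shows "J (\<lambda>t. u' t * w t) = - J (\<lambda>t. u t * w' t)"
proof -
  have cu: "continuous_on {0..pi/2} u" "continuous_on {0..pi/2} w"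
    by (rule DERIV_continuous_on[OF du], simp) (rule DERIV_continuous_on[OF dw], simp)
  have "((\<lambda>t. (u' t * w t + u t * w' t) / \<sigma> t) has_integral (u (pi/2) * w (pi/2) - u 0 * w 0)) {0..pi/2}"
  proof (rule fundamental_theorem_of_calculus)
    show "((\<lambda>t. u t * w t) has_vector_derivative (u' t * w t + u t * w' t) / \<sigma> t) (at t within {0..pi/2})"
      if "t \<in> {0..pi/2}" for t
      unfolding has_real_derivative_iff_has_vector_derivative[symmetric]
      by (auto intro!: derivative_eq_intros du[OF that] dw[OF that] simp: add_divide_distrib mult.commute)
  qed simp
  then have "J (\<lambda>t. u' t * w t + u t * w' t) = 0"
    using bd by (simp add: J_def integral_unique)
  then show ?thesis
    by (subst (asm) J_add) (auto intro!: continuous_intros c cu)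
qed

lemma DERIV_trig_X:
  fixes n :: int
  shows "((\<lambda>t. sin (of_int n * X t)) has_real_derivative (of_int n * pi / KK * cos (of_int n * X t)) / \<sigma> t) (at t within S)"
    and "((\<lambda>t. cos (of_int n * X t)) has_real_derivative (- of_int n * pi / KK * sin (of_int n * X t)) / \<sigma> t) (at t within S)"
  by (auto intro!: derivative_eq_intros simp: field_simps)

lemma sin_X_end [simp]: "sin (of_int n * pi) = (0::real)"
  by (simp add: mult.commute sin_zero_iff_int2)

lemma J_cos_X:
  fixes n :: int
  shows "J (\<lambda>t. cos (of_int n * X t)) = (if n = 0 then KK else 0)"
proof (cases "n = 0")
  case True
  then show ?thesis by (simp add: J_const)
next
  case False
  have "J (\<lambda>t. (of_int n * pi / KK * cos (of_int n * X t)) * 1) = - J (\<lambda>t. sin (of_int n * X t) * 0)"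
    by (rule J_parts) (auto intro!: DERIV_trig_X continuous_intros derivative_eq_intros)
  then have "of_int n * pi / KK * J (\<lambda>t. cos (of_int n * X t)) = 0"
    by (simp only: mult_1_right mult_zero_right J_cmult J_const)
  then show ?thesis using False by simp
qed

lemma J_cos_cos:
  fixes m n :: int
  shows "J (\<lambda>t. cos (of_int m * X t) * cos (of_int n * X t)) =
    ((if m = n then KK else 0) + (if m = - n then KK else 0)) / 2"
proof -
  have "J (\<lambda>t. cos (of_int m * X t) * cos (of_int n * X t)) =
      J (\<lambda>t. 1/2 * (cos (of_int (m - n) * X t) + cos (of_int (m + n) * X t)))"
    by (rule J_cong) (simp add: cos_times_cos field_simps)
  then show ?thesis
    by (simp only: J_cmult) (subst J_add, auto intro!: continuous_intros simp only: J_cos_X, auto)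
qed

lemma J_sin_sin:
  fixes m n :: int
  shows "J (\<lambda>t. sin (of_int m * X t) * sin (of_int n * X t)) =
    ((if m = n then KK else 0) - (if m = - n then KK else 0)) / 2"
proof -
  have "J (\<lambda>t. sin (of_int m * X t) * sin (of_int n * X t)) =
      J (\<lambda>t. 1/2 * (cos (of_int (m - n) * X t) - cos (of_int (m + n) * X t)))"
    by (rule J_cong) (simp add: sin_times_sin field_simps)
  then show ?thesis
    by (simp only: J_cmult) (subst J_diff, auto intro!: continuous_intros simp only: J_cos_X, auto)
qed

text \<open>By Stone--Weierstrass the polynomials in \<open>cos X\<close> are dense in the continuous functions.\<close>

lemma cos_coefficients_zero:
  assumes h: "continuous_on {0..pi/2} h"
    and z: "\<And>n::nat. J (\<lambda>t. h t * cos (of_nat n * X t)) = 0" and "t \<in> {0..pi/2}"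
  shows "h t = 0"
proof -
  have z': "J (\<lambda>t. h t * cos (of_int n * X t)) = 0" for n :: int
  proof (cases "n \<ge> 0")
    case True
    then show ?thesis using z[of "nat n"] by simp
  next
    case False
    then show ?thesis using z[of "nat (- n)"] by simp
  qed
  \<comment> \<open>A factor \<open>cos X\<close> of the polynomial is absorbed by the product
    formula into the frequencies \<open>n + 1\<close> and \<open>n - 1\<close>; hence the induction
    needs all integers \<open>n\<close>.\<close>
  have zp: "J (\<lambda>t. h t * cos (of_int n * X t) * poly p (cos (X t))) = 0" for n :: int and p
  proof (induction p arbitrary: n)
    case (pCons a p)
    have "J (\<lambda>t. h t * cos (of_int n * X t) * poly (pCons a p) (cos (X t))) =
      J (\<lambda>t. a * (h t * cos (of_int n * X t)) + 1/2 *
       (h t * cos (of_int (n + 1) * X t) * poly p (cos (X t)) + h t * cos (of_int (n - 1) * X t) * poly p (cos (X t))))"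
    proof (rule J_cong)
      fix t
      have "cos (of_int (n + 1) * X t) + cos (of_int (n - 1) * X t) = 2 * cos (of_int n * X t) * cos (X t)"
        by (simp add: algebra_simps cos_add cos_diff)
      then have "h t * cos (of_int (n + 1) * X t) * poly p (cos (X t)) + h t * cos (of_int (n - 1) * X t) * poly p (cos (X t))
         = h t * poly p (cos (X t)) * (2 * cos (of_int n * X t) * cos (X t))"
        by (metis (no_types, opaque_lifting) distrib_left mult.assoc mult.commute)
      then show "h t * cos (of_int n * X t) * poly (pCons a p) (cos (X t)) =
        a * (h t * cos (of_int n * X t)) + 1/2 *
       (h t * cos (of_int (n + 1) * X t) * poly p (cos (X t)) + h t * cos (of_int (n - 1) * X t) * poly p (cos (X t)))"
        by (simp only:) (simp add: algebra_simps)
    qed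
    also have "\<dots> = a * J (\<lambda>t. h t * cos (of_int n * X t)) + 1/2 *
        (J (\<lambda>t. h t * cos (of_int (n + 1) * X t) * poly p (cos (X t))) + J (\<lambda>t. h t * cos (of_int (n - 1) * X t) * poly p (cos (X t))))"
      by (subst J_add J_cmult; (intro continuous_intros h)?)+ simp
    finally show ?case by (simp only: pCons.IH z') simp
  qed (simp add: J_const)
  define R where "R = {(\<lambda>t. poly p (cos (X t))) | p. True}"
  have R: "function_ring_on R {0..pi/2}"
  proof
    show "compact {0..pi/2}" by simp
    show "continuous_on {0..pi/2} f" if "f \<in> R" for f
      using that by (auto simp: R_def intro!: continuous_intros)
    show "(\<lambda>x. f x + g x) \<in> R" if "f \<in> R" "g \<in> R" for f g
      using that by (auto simp: R_def simp flip: poly_add)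
    show "(\<lambda>x. f x * g x) \<in> R" if "f \<in> R" "g \<in> R" for f g
      using that by (auto simp: R_def simp flip: poly_mult)
    show "(\<lambda>_. c) \<in> R" for c
      unfolding R_def by (auto intro!: exI[of _ "[:c:]"])
    show "\<exists>f\<in>R. f x \<noteq> f y" if "x \<in> {0..pi/2}" "y \<in> {0..pi/2}" "x \<noteq> y" for x y
    proof -
      have "X x \<noteq> X y" using X_strict_mono[of x y] X_strict_mono[of y x] that(3) by (cases "x < y") auto
      then have "cos (X x) \<noteq> cos (X y)" using X_range[OF that(1)] X_range[OF that(2)] cos_inj_pi by blast
      moreover have "(\<lambda>t. poly [:0, 1:] (cos (X t))) \<in> R" unfolding R_def by blast
      ultimately show ?thesis by (intro bexI[of _ "\<lambda>t. poly [:0, 1:] (cos (X t))"]) auto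
    qed
  qed
  have cabs: "continuous_on {0..pi/2} (\<lambda>t. \<bar>h t\<bar>)" by (intro continuous_intros h)
  have le: "J (\<lambda>t. h t * h t) \<le> e * J (\<lambda>t. \<bar>h t\<bar>)" if "e > 0" for e
  proof -
    obtain f where "f \<in> R" and f: "\<And>t. t \<in> {0..pi/2} \<Longrightarrow> \<bar>h t - f t\<bar> < e"
      using function_ring_on.Stone_Weierstrass_basic[OF R h \<open>e > 0\<close>] by blast
    then obtain p where p: "f = (\<lambda>t. poly p (cos (X t)))" by (auto simp: R_def)
    have cf: "continuous_on {0..pi/2} f" using R \<open>f \<in> R\<close> by (simp add: function_ring_on_def)
    \<comment> \<open>As \<open>h\<close> is orthogonal to \<open>f\<close>, its square may be
      replaced by \<open>h (h - f)\<close>, which is small.\<close>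
    have "J (\<lambda>t. h t * h t) = J (\<lambda>t. h t * h t) - J (\<lambda>t. h t * f t)"
      using zp[of 0 p] by (simp add: p)
    also have "\<dots> = J (\<lambda>t. h t * h t - h t * f t)"
      by (rule J_diff[symmetric]) (intro continuous_intros h cf)+
    also have "\<dots> \<le> J (\<lambda>t. e * \<bar>h t\<bar>)"
      unfolding J_def
    proof (intro integral_le J_integrable continuous_intros h cf)
      fix t assume "t \<in> {0..pi/2}"
      then have "h t * (h t - f t) \<le> \<bar>h t\<bar> * e"
        using f[of t] abs_ge_self[of "h t * (h t - f t)"] mult_left_mono[of "\<bar>h t - f t\<bar>" e "\<bar>h t\<bar>"]
        by (simp add: abs_mult)
      then show "(h t * h t - h t * f t) / \<sigma> t \<le> e * \<bar>h t\<bar> / \<sigma> t"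
        using sigma_bounds(1)[of t] by (intro divide_right_mono) (auto simp: algebra_simps)
    qed
    finally show ?thesis by (simp add: J_cmult)
  qed
  have "J (\<lambda>t. h t * h t) \<le> 0"
  proof (rule ccontr)
    assume n: "\<not> ?thesis"
    have J0: "0 \<le> J (\<lambda>t. \<bar>h t\<bar>)" unfolding J_def
      using sigma_bounds(1) by (intro integral_nonneg J_integrable cabs) (auto simp: less_imp_le)
    \<comment> \<open>Chosen so that \<open>e\<close> times the integral of \<open>|h|\<close> stays
      below half of the integral of \<open>h\<^sup>2\<close>; the summand 1 keeps the denominator
      positive.\<close>
    define e where "e = J (\<lambda>t. h t * h t) / (2 * (J (\<lambda>t. \<bar>h t\<bar>) + 1))"
    have "e * (2 * (J (\<lambda>t. \<bar>h t\<bar>) + 1)) = J (\<lambda>t. h t * h t)" "e > 0"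
      using n J0 by (auto simp: e_def)
    moreover have "e * (2 * (J (\<lambda>t. \<bar>h t\<bar>) + 1)) = 2 * (e * J (\<lambda>t. \<bar>h t\<bar>)) + 2 * e"
      by (simp add: algebra_simps)
    ultimately show False using le[OF \<open>e > 0\<close>] mult_nonneg_nonneg[OF less_imp_le[OF \<open>e > 0\<close>] J0] by linarith
  qed
  moreover have "0 \<le> J (\<lambda>t. h t * h t)" unfolding J_def
    using sigma_bounds(1) by (intro integral_nonneg J_integrable continuous_intros h) (auto simp: less_imp_le)
  ultimately have "integral {0..pi/2} (\<lambda>t. h t * h t / \<sigma> t) = 0" by (simp add: J_def)
  moreover have "continuous_on {0..pi/2} (\<lambda>t. h t * h t / \<sigma> t)"
    by (intro continuous_intros h) auto
  moreover have "0 \<le> h t * h t / \<sigma> t" for t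
    using sigma_bounds(1)[of t] by simp
  ultimately have "h t * h t / \<sigma> t = 0"
    using integral_eq_0_iff[of 0 "pi/2" "\<lambda>t. h t * h t / \<sigma> t"] \<open>t \<in> _\<close> by simp
  then show ?thesis by simp
qed

text \<open>Multiplication by \<open>sin X\<close> turns sine coefficients into cosine coefficients.
  It can be divided out again only where it is positive, hence the open interval.\<close>

lemma sin_coefficients_zero:
  assumes h: "continuous_on {0..pi/2} h"
    and z: "\<And>n::nat. n > 0 \<Longrightarrow> J (\<lambda>t. h t * sin (of_nat n * X t)) = 0" and t: "t \<in> {0<..<pi/2}"
  shows "h t = 0"
proof -
  have z': "J (\<lambda>t. h t * sin (of_int n * X t)) = 0" for n :: int
  proof (cases "n \<ge> 0")
    case True
    then show ?thesis using z[of "nat n"] by (cases "n = 0") (auto simp: J_const)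
  next
    case False
    then show ?thesis using z[of "nat (- n)"] J_cmult[of "-1" "\<lambda>t. h t * sin (of_int n * X t)"] by simp
  qed
  have "h t * sin (X t) = 0"
  proof (rule cos_coefficients_zero[of "\<lambda>t. h t * sin (X t)"])
    fix n :: nat
    have "J (\<lambda>t. h t * sin (X t) * cos (of_nat n * X t)) =
      J (\<lambda>t. 1/2 * (h t * sin (of_int (int n + 1) * X t) - h t * sin (of_int (int n - 1) * X t)))"
      by (rule J_cong) (simp add: algebra_simps sin_add sin_diff)
    also have "\<dots> = 0"
      by (simp only: J_cmult) (subst J_diff, auto intro!: continuous_intros h simp only: z', simp)
    finally show "J (\<lambda>t. h t * sin (X t) * cos (of_nat n * X t)) = 0" .
  qed (use t in \<open>auto intro!: continuous_intros h\<close>)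
  moreover have "sin (X t) > 0"
    using X_strict_mono[of 0 t] X_strict_mono[of t "pi/2"] t by (intro sin_gt_zero) auto
  ultimately show ?thesis by simp
qed

end

section \<open>Moving the line of integration\<close>

lemma DERIV_div_square:
  assumes "(N has_real_derivative N') (at x within S)" "(D has_real_derivative D') (at x within S)" "D x \<noteq> 0"
    and "N' * D x - 2 * N x * D' = E"
  shows "((\<lambda>x. N x / (D x)\<^sup>2) has_real_derivative E / (D x)^3) (at x within S)"
proof -
  have "((\<lambda>x. N x / (D x)\<^sup>2) has_real_derivative (N' * (D x)\<^sup>2 - N x * (2 * D x * D')) / ((D x)\<^sup>2 * (D x)\<^sup>2)) (at x within S)"
    by (rule derivative_eq_intros assms refl)+ (use assms(3) in \<open>auto simp: power2_eq_square\<close>)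
  moreover have "(N' * (D x)\<^sup>2 - N x * (2 * D x * D')) / ((D x)\<^sup>2 * (D x)\<^sup>2) = E / (D x)^3"
    using assms(3) unfolding assms(4)[symmetric]
    by (simp add: divide_simps) algebra
  ultimately show ?thesis by simp
qed

text \<open>Inverts a hyperbolic rotation, whose determinant is 1.\<close>

lemma solve_hyperbolic:
  fixes a b c s A :: real
  assumes "a * c + b * s = A" "a * s + b * c = 0" "c\<^sup>2 = s\<^sup>2 + 1"
  shows "a = A * c" "b = - A * s"
proof -
  have bc: "b * c = - (a * s)" using assms(2) by simp
  have "A * c = a * c\<^sup>2 + s * (b * c)"
    unfolding assms(1)[symmetric] by (simp add: algebra_simps power2_eq_square)
  then show "a = A * c" unfolding bc assms(3) by (simp add: algebra_simps power2_eq_square)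
  have "A * s = - (b * c\<^sup>2) + b * s\<^sup>2 + c * (a * s + b * c)"
    unfolding assms(1)[symmetric] by (simp add: algebra_simps power2_eq_square)
  then show "b = - A * s" unfolding assms(2,3) by (simp add: algebra_simps)
qed

text \<open>For positive \<open>k\<close> the complementary modulus is below 1 as well: the pole
  lies at finite height, and a second copy \<open>co\<close> of the theory describes the vertical
  direction.\<close>

locale modulus_pos = modulus +
  assumes k_pos: "0 < k"
begin

lemma k'_less_1: "k' < 1"
  using k_pos k2 by (simp add: k'_def)

sublocale co: modulus k'
  by unfold_locales (use k'_pos k'_less_1 in auto)

lemma co_k' [simp]: "co.k' = k"
  using k_pos by (simp add: co.k'_def k'_sq)

lemma KK_co: "co.KK = ellipticK (sqrt (1 - k\<^sup>2))"
  unfolding co.KK_def by (simp only: k'_def)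

text \<open>This is pi F(p, k') / K, the height in the same unit as \<open>X\<close>;
  \<open>y0 = pi K'/K\<close> is the height of the pole.\<close>

definition y where "y p = pi / KK * primitive (\<lambda>t. 1 / co.\<sigma> t) p"

definition y0 where "y0 = y (pi/2)"

lemma y0_eq: "y0 = pi * co.KK / KK"
  by (simp add: y0_def y_def primitive_nonneg co.KK_eq)

lemma y0_pos: "y0 > 0"
  using KK_pos co.KK_pos by (simp add: y0_eq)

lemma y_0 [simp]: "y 0 = 0"
  by (simp add: y_def)

lemma DERIV_y [derivative_intros]:
  assumes "(g has_real_derivative g') (at x within S)"
  shows "((\<lambda>x. y (g x)) has_real_derivative pi / (KK * co.\<sigma> (g x)) * g') (at x within S)"
proof -
  have "continuous_on UNIV (\<lambda>t. 1 / co.\<sigma> t)" by (intro continuous_intros) auto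
  then show ?thesis
    unfolding y_def using KK_pos by (auto intro!: derivative_eq_intros assms simp: mult_ac)
qed

lemma cont_y [continuous_intros]: "continuous_on S g \<Longrightarrow> continuous_on S (\<lambda>x. y (g x))" for g :: "'a::t2_space \<Rightarrow> real"
proof -
  have "continuous_on UNIV y"
    using DERIV_y[OF DERIV_ident] by (intro DERIV_continuous_on[where D = "\<lambda>x. pi / (KK * co.\<sigma> x) * 1"]) auto
  then show "continuous_on S g \<Longrightarrow> continuous_on S (\<lambda>x. y (g x))"
    by (rule continuous_on_compose2) auto
qed

text \<open>With \<open>z = F(f, k) + i F(p, k')\<close> one has \<open>dn z = (xr + i xi) / Dl\<close> by the addition theorem and
  Jacobi's imaginary transformation, and \<open>al + i be\<close> is \<open>dn\<^sup>2 z\<close>.\<close>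

definition Dl where "Dl f p = (cos p)\<^sup>2 + k\<^sup>2 * (sin f)\<^sup>2 * (sin p)\<^sup>2"
definition xr where "xr f p = \<sigma> f * cos p * co.\<sigma> p"
definition xi where "xi f p = - k\<^sup>2 * sin f * cos f * sin p"
definition al where "al f p = ((xr f p)\<^sup>2 - (xi f p)\<^sup>2) / (Dl f p)\<^sup>2"
definition be where "be f p = 2 * xr f p * xi f p / (Dl f p)\<^sup>2"
text \<open>\<open>cu\<close> and \<open>cw\<close> are the polynomials left in the two partial
  derivatives of \<open>al\<close> once the trigonometric prefactor and the cube of
  \<open>Dl\<close> are split off; \<open>a\<close> and \<open>b\<close> stand for the squared
  sines. They recur in the derivatives of \<open>be\<close>.\<close>

definition cu where "cu a b = ((1 - 2*a) * (1 - k\<^sup>2 * a) - k\<^sup>2 * a * (1 - a)) * (1 - b + k\<^sup>2 * a * b)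
  - 4 * k\<^sup>2 * a * (1 - a) * (1 - k\<^sup>2 * a) * b"
definition cw where "cw a b = ((1 - 2*b) * (1 - (1 - k\<^sup>2) * b) - (1 - k\<^sup>2) * b * (1 - b)) * (1 - b + k\<^sup>2 * a * b)
  + 4 * b * (1 - b) * (1 - k\<^sup>2 * a) * (1 - (1 - k\<^sup>2) * b)"
definition al_p where "al_p f p = 2 * sin p * cos p * k\<^sup>2 * cu ((sin f)\<^sup>2) ((sin p)\<^sup>2) / (Dl f p)^3"
definition al_f where "al_f f p = - 2 * sin f * cos f * k\<^sup>2 * cw ((sin f)\<^sup>2) ((sin p)\<^sup>2) / (Dl f p)^3"

lemma Dl_eq: "Dl f p = 1 - (sin p)\<^sup>2 + k\<^sup>2 * (sin f)\<^sup>2 * (sin p)\<^sup>2"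
  by (simp add: Dl_def cos_squared_eq)

lemma co_P_eq: "co.P p = 1 - (1 - k\<^sup>2) * (sin p)\<^sup>2"
  by (simp add: co.P_def k'_sq)

lemma num_eq: "(xr f p)\<^sup>2 - (xi f p)\<^sup>2 = (1 - k\<^sup>2 * (sin f)\<^sup>2) * (1 - (sin p)\<^sup>2) * (1 - (1 - k\<^sup>2) * (sin p)\<^sup>2)
   - k\<^sup>2 * k\<^sup>2 * (sin f)\<^sup>2 * (1 - (sin f)\<^sup>2) * (sin p)\<^sup>2"
  unfolding xr_def xi_def power_mult_distrib sigma_sq co.sigma_sq cos_squared_eq co_P_eq
  by (simp add: P_def power2_eq_square)

lemma Dl_pos: "cos p \<noteq> 0 \<Longrightarrow> Dl f p > 0"
  unfolding Dl_def by (intro add_pos_nonneg) auto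

context
  fixes f p :: real and S :: "real set"
  assumes nz: "Dl f p \<noteq> 0"
begin

lemma DERIV_Dl:
  "((\<lambda>p. Dl f p) has_real_derivative 2 * sin p * cos p * (k\<^sup>2 * (sin f)\<^sup>2 - 1)) (at p within S)"
  "((\<lambda>f. Dl f p) has_real_derivative 2 * sin f * cos f * k\<^sup>2 * (sin p)\<^sup>2) (at f within S)"
  unfolding Dl_eq by (auto intro!: derivative_eq_intros simp: algebra_simps)

lemma DERIV_al_p: "((\<lambda>p. al f p) has_real_derivative al_p f p) (at p within S)"
  unfolding al_def al_p_def
  apply (rule DERIV_div_square[OF _ DERIV_Dl(1) nz, where N' = "2 * sin p * cos p * (- (1 - k\<^sup>2 * (sin f)\<^sup>2) * (1 - (1 - k\<^sup>2) * (sin p)\<^sup>2)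
     - (1 - k\<^sup>2) * (1 - k\<^sup>2 * (sin f)\<^sup>2) * (1 - (sin p)\<^sup>2) - k\<^sup>2 * k\<^sup>2 * (sin f)\<^sup>2 * (1 - (sin f)\<^sup>2))"])
  subgoal unfolding num_eq by ((rule derivative_eq_intros refl)+, simp, algebra)
  subgoal unfolding num_eq cu_def Dl_eq by algebra
  done

lemma DERIV_al_f: "((\<lambda>f. al f p) has_real_derivative al_f f p) (at f within S)"
  unfolding al_def al_f_def
  apply (rule DERIV_div_square[OF _ DERIV_Dl(2) nz, where N' = "2 * sin f * cos f * (- k\<^sup>2 * (1 - (sin p)\<^sup>2) * (1 - (1 - k\<^sup>2) * (sin p)\<^sup>2)
     - k\<^sup>2 * k\<^sup>2 * (1 - 2 * (sin f)\<^sup>2) * (sin p)\<^sup>2)"])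
  subgoal unfolding num_eq by ((rule derivative_eq_intros refl)+, simp, algebra)
  subgoal unfolding num_eq cw_def Dl_eq by algebra
  done

text \<open>One Cauchy-Riemann equation for \<open>dn\<^sup>2\<close>: in elliptic variables, where
  \<open>co.\<sigma> d/dp\<close> and \<open>\<sigma> d/df\<close> are the derivatives, the vertical
  derivative of \<open>be\<close> is the horizontal one of \<open>al\<close>.\<close>

lemma DERIV_be_p: "((\<lambda>p. be f p) has_real_derivative \<sigma> f / co.\<sigma> p * al_f f p) (at p within S)"
proof -
  let ?c = "- 2 * k\<^sup>2 * sin f * cos f * \<sigma> f"
  have "((\<lambda>p. be f p) has_real_derivative (\<sigma> f / co.\<sigma> p * (- 2 * sin f * cos f * k\<^sup>2 * cw ((sin f)\<^sup>2) ((sin p)\<^sup>2))) / (Dl f p)^3) (at p within S)"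
    unfolding be_def
  proof (rule DERIV_div_square[OF _ DERIV_Dl(1) nz])
    show "((\<lambda>p. 2 * xr f p * xi f p) has_real_derivative
      ?c * (((cos p)\<^sup>2 - (sin p)\<^sup>2) * co.\<sigma> p - sin p * cos p * co.Y p)) (at p within S)"
      unfolding xr_def xi_def by (auto intro!: derivative_eq_intros simp: algebra_simps power2_eq_square)
    have s: "co.\<sigma> p * co.\<sigma> p = 1 - (1 - k\<^sup>2) * (sin p)\<^sup>2"
      using co.sigma_sq[of p] co_P_eq by (simp add: power2_eq_square)
    have Y: "co.Y p = (1 - k\<^sup>2) * sin p * cos p / co.\<sigma> p"
      by (simp add: co.Y_def k'_sq)
    have c: "(cos p)\<^sup>2 = 1 - (sin p)\<^sup>2" by (simp add: cos_squared_eq)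
    \<comment> \<open>Multiplication by \<open>co.\<sigma>\<close> clears the root from the
      denominator of \<open>co.Y\<close>; what remains is a polynomial identity in squared
      sines.\<close>
    have "co.\<sigma> p * ((((cos p)\<^sup>2 - (sin p)\<^sup>2) * co.\<sigma> p - sin p * cos p * co.Y p) * Dl f p
       - 2 * (sin p * cos p * co.\<sigma> p) * (2 * sin p * cos p * (k\<^sup>2 * (sin f)\<^sup>2 - 1)))
       = ((cos p)\<^sup>2 - (sin p)\<^sup>2) * (co.\<sigma> p * co.\<sigma> p) * Dl f p - (sin p)\<^sup>2 * (cos p)\<^sup>2 * (1 - k\<^sup>2) * Dl f p
        - 4 * (sin p)\<^sup>2 * (cos p)\<^sup>2 * (co.\<sigma> p * co.\<sigma> p) * (k\<^sup>2 * (sin f)\<^sup>2 - 1)"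
      by (simp add: Y field_simps power2_eq_square)
    also have "\<dots> = cw ((sin f)\<^sup>2) ((sin p)\<^sup>2)"
      unfolding s c cw_def Dl_eq by algebra
    finally have *: "(((cos p)\<^sup>2 - (sin p)\<^sup>2) * co.\<sigma> p - sin p * cos p * co.Y p) * Dl f p
       - 2 * (sin p * cos p * co.\<sigma> p) * (2 * sin p * cos p * (k\<^sup>2 * (sin f)\<^sup>2 - 1)) = cw ((sin f)\<^sup>2) ((sin p)\<^sup>2) / co.\<sigma> p"
      by (simp add: eq_divide_eq mult.commute)
    have "?c * (((cos p)\<^sup>2 - (sin p)\<^sup>2) * co.\<sigma> p - sin p * cos p * co.Y p) * Dl f p -
        2 * (2 * xr f p * xi f p) * (2 * sin p * cos p * (k\<^sup>2 * (sin f)\<^sup>2 - 1)) =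
      ?c * ((((cos p)\<^sup>2 - (sin p)\<^sup>2) * co.\<sigma> p - sin p * cos p * co.Y p) * Dl f p
       - 2 * (sin p * cos p * co.\<sigma> p) * (2 * sin p * cos p * (k\<^sup>2 * (sin f)\<^sup>2 - 1)))"
      unfolding xr_def xi_def by algebra
    then show "?c * (((cos p)\<^sup>2 - (sin p)\<^sup>2) * co.\<sigma> p - sin p * cos p * co.Y p) * Dl f p -
        2 * (2 * xr f p * xi f p) * (2 * sin p * cos p * (k\<^sup>2 * (sin f)\<^sup>2 - 1)) =
      \<sigma> f / co.\<sigma> p * (- 2 * sin f * cos f * k\<^sup>2 * cw ((sin f)\<^sup>2) ((sin p)\<^sup>2))"
      unfolding * by simp
  qed
  then show ?thesis by (simp add: al_f_def)
qed

text \<open>The other Cauchy-Riemann equation: the horizontal derivative of \<open>be\<close> is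
  minus the vertical one of \<open>al\<close>.\<close>

lemma DERIV_be_f: "((\<lambda>f. be f p) has_real_derivative - co.\<sigma> p * al_p f p / \<sigma> f) (at f within S)"
proof -
  let ?c = "- 2 * k\<^sup>2 * sin p * cos p * co.\<sigma> p"
  have "((\<lambda>f. be f p) has_real_derivative (- co.\<sigma> p / \<sigma> f * (2 * sin p * cos p * k\<^sup>2 * cu ((sin f)\<^sup>2) ((sin p)\<^sup>2))) / (Dl f p)^3) (at f within S)"
    unfolding be_def
  proof (rule DERIV_div_square[OF _ DERIV_Dl(2) nz])
    show "((\<lambda>f. 2 * xr f p * xi f p) has_real_derivative
      ?c * (((cos f)\<^sup>2 - (sin f)\<^sup>2) * \<sigma> f - sin f * cos f * Y f)) (at f within S)"
      unfolding xr_def xi_def by (auto intro!: derivative_eq_intros simp: algebra_simps power2_eq_square)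
    have s: "\<sigma> f * \<sigma> f = 1 - k\<^sup>2 * (sin f)\<^sup>2"
      using sigma_sq[of f] P_def by (simp add: power2_eq_square)
    have c: "(cos f)\<^sup>2 = 1 - (sin f)\<^sup>2" by (simp add: cos_squared_eq)
    have "\<sigma> f * ((((cos f)\<^sup>2 - (sin f)\<^sup>2) * \<sigma> f - sin f * cos f * Y f) * Dl f p
       - 2 * (sin f * cos f * \<sigma> f) * (2 * sin f * cos f * k\<^sup>2 * (sin p)\<^sup>2))
       = ((cos f)\<^sup>2 - (sin f)\<^sup>2) * (\<sigma> f * \<sigma> f) * Dl f p - (sin f)\<^sup>2 * (cos f)\<^sup>2 * k\<^sup>2 * Dl f p
        - 4 * (sin f)\<^sup>2 * (cos f)\<^sup>2 * (\<sigma> f * \<sigma> f) * k\<^sup>2 * (sin p)\<^sup>2"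
      by (simp add: Y_def field_simps power2_eq_square)
    also have "\<dots> = cu ((sin f)\<^sup>2) ((sin p)\<^sup>2)"
      unfolding s c cu_def Dl_eq by algebra
    finally have *: "(((cos f)\<^sup>2 - (sin f)\<^sup>2) * \<sigma> f - sin f * cos f * Y f) * Dl f p
       - 2 * (sin f * cos f * \<sigma> f) * (2 * sin f * cos f * k\<^sup>2 * (sin p)\<^sup>2) = cu ((sin f)\<^sup>2) ((sin p)\<^sup>2) / \<sigma> f"
      by (simp add: eq_divide_eq mult.commute)
    have "?c * (((cos f)\<^sup>2 - (sin f)\<^sup>2) * \<sigma> f - sin f * cos f * Y f) * Dl f p -
        2 * (2 * xr f p * xi f p) * (2 * sin f * cos f * k\<^sup>2 * (sin p)\<^sup>2) =
      ?c * ((((cos f)\<^sup>2 - (sin f)\<^sup>2) * \<sigma> f - sin f * cos f * Y f) * Dl f p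
       - 2 * (sin f * cos f * \<sigma> f) * (2 * sin f * cos f * k\<^sup>2 * (sin p)\<^sup>2))"
      unfolding xr_def xi_def by algebra
    then show "?c * (((cos f)\<^sup>2 - (sin f)\<^sup>2) * \<sigma> f - sin f * cos f * Y f) * Dl f p -
        2 * (2 * xr f p * xi f p) * (2 * sin f * cos f * k\<^sup>2 * (sin p)\<^sup>2) =
      - co.\<sigma> p / \<sigma> f * (2 * sin p * cos p * k\<^sup>2 * cu ((sin f)\<^sup>2) ((sin p)\<^sup>2))"
      unfolding * by simp
  qed
  then show ?thesis by (simp add: al_p_def mult_ac)
qed

end

section \<open>Fourier coefficients of \<open>dn\<^sup>2\<close> on horizontal lines below the
  pole\<close>

definition strip :: "real set" where "strip = {- (pi/2)<..<pi/2}"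

lemma strip: "open strip" "convex strip" "0 \<in> strip"
  by (auto simp: strip_def)

lemma strip_cos: "p \<in> strip \<Longrightarrow> cos p > 0"
  by (auto simp: strip_def intro!: cos_gt_zero_pi)

lemma strip_Dl: "p \<in> strip \<Longrightarrow> Dl f p \<noteq> 0"
  using Dl_pos[of p f] strip_cos[of p] by simp

text \<open>\<open>al\<close> is even and \<open>be\<close> is odd in \<open>f\<close>, so
  \<open>a\<close> and \<open>b\<close> hold the Fourier data of \<open>dn\<^sup>2\<close> at the
  height given by \<open>p\<close>; \<open>A\<close> belongs to the real line.\<close>

definition A :: "int \<Rightarrow> real" where "A n = J (\<lambda>f. P f * cos (of_int n * X f))"
definition a :: "int \<Rightarrow> real \<Rightarrow> real" where "a n p = J (\<lambda>f. al f p * cos (of_int n * X f))"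
definition b :: "int \<Rightarrow> real \<Rightarrow> real" where "b n p = J (\<lambda>f. be f p * sin (of_int n * X f))"

lemma cont_al_be:
  fixes g h :: "'a::t2_space \<Rightarrow> real"
  assumes "continuous_on S g" "continuous_on S h" "\<And>x. x \<in> S \<Longrightarrow> Dl (g x) (h x) \<noteq> 0"
  shows "continuous_on S (\<lambda>x. al (g x) (h x))" "continuous_on S (\<lambda>x. be (g x) (h x))"
    "continuous_on S (\<lambda>x. al_p (g x) (h x))" "continuous_on S (\<lambda>x. al_f (g x) (h x))"
proof -
  have Dl: "continuous_on S (\<lambda>x. Dl (g x) (h x))"
    unfolding Dl_def by (intro continuous_intros assms)
  show "continuous_on S (\<lambda>x. al (g x) (h x))" "continuous_on S (\<lambda>x. be (g x) (h x))"
    unfolding al_def be_def xr_def xi_def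
    by (intro continuous_intros assms Dl; simp add: assms)+
  show "continuous_on S (\<lambda>x. al_p (g x) (h x))" "continuous_on S (\<lambda>x. al_f (g x) (h x))"
    unfolding al_p_def al_f_def cu_def cw_def
    by (intro continuous_intros assms Dl; simp add: assms)+
qed

lemma J_leibniz:
  assumes d: "\<And>p f. p \<in> strip \<Longrightarrow> f \<in> {0..pi/2} \<Longrightarrow> ((\<lambda>p. u f p) has_real_derivative u' f p) (at p)"
    and c: "\<And>p. p \<in> strip \<Longrightarrow> continuous_on {0..pi/2} (\<lambda>f. u f p)"
    and c': "continuous_on (strip \<times> {0..pi/2}) (\<lambda>x. u' (snd x) (fst x))"
    and w: "continuous_on {0..pi/2} w" and p: "p \<in> strip"
  shows "((\<lambda>p. J (\<lambda>f. u f p * w f)) has_real_derivative J (\<lambda>f. u' f p * w f)) (at p)"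
proof -
  have "((\<lambda>p. integral (cbox 0 (pi/2)) (\<lambda>f. u f p * w f / \<sigma> f)) has_real_derivative
      integral (cbox 0 (pi/2)) (\<lambda>f. u' f p * w f / \<sigma> f)) (at p within strip)"
  proof (rule leibniz_rule_field_derivative)
    show "((\<lambda>p. u f p * w f / \<sigma> f) has_real_derivative u' f p * w f / \<sigma> f) (at p within strip)"
      if "p \<in> strip" "f \<in> cbox 0 (pi/2)" for p f
      using that by (auto intro!: derivative_eq_intros DERIV_subset[OF d])
    show "(\<lambda>f. u f p * w f / \<sigma> f) integrable_on cbox 0 (pi/2)" if "p \<in> strip" for p
      unfolding cbox_interval by (rule J_integrable) (intro continuous_intros c w that)
    have "continuous_on (strip \<times> {0..pi/2}) (\<lambda>x. u' (snd x) (fst x) * w (snd x) / \<sigma> (snd x))"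
      by (intro continuous_intros c' continuous_on_compose2[OF w]) auto
    then show "continuous_on (strip \<times> cbox 0 (pi/2)) (\<lambda>(x, t). u' t x * w t / \<sigma> t)"
      by (simp add: case_prod_unfold)
  qed (use strip p in auto)
  then show ?thesis
    using at_within_open[OF p strip(1)] by (simp add: J_def)
qed

text \<open>Stands in for Cauchy's theorem: the Cauchy-Riemann equations turn the derivative in
  \<open>p\<close> under the integral into one in \<open>f\<close>, and integration by parts moves
  that onto the trigonometric factor.\<close>

lemma DERIV_a_b:
  assumes p: "p \<in> strip"
  shows "(a n has_real_derivative - of_int n * (pi / (KK * co.\<sigma> p)) * b n p) (at p)"
    and "(b n has_real_derivative - of_int n * (pi / (KK * co.\<sigma> p)) * a n p) (at p)"
proof -
  have ca: "continuous_on {0..pi/2} (\<lambda>f. al f p)" "continuous_on {0..pi/2} (\<lambda>f. be f p)"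
     "continuous_on {0..pi/2} (\<lambda>f. al_p f p)" "continuous_on {0..pi/2} (\<lambda>f. al_f f p)" if "p \<in> strip" for p
    using cont_al_be[of "{0..pi/2}" "\<lambda>f. f" "\<lambda>f. p"] strip_Dl[OF that] by auto
  have ca2: "continuous_on (strip \<times> {0..pi/2}) (\<lambda>x. al_p (snd x) (fst x))"
      "continuous_on (strip \<times> {0..pi/2}) (\<lambda>x. al_f (snd x) (fst x))"
    by (rule cont_al_be; use strip_Dl in \<open>auto intro: continuous_on_fst continuous_on_snd continuous_on_id\<close>)+
  have "(a n has_real_derivative J (\<lambda>f. al_p f p * cos (of_int n * X f))) (at p)"
    unfolding a_def[abs_def]
    by (rule J_leibniz) (auto intro!: DERIV_al_p ca ca2 continuous_intros p strip_Dl)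
  \<comment> \<open>No boundary terms: \<open>be\<close> vanishes at both ends because of its factor
    \<open>sin f * cos f\<close>.\<close>
  moreover have "J (\<lambda>f. (- co.\<sigma> p * al_p f p) * cos (of_int n * X f)) =
     - J (\<lambda>f. be f p * (- of_int n * pi / KK * sin (of_int n * X f)))"
    using DERIV_be_f[OF strip_Dl[OF p]]
    by (intro J_parts DERIV_trig_X) (auto intro!: continuous_intros ca p simp: be_def xi_def)
  then have "- co.\<sigma> p * J (\<lambda>f. al_p f p * cos (of_int n * X f)) = - (- of_int n * pi / KK * b n p)"
    unfolding b_def J_cmult[symmetric] by (simp add: mult_ac)
  then have "J (\<lambda>f. al_p f p * cos (of_int n * X f)) = - of_int n * (pi / (KK * co.\<sigma> p)) * b n p"
    by (simp add: field_simps)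
  ultimately show "(a n has_real_derivative - of_int n * (pi / (KK * co.\<sigma> p)) * b n p) (at p)" by simp
  have "(b n has_real_derivative J (\<lambda>f. \<sigma> f / co.\<sigma> p * al_f f p * sin (of_int n * X f))) (at p)"
    unfolding b_def[abs_def]
    by (rule J_leibniz[OF DERIV_be_p[OF strip_Dl]]) (auto intro!: ca ca2 continuous_intros p)
  moreover have "J (\<lambda>f. (\<sigma> f * al_f f p) * sin (of_int n * X f)) =
     - J (\<lambda>f. al f p * (of_int n * pi / KK * cos (of_int n * X f)))"
    using DERIV_al_f[OF strip_Dl[OF p]]
    by (intro J_parts DERIV_trig_X) (auto intro!: continuous_intros ca p)
  then have "J (\<lambda>f. (\<sigma> f * al_f f p) * sin (of_int n * X f)) = - (of_int n * pi / KK * a n p)"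
    unfolding a_def J_cmult[symmetric] by (simp add: mult_ac)
  moreover have "J (\<lambda>f. \<sigma> f / co.\<sigma> p * al_f f p * sin (of_int n * X f)) = 1 / co.\<sigma> p * J (\<lambda>f. (\<sigma> f * al_f f p) * sin (of_int n * X f))"
    unfolding J_cmult[symmetric] by simp
  ultimately have "(b n has_real_derivative 1 / co.\<sigma> p * - (of_int n * pi / KK * a n p)) (at p)"
    by (simp only:)
  then show "(b n has_real_derivative - of_int n * (pi / (KK * co.\<sigma> p)) * a n p) (at p)"
    by (rule DERIV_cong) (simp add: field_simps)
qed

lemma DERIV_cosh_sinh_y:
  "((\<lambda>p. cosh (of_int n * y p)) has_real_derivative of_int n * (pi / (KK * co.\<sigma> p)) * sinh (of_int n * y p)) (at p within S)"
  "((\<lambda>p. sinh (of_int n * y p)) has_real_derivative of_int n * (pi / (KK * co.\<sigma> p)) * cosh (of_int n * y p)) (at p within S)"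
  by (auto intro!: derivative_eq_intros simp: mult_ac)

text \<open>The linear system for \<open>(a, b)\<close> is a hyperbolic rotation with angle
  \<open>n y\<close>; rotating back gives two quantities that are constant in
  \<open>p\<close>.\<close>

lemma a_b_eq:
  assumes p: "p \<in> strip"
  shows "a n p = A n * cosh (of_int n * y p)" "b n p = - A n * sinh (of_int n * y p)"
proof -
  have al0: "al f 0 = P f" "be f 0 = 0" for f
    by (auto simp: al_def be_def xr_def xi_def Dl_def sigma_sq power_mult_distrib co.\<sigma>_def co.P_def)
  have a0: "a n 0 = A n" "b n 0 = 0" by (auto simp: a_def A_def b_def al0 J_const)
  have "\<exists>c. \<forall>p\<in>strip. a n p * cosh (of_int n * y p) + b n p * sinh (of_int n * y p) = c"
    by (rule has_field_derivative_zero_constant[OF strip(2)])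
      (auto intro!: derivative_eq_intros DERIV_subset[OF DERIV_a_b(1)] DERIV_subset[OF DERIV_a_b(2)]
        DERIV_cosh_sinh_y simp: algebra_simps)
  then have 1: "a n p * cosh (of_int n * y p) + b n p * sinh (of_int n * y p) = A n"
    using strip(3) p a0 by fastforce
  have "\<exists>c. \<forall>p\<in>strip. a n p * sinh (of_int n * y p) + b n p * cosh (of_int n * y p) = c"
    by (rule has_field_derivative_zero_constant[OF strip(2)])
      (auto intro!: derivative_eq_intros DERIV_subset[OF DERIV_a_b(1)] DERIV_subset[OF DERIV_a_b(2)]
        DERIV_cosh_sinh_y simp: algebra_simps)
  then have 2: "a n p * sinh (of_int n * y p) + b n p * cosh (of_int n * y p) = 0"
    using strip(3) p a0 by fastforce
  have c: "(cosh (of_int n * y p))\<^sup>2 = (sinh (of_int n * y p))\<^sup>2 + 1" by (simp add: cosh_square_eq)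
  show "a n p = A n * cosh (of_int n * y p)" "b n p = - A n * sinh (of_int n * y p)"
    using solve_hyperbolic[OF 1 2 c] by auto
qed

end

section \<open>The limit at the pole\<close>

text \<open>The crude constant is 2 + 1: \<open>x \<le> x (sin x + cos x)\<close>, where
  \<open>x \<le> 2\<close> bounds the first product by \<open>2 sin x\<close> and
  \<open>x cos x \<le> sin x\<close> the second.\<close>

lemma le_three_sin:
  fixes x :: real
  assumes "0 \<le> x" "x \<le> pi/2"
  shows "x \<le> 3 * sin x"
proof -
  have s: "0 \<le> sin x" "0 \<le> cos x" using assms by (auto intro: sin_ge_zero cos_ge_zero)
  have "sin 0 - 0 * cos 0 \<le> sin x - x * cos x"
  proof (rule DERIV_nonneg_imp_nondecreasing[OF assms(1), of "\<lambda>x. sin x - x * cos x"])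
    fix t assume "0 \<le> t" "t \<le> x"
    then have "0 \<le> t * sin t" using assms by (intro mult_nonneg_nonneg sin_ge_zero) auto
    then show "\<exists>y. ((\<lambda>x. sin x - x * cos x) has_real_derivative y) (at t) \<and> 0 \<le> y"
      by (intro exI[of _ "t * sin t"]) (auto intro!: derivative_eq_intros simp: algebra_simps)
  qed
  then have 1: "x * cos x \<le> sin x" by simp
  have "1 \<le> (sin x + cos x)\<^sup>2"
    using s by (simp add: power2_sum)
  then have "1 \<le> sin x + cos x" using s by (smt (verit) power_le_one abs_square_le_1 power2_le_imp_le one_power2)
  then have "x * 1 \<le> x * (sin x + cos x)" using assms by (intro mult_left_mono) auto
  also have "\<dots> \<le> 2 * sin x + sin x"
  proof -
    have "x * sin x \<le> 2 * sin x" using assms s pi_less_4 by (intro mult_right_mono) auto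
    then show ?thesis using 1 by (simp add: distrib_left)
  qed
  finally show ?thesis by simp
qed

lemma one_minus_cos_le: "1 - cos x \<le> x\<^sup>2 / 2" for x :: real
proof -
  have "1 - cos x = 2 * (sin (x/2))\<^sup>2" using cos_double_sin[of "x/2"] by simp
  moreover have "(sin (x/2))\<^sup>2 \<le> (x/2)\<^sup>2" using abs_sin_x_le_abs_x[of "x/2"] by (rule abs_le_square_iff[THEN iffD1])
  ultimately show ?thesis by (simp add: power_divide)
qed

text \<open>Half arguments: \<open>cosh x - 1\<close> is twice the square of
  \<open>sinh (x/2)\<close>, and \<open>sinh h \<le> h cosh h\<close>.\<close>

lemma cosh_minus_one_le:
  fixes x :: real
  assumes "0 \<le> x"
  shows "cosh x - 1 \<le> x\<^sup>2 * cosh x"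
proof -
  let ?h = "x/2"
  have "0 * cosh 0 - sinh 0 \<le> ?h * cosh ?h - sinh ?h"
  proof (rule DERIV_nonneg_imp_nondecreasing[of 0 ?h "\<lambda>x. x * cosh x - sinh x"])
    fix t :: real assume "0 \<le> t"
    then show "\<exists>y. ((\<lambda>x. x * cosh x - sinh x) has_real_derivative y) (at t) \<and> 0 \<le> y"
      by (intro exI[of _ "t * sinh t"]) (auto intro!: derivative_eq_intros simp: algebra_simps)
  qed (use assms in simp)
  then have "sinh ?h \<le> ?h * cosh ?h" by simp
  then have "(sinh ?h)\<^sup>2 \<le> (?h * cosh ?h)\<^sup>2" using assms by (intro power_mono) auto
  moreover have cd: "cosh x = 2 * (sinh ?h)\<^sup>2 + 1" "cosh x = 2 * (cosh ?h)\<^sup>2 - 1"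
    using cosh_double[of ?h] cosh_square_eq[of ?h] by auto
  ultimately have "cosh x - 1 \<le> 2 * (?h)\<^sup>2 * (cosh ?h)\<^sup>2"
    by (simp add: power_mult_distrib power_divide)
  moreover have "(cosh ?h)\<^sup>2 \<le> cosh x"
    using cd(2) cosh_square_eq[of ?h] zero_le_power2[of "sinh ?h"] by linarith
  ultimately have "cosh x - 1 \<le> 2 * (?h)\<^sup>2 * cosh x"
    by (meson mult_left_mono order_trans zero_le_mult_iff zero_le_numeral zero_le_power2)
  also have "\<dots> \<le> x\<^sup>2 * cosh x" using cosh_real_ge_1[of x] by (simp add: power_divide)
  finally show ?thesis .
qed

lemma Re_Im_cos_sin:
  fixes u v :: real
  shows "Re (cos (Complex u (- v))) = cos u * cosh v" "Im (cos (Complex u (- v))) = sin u * sinh v"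
    "Re (sin (Complex u (- v))) = sin u * cosh v" "Im (sin (Complex u (- v))) = - cos u * sinh v"
  by (simp_all add: Re_sin Im_sin Re_cos Im_cos cosh_field_def sinh_field_def field_simps)

context modulus_pos
begin

text \<open>\<open>G\<close> is \<open>dn\<^sup>2 z\<close>, and \<open>\<zeta>\<close> is pi (z - i
  K') / K; so \<open>\<eta>\<close> is the depth below the line through the pole.\<close>

definition G where "G f p = Complex (al f p) (be f p)"
definition \<eta> where "\<eta> p = y0 - y p"
definition \<zeta> where "\<zeta> f p = Complex (X f) (- \<eta> p)"

lemma int_zeta: "of_int n * \<zeta> f p = Complex (of_int n * X f) (- (of_int n * \<eta> p))"
  by (simp add: \<zeta>_def complex_eq_iff)

text \<open>Multiplication by \<open>1 - cos \<zeta>\<close> is minus half the second difference in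
  \<open>n\<close>; regularised integrals are computed in this way from the singular ones.\<close>

lemma cos_zeta_rec:
  "cos (of_int n * \<zeta> f p) - (cos (of_int (n + 1) * \<zeta> f p) + cos (of_int (n - 1) * \<zeta> f p)) / 2 = (1 - cos (\<zeta> f p)) * cos (of_int n * \<zeta> f p)"
  "sin (of_int n * \<zeta> f p) - (sin (of_int (n + 1) * \<zeta> f p) + sin (of_int (n - 1) * \<zeta> f p)) / 2 = (1 - cos (\<zeta> f p)) * sin (of_int n * \<zeta> f p)"
  by (simp_all add: algebra_simps cos_add cos_diff sin_add sin_diff)

definition gcos where "gcos n f p = Re (G f p * cos (of_int n * \<zeta> f p))"
definition gsin where "gsin n f p = Im (G f p * sin (of_int n * \<zeta> f p))"

lemma gcos_eq: "gcos n f p = al f p * cos (of_int n * X f) * cosh (of_int n * \<eta> p) - be f p * sin (of_int n * X f) * sinh (of_int n * \<eta> p)"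
  and gsin_eq: "gsin n f p = be f p * sin (of_int n * X f) * cosh (of_int n * \<eta> p) - al f p * cos (of_int n * X f) * sinh (of_int n * \<eta> p)"
  unfolding gcos_def gsin_def int_zeta times_complex.sel Re_Im_cos_sin by (simp_all add: G_def algebra_simps)

definition M where "M n = A n * cosh (of_int n * y0)"
definition D where "D n = A n * sinh (of_int n * y0)"

lemma cont_al_be_Icc:
  assumes "p \<in> strip"
  shows "continuous_on {0..pi/2} (\<lambda>f. al f p)" "continuous_on {0..pi/2} (\<lambda>f. be f p)"
  using cont_al_be[of "{0..pi/2}" "\<lambda>f. f" "\<lambda>f. p"] strip_Dl[OF assms] by auto

lemma cont_gcos_gsin: "p \<in> strip \<Longrightarrow> continuous_on {0..pi/2} (\<lambda>f. gcos n f p)" "p \<in> strip \<Longrightarrow> continuous_on {0..pi/2} (\<lambda>f. gsin n f p)"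
  unfolding gcos_eq gsin_eq by (intro continuous_intros cont_al_be_Icc; assumption)+

text \<open>The integrals do not depend on the height: the hyperbolic rotation by \<open>n y\<close>
  in the coefficients and the one by \<open>n \<eta>\<close> in the trigonometric factor add up to
  \<open>n y0\<close>.\<close>

lemma J_gcos_gsin:
  assumes p: "p \<in> strip"
  shows "J (\<lambda>f. gcos n f p) = M n" "J (\<lambda>f. gsin n f p) = - D n"
proof -
  note [continuous_intros] = cont_al_be_Icc[OF p]
  have y: "of_int n * y0 = of_int n * y p + of_int n * \<eta> p" by (simp add: \<eta>_def algebra_simps)
  have "J (\<lambda>f. gcos n f p) = J (\<lambda>f. cosh (of_int n * \<eta> p) * (al f p * cos (of_int n * X f))
      - sinh (of_int n * \<eta> p) * (be f p * sin (of_int n * X f)))"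
    by (rule J_cong) (simp add: gcos_eq)
  also have "\<dots> = cosh (of_int n * \<eta> p) * a n p - sinh (of_int n * \<eta> p) * b n p"
    unfolding a_def b_def J_cmult[symmetric] by (rule J_diff) (intro continuous_intros)+
  also have "\<dots> = M n"
    unfolding a_b_eq[OF p] M_def y cosh_add by (simp add: algebra_simps)
  finally show "J (\<lambda>f. gcos n f p) = M n" .
  have "J (\<lambda>f. gsin n f p) = J (\<lambda>f. cosh (of_int n * \<eta> p) * (be f p * sin (of_int n * X f))
      - sinh (of_int n * \<eta> p) * (al f p * cos (of_int n * X f)))"
    by (rule J_cong) (simp add: gsin_eq)
  also have "\<dots> = cosh (of_int n * \<eta> p) * b n p - sinh (of_int n * \<eta> p) * a n p"
    unfolding a_def b_def J_cmult[symmetric] by (rule J_diff) (intro continuous_intros)+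
  also have "\<dots> = - D n"
    unfolding a_b_eq[OF p] D_def y sinh_add by (simp add: algebra_simps)
  finally show "J (\<lambda>f. gsin n f p) = - D n" .
qed

definition gcos0 where "gcos0 n f p = Re (G f p * (1 - cos (\<zeta> f p)) * cos (of_int n * \<zeta> f p))"
definition gsin0 where "gsin0 n f p = Im (G f p * (1 - cos (\<zeta> f p)) * sin (of_int n * \<zeta> f p))"

lemma gcos0_eq: "gcos0 n f p = gcos n f p - 1/2 * (gcos (n + 1) f p + gcos (n - 1) f p)"
  and gsin0_eq: "gsin0 n f p = gsin n f p - 1/2 * (gsin (n + 1) f p + gsin (n - 1) f p)"
  unfolding gcos0_def gsin0_def mult.assoc cos_zeta_rec[symmetric] by (simp_all add: gcos_def gsin_def field_simps)

lemma J_gcos0_gsin0: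
  assumes p: "p \<in> strip"
  shows "J (\<lambda>f. gcos0 n f p) = M n - (M (n + 1) + M (n - 1)) / 2" "J (\<lambda>f. gsin0 n f p) = - (D n - (D (n + 1) + D (n - 1)) / 2)"
    "continuous_on {0..pi/2} (\<lambda>f. gcos0 n f p)" "continuous_on {0..pi/2} (\<lambda>f. gsin0 n f p)"
proof -
  note [continuous_intros] = cont_gcos_gsin[OF p]
  show "continuous_on {0..pi/2} (\<lambda>f. gcos0 n f p)" "continuous_on {0..pi/2} (\<lambda>f. gsin0 n f p)"
    unfolding gcos0_eq gsin0_eq by (intro continuous_intros)+
  show "J (\<lambda>f. gcos0 n f p) = M n - (M (n + 1) + M (n - 1)) / 2"
    unfolding gcos0_eq
    by (subst J_diff; (intro continuous_intros)?) (subst J_cmult, subst J_add; (intro continuous_intros)?; simp add: J_gcos_gsin[OF p] field_simps)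
  show "J (\<lambda>f. gsin0 n f p) = - (D n - (D (n + 1) + D (n - 1)) / 2)"
    unfolding gsin0_eq
    by (subst J_diff; (intro continuous_intros)?) (subst J_cmult, subst J_add; (intro continuous_intros)?; simp add: J_gcos_gsin[OF p] field_simps)
qed

text \<open>With \<open>eta_bounds\<close>, this bounds both components of \<open>\<zeta>\<close>
  linearly in the distance to the pole.\<close>

lemma X_le: "0 \<le> f \<Longrightarrow> X f \<le> pi / (KK * k') * f"
proof -
  assume "0 \<le> f"
  define c where "c = pi / (KK * k')"
  have "c * 0 - X 0 \<le> c * f - X f"
  proof (rule DERIV_nonneg_imp_nondecreasing[OF \<open>0 \<le> f\<close>, of "\<lambda>f. c * f - X f"])
    fix t
    have "pi / (KK * \<sigma> t) \<le> c"
      unfolding c_def using KK_pos k'_pos sigma_bounds[of t] by (intro divide_left_mono) auto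
    then show "\<exists>y. ((\<lambda>f. c * f - X f) has_real_derivative y) (at t) \<and> 0 \<le> y"
      by (intro exI[of _ "c - pi / (KK * \<sigma> t)"]) (auto intro!: derivative_eq_intros)
  qed
  then show ?thesis by (simp add: c_def)
qed

lemma eta_bounds:
  assumes "p \<le> pi/2"
  shows "0 \<le> \<eta> p" "\<eta> p \<le> pi / (KK * k) * (pi/2 - p)"
proof -
  have "y p \<le> y (pi/2)"
  proof (rule DERIV_nonneg_imp_nondecreasing[OF assms])
    fix t
    show "\<exists>z. (y has_real_derivative z) (at t) \<and> 0 \<le> z"
      using KK_pos co.sigma_bounds(1)[of t] by (intro exI[of _ "pi / (KK * co.\<sigma> t) * 1"] conjI DERIV_y DERIV_ident) simp
  qed
  then show "0 \<le> \<eta> p" by (simp add: \<eta>_def y0_def)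
  define c where "c = pi / (KK * k)"
  have "c * p - y p \<le> c * (pi/2) - y (pi/2)"
  proof (rule DERIV_nonneg_imp_nondecreasing[OF assms, of "\<lambda>f. c * f - y f"])
    fix t
    have "pi / (KK * co.\<sigma> t) \<le> c"
      unfolding c_def using KK_pos k_pos co.sigma_bounds[of t] by (intro divide_left_mono) auto
    then show "\<exists>z. ((\<lambda>f. c * f - y f) has_real_derivative z) (at t) \<and> 0 \<le> z"
      by (intro exI[of _ "c - pi / (KK * co.\<sigma> t)"]) (auto intro!: derivative_eq_intros)
  qed
  then show "\<eta> p \<le> pi / (KK * k) * (pi/2 - p)" by (simp add: c_def \<eta>_def y0_def algebra_simps)
qed

lemma eta_le_y0: "0 \<le> p \<Longrightarrow> p \<le> pi/2 \<Longrightarrow> \<eta> p \<le> y0"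
proof -
  assume p: "0 \<le> p" "p \<le> pi/2"
  have "y 0 \<le> y p"
  proof (rule DERIV_nonneg_imp_nondecreasing[OF p(1)])
    fix t
    show "\<exists>z. (y has_real_derivative z) (at t) \<and> 0 \<le> z"
      using KK_pos co.sigma_bounds(1)[of t] by (intro exI[of _ "pi / (KK * co.\<sigma> t) * 1"] conjI DERIV_y DERIV_ident) simp
  qed
  then show ?thesis by (simp add: \<eta>_def)
qed

lemma norm_one_minus_cos_zeta: "cmod (1 - cos (\<zeta> f p)) = cosh (\<eta> p) - cos (X f)"
proof -
  have "(cmod (1 - cos (\<zeta> f p)))\<^sup>2 = (1 - cos (X f) * cosh (\<eta> p))\<^sup>2 + (sin (X f))\<^sup>2 * (sinh (\<eta> p))\<^sup>2"
    by (simp add: cmod_power2 \<zeta>_def Re_Im_cos_sin power_mult_distrib)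
  also have "\<dots> = (cosh (\<eta> p) - cos (X f))\<^sup>2"
    unfolding sinh_square_eq sin_squared_eq by (simp add: power2_eq_square algebra_simps)
  finally have sq: "(cmod (1 - cos (\<zeta> f p)))\<^sup>2 = (cosh (\<eta> p) - cos (X f))\<^sup>2" .
  have "0 \<le> cosh (\<eta> p) - cos (X f)" using cosh_real_ge_1[of "\<eta> p"] cos_le_one[of "X f"] by linarith
  with sq norm_ge_zero show ?thesis by (rule power2_eq_imp_eq)
qed

lemma norm_G: "cmod (G f p) = ((xr f p)\<^sup>2 + (xi f p)\<^sup>2) / (Dl f p)\<^sup>2"
proof -
  have "G f p = (Complex (xr f p) (xi f p))\<^sup>2 / of_real ((Dl f p)\<^sup>2)"
    by (simp add: G_def al_def be_def complex_eq_iff Re_power2 Im_power2 Re_divide_of_real Im_divide_of_real del: of_real_power)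
  then show ?thesis by (simp add: norm_divide norm_power cmod_power2 del: of_real_power)
qed

text \<open>The double pole of \<open>dn\<^sup>2\<close> at \<open>f = 0\<close>, \<open>p = \<pi>/2\<close> is cancelled by the double zero of \<open>1 - cos \<zeta>\<close>.\<close>

lemma bounded_near_pole:
  "\<exists>B. \<forall>p f. pi/4 \<le> p \<longrightarrow> p < pi/2 \<longrightarrow> 0 < f \<longrightarrow> f < pi/2 \<longrightarrow> cmod (G f p * (1 - cos (\<zeta> f p))) \<le> B"
proof (intro exI allI impI)
  fix p f :: real
  assume p: "pi/4 \<le> p" "p < pi/2" and f: "0 < f" "f < pi/2"
  define c1 where "c1 = pi / (KK * k') * 3"
  define c2 where "c2 = pi / (KK * k) * 3"
  \<comment> \<open>\<open>r\<close> plays the role of the squared distance to the pole. Below,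
    \<open>|1 - cos \<zeta>|\<close> is O(r) and \<open>|G|\<close> is O(1/r), with constants
    independent of \<open>p\<close> and \<open>f\<close>.\<close>
  define r where "r = (cos p)\<^sup>2 + (sin f)\<^sup>2"
  have r: "r > 0" using f sin_gt_zero[of f] by (auto simp: r_def intro!: add_nonneg_pos)
  have c: "c1 \<ge> 0" "c2 \<ge> 0" using KK_pos k'_pos k_pos by (auto simp: c1_def c2_def)
  have "X f \<le> pi / (KK * k') * (3 * sin f)"
    using X_le[of f] le_three_sin[of f] f KK_pos k'_pos
    by (intro order_trans[OF X_le] mult_left_mono) auto
  then have "X f \<le> c1 * sin f" by (simp add: c1_def)
  moreover have "0 \<le> X f" using X_range[of f] f by auto
  ultimately have "(X f)\<^sup>2 \<le> (c1 * sin f)\<^sup>2" by (intro power_mono) auto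
  then have X2: "(X f)\<^sup>2 \<le> c1\<^sup>2 * (sin f)\<^sup>2" by (simp add: power_mult_distrib)
  have "\<eta> p \<le> pi / (KK * k) * (3 * sin (pi/2 - p))"
    using p pi_gt_zero KK_pos k_pos by (intro order_trans[OF eta_bounds(2)] mult_left_mono le_three_sin) auto
  then have "\<eta> p \<le> c2 * cos p" by (simp add: c2_def sin_diff)
  then have "(\<eta> p)\<^sup>2 \<le> (c2 * cos p)\<^sup>2" using eta_bounds(1)[of p] p by (intro power_mono) auto
  then have e2: "(\<eta> p)\<^sup>2 \<le> c2\<^sup>2 * (cos p)\<^sup>2" by (simp add: power_mult_distrib)
  have "cosh (\<eta> p) \<le> cosh y0"
    using eta_bounds(1)[of p] eta_le_y0[of p] p pi_gt_zero by (subst cosh_real_nonneg_le_iff) auto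
  have "cosh (\<eta> p) - 1 \<le> (\<eta> p)\<^sup>2 * cosh (\<eta> p)"
    using eta_bounds(1)[of p] p by (intro cosh_minus_one_le) auto
  also have "\<dots> \<le> (c2\<^sup>2 * (cos p)\<^sup>2) * cosh y0"
    using e2 \<open>cosh (\<eta> p) \<le> cosh y0\<close> by (intro mult_mono) auto
  finally have "cosh (\<eta> p) - cos (X f) \<le> c2\<^sup>2 * (cos p)\<^sup>2 * cosh y0 + c1\<^sup>2 * (sin f)\<^sup>2"
    using one_minus_cos_le[of "X f"] X2 zero_le_power2[of "X f"] by linarith
  also have "\<dots> \<le> (c2\<^sup>2 * cosh y0 + c1\<^sup>2) * r"
    by (simp add: r_def algebra_simps)
  finally have 1: "cmod (1 - cos (\<zeta> f p)) \<le> (c2\<^sup>2 * cosh y0 + c1\<^sup>2) * r"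
    by (simp add: norm_one_minus_cos_zeta)
  \<comment> \<open>The restriction \<open>p \<ge> pi/4\<close> bounds the squared sine of
    \<open>p\<close> below by 1/2, and hence \<open>Dl\<close> by
    \<open>k\<^sup>2 / 2 * r\<close>.\<close>
  have "sin (pi/4) \<le> sin p" using p pi_gt_zero by (subst sin_mono_le_eq) auto
  then have "(sqrt 2 / 2)\<^sup>2 \<le> (sin p)\<^sup>2" by (intro power_mono) (auto simp: sin_45)
  then have s: "1/2 \<le> (sin p)\<^sup>2" by (simp add: power_divide)
  have "k\<^sup>2 / 2 * (cos p)\<^sup>2 \<le> 1 * (cos p)\<^sup>2" using k2 by (intro mult_right_mono) auto
  moreover have "k\<^sup>2 * (sin f)\<^sup>2 * (1/2) \<le> k\<^sup>2 * (sin f)\<^sup>2 * (sin p)\<^sup>2" using s by (intro mult_left_mono) auto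
  ultimately have "k\<^sup>2 / 2 * r \<le> Dl f p" by (simp add: Dl_def r_def algebra_simps)
  then have "(k\<^sup>2 / 2 * r)\<^sup>2 \<le> (Dl f p)\<^sup>2" using r by (intro power_mono) auto
  moreover have "(xr f p)\<^sup>2 + (xi f p)\<^sup>2 \<le> r"
  proof -
    have "(xr f p)\<^sup>2 = P f * co.P p * (cos p)\<^sup>2" by (simp add: xr_def power_mult_distrib sigma_sq co.sigma_sq)
    also have "\<dots> \<le> 1 * (cos p)\<^sup>2"
      using P_bounds[of f] co.P_bounds[of p] by (intro mult_right_mono mult_le_one) auto
    finally have a: "(xr f p)\<^sup>2 \<le> (cos p)\<^sup>2" by simp
    have "(xi f p)\<^sup>2 = (k\<^sup>2)\<^sup>2 * (cos f)\<^sup>2 * (sin p)\<^sup>2 * (sin f)\<^sup>2" by (simp add: xi_def power_mult_distrib)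
    also have "\<dots> \<le> 1 * (sin f)\<^sup>2"
    proof (intro mult_right_mono mult_le_one)
      show "(k\<^sup>2)\<^sup>2 \<le> 1" using k2 power_le_one[of "k\<^sup>2" 2] by simp
    qed (auto simp: abs_square_le_1)
    finally show ?thesis using a by (simp add: r_def)
  qed
  ultimately have 2: "cmod (G f p) \<le> r / (k\<^sup>2 / 2 * r)\<^sup>2"
    unfolding norm_G using r k_pos by (intro frac_le) auto
  have "cmod (G f p * (1 - cos (\<zeta> f p))) \<le> r / (k\<^sup>2 / 2 * r)\<^sup>2 * ((c2\<^sup>2 * cosh y0 + c1\<^sup>2) * r)"
    unfolding norm_mult using 1 2 r by (intro mult_mono) auto
  also have "\<dots> = ((pi / (KK * k) * 3)\<^sup>2 * cosh y0 + (pi / (KK * k') * 3)\<^sup>2) / (k\<^sup>2 / 2)\<^sup>2"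
    unfolding c1_def[symmetric] c2_def[symmetric] using r k_pos by (simp add: field_simps power2_eq_square)
  finally show "cmod (G f p * (1 - cos (\<zeta> f p))) \<le> ((pi / (KK * k) * 3)\<^sup>2 * cosh y0 + (pi / (KK * k') * 3)\<^sup>2) / (k\<^sup>2 / 2)\<^sup>2" .
qed

lemma norm_cos_sin_zeta:
  assumes "0 \<le> p" "p \<le> pi/2"
  shows "cmod (cos (of_int n * \<zeta> f p)) \<le> 2 * cosh (of_int n * y0)"
    "cmod (sin (of_int n * \<zeta> f p)) \<le> 2 * cosh (of_int n * y0)"
proof -
  have "\<bar>of_int n * \<eta> p\<bar> \<le> \<bar>of_int n * y0\<bar>"
    using eta_bounds(1)[of p] eta_le_y0[of p] assms y0_pos by (auto simp: abs_mult intro!: mult_left_mono)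
  then have c: "cosh (of_int n * \<eta> p) \<le> cosh (of_int n * y0)"
    by (metis abs_ge_zero cosh_real_abs cosh_real_nonneg_le_iff)
  have s: "\<bar>sinh u\<bar> \<le> cosh u" for u :: real
    using sinh_le_cosh_real[of u] sinh_le_cosh_real[of "- u"] by auto
  have b: "\<bar>x * w\<bar> \<le> cosh (of_int n * y0)" if "\<bar>x\<bar> \<le> 1" "\<bar>w\<bar> \<le> cosh (of_int n * \<eta> p)" for x w :: real
  proof -
    have "\<bar>x\<bar> * \<bar>w\<bar> \<le> 1 * cosh (of_int n * \<eta> p)" using that by (intro mult_mono) auto
    then show ?thesis using c by (simp add: abs_mult)
  qed
  have "cmod z \<le> 2 * cosh (of_int n * y0)" if "\<bar>Re z\<bar> \<le> cosh (of_int n * y0)" "\<bar>Im z\<bar> \<le> cosh (of_int n * y0)" for z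
    using cmod_le[of z] that by linarith
  then show "cmod (cos (of_int n * \<zeta> f p)) \<le> 2 * cosh (of_int n * y0)" "cmod (sin (of_int n * \<zeta> f p)) \<le> 2 * cosh (of_int n * y0)"
    unfolding int_zeta by (simp_all add: Re_Im_cos_sin b s)
qed

text \<open>Limit of \<open>G (1 - cos \<zeta>)\<close> on the line through the pole, where
  \<open>dn\<^sup>2 (u + i K')\<close> is \<open>- (cn u / sn u)\<^sup>2\<close>.\<close>

definition bb where "bb f = - ((cos f)\<^sup>2 / (sin f)\<^sup>2) * (1 - cos (X f))"

text \<open>On the limit line both \<open>G\<close> and \<open>\<zeta>\<close> are real away from
  the pole, so the imaginary part in \<open>gsin0\<close> disappears.\<close>

lemma limit_at_pole:
  assumes f: "0 < f" "f < pi/2" and q: "q \<longlonglongrightarrow> pi/2"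
  shows "(\<lambda>j. gcos0 n f (q j)) \<longlonglongrightarrow> bb f * cos (of_int n * X f)" "(\<lambda>j. gsin0 n f (q j)) \<longlonglongrightarrow> 0"
proof -
  have s: "sin f > 0" using f by (intro sin_gt_zero) auto
  then have nz: "Dl f (pi/2) \<noteq> 0" using k_pos by (simp add: Dl_def)
  have al: "(\<lambda>j. al f (q j)) \<longlonglongrightarrow> al f (pi/2)" "(\<lambda>j. be f (q j)) \<longlonglongrightarrow> be f (pi/2)"
    using DERIV_isCont[OF DERIV_al_p[OF nz]] DERIV_isCont[OF DERIV_be_p[OF nz]] q
    by (auto intro: isCont_tendsto_compose)
  have "al f (pi/2) = - ((cos f)\<^sup>2 / (sin f)\<^sup>2)" "be f (pi/2) = 0"
    using s k_pos by (simp_all add: al_def be_def xr_def xi_def Dl_def power_mult_distrib power2_eq_square)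
  with tendsto_Complex[OF al] have G: "(\<lambda>j. G f (q j)) \<longlonglongrightarrow> of_real (- ((cos f)\<^sup>2 / (sin f)\<^sup>2))"
    by (simp add: G_def complex_of_real_def)
  have "isCont y (pi/2)" using DERIV_isCont[OF DERIV_y[OF DERIV_ident]] by blast
  from isCont_tendsto_compose[OF this q] have "(\<lambda>j. - \<eta> (q j)) \<longlonglongrightarrow> - (y0 - y0)"
    unfolding \<eta>_def y0_def by (intro tendsto_intros)
  then have z: "(\<lambda>j. \<zeta> f (q j)) \<longlonglongrightarrow> of_real (X f)"
    unfolding \<zeta>_def complex_of_real_def by (intro tendsto_Complex) auto
  have "(\<lambda>j. gcos0 n f (q j)) \<longlonglongrightarrow> Re (of_real (- ((cos f)\<^sup>2 / (sin f)\<^sup>2)) * (1 - cos (of_real (X f))) * cos (of_int n * of_real (X f)))"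
    unfolding gcos0_def by (intro tendsto_intros G z)
  also have "of_real (- ((cos f)\<^sup>2 / (sin f)\<^sup>2)) * (1 - cos (of_real (X f))) * cos (of_int n * of_real (X f)) =
      (of_real (bb f * cos (of_int n * X f)) :: complex)"
    unfolding bb_def of_real_mult of_real_diff of_real_1 cos_of_real[symmetric] of_real_of_int_eq ..
  finally show "(\<lambda>j. gcos0 n f (q j)) \<longlonglongrightarrow> bb f * cos (of_int n * X f)" by simp
  have "(\<lambda>j. gsin0 n f (q j)) \<longlonglongrightarrow> Im (of_real (- ((cos f)\<^sup>2 / (sin f)\<^sup>2)) * (1 - cos (of_real (X f))) * sin (of_int n * of_real (X f)))"
    unfolding gsin0_def by (intro tendsto_intros G z)
  also have "of_real (- ((cos f)\<^sup>2 / (sin f)\<^sup>2)) * (1 - cos (of_real (X f))) * sin (of_int n * of_real (X f)) =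
      (of_real (bb f * sin (of_int n * X f)) :: complex)"
    unfolding bb_def of_real_mult of_real_diff of_real_1 cos_of_real[symmetric] sin_of_real[symmetric] of_real_of_int_eq ..
  finally show "(\<lambda>j. gsin0 n f (q j)) \<longlonglongrightarrow> 0" by simp
qed

lemma J_open: "J h = integral {0<..<pi/2} (\<lambda>t. h t / \<sigma> t)"
  unfolding J_def by (rule integral_open_interval_real)

text \<open>Bound and convergence are asked only inside the interval, since the endpoint 0 is the
  pole of the limit line; constancy of \<open>J (h j)\<close> then fixes the limit integral.\<close>

lemma J_dominated:
  assumes c: "\<And>j::nat. continuous_on {0..pi/2} (h j)" and bd: "\<And>j t. t \<in> {0<..<pi/2} \<Longrightarrow> \<bar>h j t\<bar> \<le> C"
    and l: "\<And>t. t \<in> {0<..<pi/2} \<Longrightarrow> (\<lambda>j. h j t) \<longlonglongrightarrow> g t" and v: "\<And>j. J (h j) = W"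
  shows "J g = W"
proof -
  have "(\<lambda>j. integral {0<..<pi/2} (\<lambda>t. h j t / \<sigma> t)) \<longlonglongrightarrow> integral {0<..<pi/2} (\<lambda>t. g t / \<sigma> t)"
  proof (rule dominated_convergence(2))
    show "(\<lambda>t. h j t / \<sigma> t) integrable_on {0<..<pi/2}" for j
      using J_integrable[OF c] by (simp add: integrable_on_open_interval_real)
    show "(\<lambda>t. C / \<sigma> t) integrable_on {0<..<pi/2}"
      using J_integrable[of "\<lambda>t. C"] by (simp add: integrable_on_open_interval_real)
    show "norm (h j t / \<sigma> t) \<le> C / \<sigma> t" if "t \<in> {0<..<pi/2}" for j t
      using bd[OF that, of j] sigma_bounds(1)[of t] by (simp add: divide_right_mono)
    show "(\<lambda>j. h j t / \<sigma> t) \<longlonglongrightarrow> g t / \<sigma> t" if "t \<in> {0<..<pi/2}" for t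
      by (intro tendsto_intros l that) simp
  qed
  then have "(\<lambda>j. W) \<longlonglongrightarrow> J g" unfolding J_open[symmetric] v .
  then show ?thesis using LIMSEQ_unique tendsto_const by blast
qed

lemma J_limits:
  "J (\<lambda>f. bb f * cos (of_int n * X f)) = M n - (M (n + 1) + M (n - 1)) / 2"
  "D n - (D (n + 1) + D (n - 1)) / 2 = 0"
proof -
  obtain B where B: "\<And>p f. pi/4 \<le> p \<Longrightarrow> p < pi/2 \<Longrightarrow> 0 < f \<Longrightarrow> f < pi/2 \<Longrightarrow> cmod (G f p * (1 - cos (\<zeta> f p))) \<le> B"
    using bounded_near_pole by blast
  \<comment> \<open>Heights tending to the pole; the shift by 2 keeps them above pi/4, where the
    uniform bound holds.\<close>
  define q :: "nat \<Rightarrow> real" where "q j = pi/2 - 1 / (real j + 2)" for j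
  have q: "pi/4 \<le> q j" "q j < pi/2" for j
  proof -
    have "1 / (real j + 2) \<le> 1/2" by (simp add: divide_simps)
    then show "pi/4 \<le> q j" unfolding q_def using pi_ge_two by linarith
  qed (simp add: q_def)
  have qs: "q j \<in> strip" for j using q[of j] pi_gt_zero by (auto simp: strip_def)
  have "(\<lambda>j. 1 / (real j + 2)) \<longlonglongrightarrow> 0"
    using LIMSEQ_ignore_initial_segment[OF lim_1_over_n[where 'a = real], of 2] by (simp add: add.commute)
  then have ql: "q \<longlonglongrightarrow> pi/2" unfolding q_def using tendsto_diff[OF tendsto_const] by fastforce
  have bd: "cmod (G f (q j) * (1 - cos (\<zeta> f (q j))) * w) \<le> B * (2 * cosh (of_int n * y0))"
    if "f \<in> {0<..<pi/2}" "cmod w \<le> 2 * cosh (of_int n * y0)" for f j w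
    unfolding norm_mult[of _ w] using B[OF q, of f j] that by (intro mult_mono order_trans[OF norm_ge_zero B[OF q, of f j]]) auto
  have q0: "0 \<le> q j" "q j \<le> pi/2" for j using q[of j] pi_gt_zero by linarith+
  show "J (\<lambda>f. bb f * cos (of_int n * X f)) = M n - (M (n + 1) + M (n - 1)) / 2"
  proof (rule J_dominated[OF J_gcos0_gsin0(3)[OF qs] _ _ J_gcos0_gsin0(1)[OF qs]])
    show "\<bar>gcos0 n t (q j)\<bar> \<le> B * (2 * cosh (of_int n * y0))" if "t \<in> {0<..<pi/2}" for j t
      unfolding gcos0_def by (rule order_trans[OF abs_Re_le_cmod bd[OF that norm_cos_sin_zeta(1)[OF q0]]])
    show "(\<lambda>j. gcos0 n t (q j)) \<longlonglongrightarrow> bb t * cos (of_int n * X t)" if "t \<in> {0<..<pi/2}" for t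
      using that ql by (intro limit_at_pole) auto
  qed
  have "J (\<lambda>f. 0) = - (D n - (D (n + 1) + D (n - 1)) / 2)"
  proof (rule J_dominated[OF J_gcos0_gsin0(4)[OF qs] _ _ J_gcos0_gsin0(2)[OF qs]])
    show "\<bar>gsin0 n t (q j)\<bar> \<le> B * (2 * cosh (of_int n * y0))" if "t \<in> {0<..<pi/2}" for j t
      unfolding gsin0_def by (rule order_trans[OF abs_Im_le_cmod bd[OF that norm_cos_sin_zeta(2)[OF q0]]])
    show "(\<lambda>j. gsin0 n t (q j)) \<longlonglongrightarrow> 0" if "t \<in> {0<..<pi/2}" for t
      using that ql by (intro limit_at_pole) auto
  qed
  then show "D n - (D (n + 1) + D (n - 1)) / 2 = 0" by (simp add: J_const)
qed

text \<open>Zero second differences together with \<open>D 0 = 0\<close>, which holds because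
  \<open>sinh 0 = 0\<close>.\<close>

lemma D_linear: "D (int n) = real n * D 1"
proof (induction n rule: less_induct)
  case (less n)
  consider "n = 0" | "n = 1" | m where "n = Suc (Suc m)" by (metis One_nat_def not0_implies_Suc)
  then show ?case
  proof cases
    case 3
    have "D (int (Suc m)) - (D (int (Suc m) + 1) + D (int (Suc m) - 1)) / 2 = 0" by (rule J_limits(2))
    moreover have "int (Suc m) + 1 = int n" "int (Suc m) - 1 = int m" using 3 by auto
    ultimately have "D (int n) = 2 * D (int (Suc m)) - D (int m)" by (simp add: algebra_simps)
    then show ?thesis using less.IH[of m] less.IH[of "Suc m"] 3 by (simp add: algebra_simps)
  qed (auto simp: D_def)
qed

end

section \<open>Fourier coefficients and the series in the nome\<close>

context modulus
begin

lemma J_cos_series: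
  fixes c :: "nat \<Rightarrow> real"
  assumes s: "summable (\<lambda>n. \<bar>c (Suc n)\<bar>)"
  defines "T \<equiv> \<lambda>f. c 0 + (\<Sum>n. c (Suc n) * cos (real (Suc n) * X f))"
  shows "continuous_on {0..pi/2} T"
    and "J (\<lambda>f. T f * cos (real m * X f)) = (if m = 0 then KK * c 0 else KK / 2 * c m)"
proof -
  have bd: "\<bar>c (Suc n) * cos (real (Suc n) * X f)\<bar> \<le> \<bar>c (Suc n)\<bar>" for n f
    by (auto simp: abs_mult intro!: mult_left_le)
  have ser: "continuous_on {0..pi/2} (\<lambda>f. \<Sum>n. c (Suc n) * cos (real (Suc n) * X f))"
    by (rule integral_series(1)[OF _ bd s]) (intro continuous_intros)
  then show "continuous_on {0..pi/2} T" unfolding T_def by (intro continuous_intros)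
  have bd': "\<bar>c (Suc n) * cos (real (Suc n) * X f) * cos (real m * X f)\<bar> \<le> \<bar>c (Suc n)\<bar>" for n f
  proof -
    have "\<bar>c (Suc n) * cos (real (Suc n) * X f)\<bar> * \<bar>cos (real m * X f)\<bar> \<le> \<bar>c (Suc n)\<bar> * 1"
      by (rule mult_mono[OF bd]) auto
    then show ?thesis by (simp only: abs_mult mult_1_right)
  qed
  have sm: "summable (\<lambda>n. c (Suc n) * cos (real (Suc n) * X f))" for f
    by (rule summable_rabs_cancel, rule summable_comparison_test'[OF s, of 0]) (use bd in auto)
  have "(\<lambda>n. J (\<lambda>f. c (Suc n) * cos (real (Suc n) * X f) * cos (real m * X f))) sums
     J (\<lambda>f. \<Sum>n. c (Suc n) * cos (real (Suc n) * X f) * cos (real m * X f))"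
    by (rule J_series[OF _ bd' s]) (intro continuous_intros)
  \<comment> \<open>For \<open>m = 0\<close> the truncated \<open>m - 1\<close> still points at
    \<open>n = 0\<close>, so the inner case distinction must make that entry 0.\<close>
  moreover have "J (\<lambda>f. c (Suc n) * cos (real (Suc n) * X f) * cos (real m * X f)) =
      (if n = m - 1 then (if m = 0 then 0 else KK / 2 * c m) else 0)" for n
  proof -
    have "int (Suc n) = int m \<longleftrightarrow> Suc n = m" "int (Suc n) \<noteq> - int m" by linarith+
    then have "J (\<lambda>f. cos (real (Suc n) * X f) * cos (real m * X f)) = (if Suc n = m then KK / 2 else 0)"
      using J_cos_cos[of "int (Suc n)" "int m"] unfolding of_int_of_nat_eq by (cases "Suc n = m") simp_all
    then show ?thesis unfolding mult.assoc J_cmult by auto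
  qed
  ultimately have "(\<lambda>n. if n = m - 1 then (if m = 0 then 0 else KK / 2 * c m) else 0) sums
     J (\<lambda>f. \<Sum>n. c (Suc n) * cos (real (Suc n) * X f) * cos (real m * X f))" by simp
  then have "J (\<lambda>f. \<Sum>n. c (Suc n) * cos (real (Suc n) * X f) * cos (real m * X f)) = (if m = 0 then 0 else KK / 2 * c m)"
    using sums_single[of "m - 1" "\<lambda>n. if m = 0 then 0 else KK / 2 * c m"] sums_unique2 by blast
  moreover have "(\<Sum>n. c (Suc n) * cos (real (Suc n) * X f) * cos (real m * X f)) =
      (\<Sum>n. c (Suc n) * cos (real (Suc n) * X f)) * cos (real m * X f)" for f
    by (rule suminf_mult2[OF sm, symmetric])
  ultimately have 1: "J (\<lambda>f. (\<Sum>n. c (Suc n) * cos (real (Suc n) * X f)) * cos (real m * X f)) = (if m = 0 then 0 else KK / 2 * c m)"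
    by simp
  have "J (\<lambda>f. T f * cos (real m * X f)) = J (\<lambda>f. c 0 * cos (of_int (int m) * X f)) +
     J (\<lambda>f. (\<Sum>n. c (Suc n) * cos (real (Suc n) * X f)) * cos (real m * X f))"
    unfolding T_def distrib_right of_int_of_nat_eq by (rule J_add) (intro continuous_intros ser)+
  then show "J (\<lambda>f. T f * cos (real m * X f)) = (if m = 0 then KK * c 0 else KK / 2 * c m)"
    unfolding 1 J_cmult J_cos_X by auto
qed

text \<open>Parseval with only one factor expanded. Taking a sine for \<open>g\<close> gives the
  coefficients of a series; taking \<open>Z - 2 Y\<close> gives the final mean.\<close>

lemma J_sin_series:
  fixes c :: "nat \<Rightarrow> real"
  assumes s: "summable (\<lambda>n. \<bar>c (Suc n)\<bar>)" and g: "continuous_on {0..pi/2} g"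
  defines "T \<equiv> \<lambda>f. \<Sum>n. c (Suc n) * sin (real (Suc n) * X f)"
  shows "continuous_on {0..pi/2} T"
    and "(\<lambda>n. c (Suc n) * J (\<lambda>f. g f * sin (real (Suc n) * X f))) sums J (\<lambda>f. g f * T f)"
proof -
  have bd: "\<bar>c (Suc n) * sin (real (Suc n) * X f)\<bar> \<le> \<bar>c (Suc n)\<bar>" for n f
    by (auto simp: abs_mult intro!: mult_left_le)
  show "continuous_on {0..pi/2} T"
    unfolding T_def by (rule integral_series(1)[OF _ bd s]) (intro continuous_intros)
  obtain C where "\<forall>f\<in>{0..pi/2}. \<bar>g f\<bar> \<le> C"
    using compact_imp_bounded[OF compact_continuous_image[OF g compact_Icc]] by (auto simp: bounded_iff)
  then have C: "\<bar>g f\<bar> \<le> C" if "f \<in> {0..pi/2}" for f using that by blast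
  have "(\<lambda>n. J (\<lambda>f. c (Suc n) * (g f * sin (real (Suc n) * X f)))) sums
     J (\<lambda>f. \<Sum>n. c (Suc n) * (g f * sin (real (Suc n) * X f)))"
  proof (rule J_series)
    show "summable (\<lambda>n. C * \<bar>c (Suc n)\<bar>)" by (rule summable_mult[OF s])
    show "\<bar>c (Suc n) * (g f * sin (real (Suc n) * X f))\<bar> \<le> C * \<bar>c (Suc n)\<bar>" if "f \<in> {0..pi/2}" for n f
    proof -
      have "\<bar>g f\<bar> * \<bar>c (Suc n) * sin (real (Suc n) * X f)\<bar> \<le> C * \<bar>c (Suc n)\<bar>"
        by (rule mult_mono[OF C[OF that] bd]) (use C[OF that] in auto)
      then show ?thesis by (simp add: abs_mult mult_ac)
    qed
  qed (intro continuous_intros g)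
  moreover have "(\<Sum>n. c (Suc n) * (g f * sin (real (Suc n) * X f))) = g f * T f" for f
  proof -
    have "summable (\<lambda>n. c (Suc n) * sin (real (Suc n) * X f))"
      by (rule summable_rabs_cancel, rule summable_comparison_test'[OF s, of 0]) (use bd in auto)
    from suminf_mult[OF this, of "g f"] show ?thesis by (simp add: T_def mult.left_commute)
  qed
  ultimately show "(\<lambda>n. c (Suc n) * J (\<lambda>f. g f * sin (real (Suc n) * X f))) sums J (\<lambda>f. g f * T f)"
    by (simp add: J_cmult)
qed

end

context modulus_pos
begin

definition q where "q = exp (- y0)"

lemma q_bounds: "0 < q" "q < 1"
  using y0_pos by (auto simp: q_def)

lemma q_nome: "nome k = q"
  using k_pos by (simp add: nome_def q_def y0_eq KK_co KK_def)

text \<open>For positive \<open>n\<close> this is 1 / (2 sinh (n y0)); \<open>c 0\<close> is a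
  division by zero, with value 0.\<close>

definition c where "c n = q ^ n / (1 - q ^ (2 * n))"

lemma q_pow_less: "n > 0 \<Longrightarrow> q ^ n \<le> q" "n > 0 \<Longrightarrow> q ^ n < 1"
  using q_bounds power_le_one_iff[of q n] power_decreasing[of 1 n q] by (auto simp: power_less_one_iff)

lemma c_bounds: "n > 0 \<Longrightarrow> 0 \<le> c n" "n > 0 \<Longrightarrow> c n \<le> q ^ n / (1 - q)"
  using q_bounds q_pow_less[of "2 * n"] by (auto simp: c_def intro!: divide_left_mono)

lemma sinh_cosh_y0:
  "sinh (of_int (int n) * y0) = (1 - q ^ (2 * n)) / (2 * q ^ n)"
  "cosh (of_int (int n) * y0) = (1 + q ^ (2 * n)) / (2 * q ^ n)"
proof -
  have e: "exp (- (real n * y0)) = q ^ n" "exp (real n * y0) = 1 / q ^ n"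
    unfolding q_def exp_of_nat_mult[symmetric] by (simp_all add: exp_minus divide_inverse)
  show "sinh (of_int (int n) * y0) = (1 - q ^ (2 * n)) / (2 * q ^ n)"
    "cosh (of_int (int n) * y0) = (1 + q ^ (2 * n)) / (2 * q ^ n)"
    using q_bounds unfolding sinh_field_def cosh_field_def of_int_of_nat_eq e mult_2 power_add
    by (simp_all add: field_simps)
qed

text \<open>Solves \<open>A n sinh (n y0) = n D 1\<close> for \<open>A n\<close>.\<close>

lemma A_eq: "n > 0 \<Longrightarrow> A (int n) = 2 * D 1 * (real n * c n)"
  using D_linear[of n] q_bounds q_pow_less[of "2 * n"]
  unfolding D_def[of "int n"] sinh_cosh_y0 by (simp add: c_def field_simps)

text \<open>The excess of \<open>n coth (n y0)\<close> over \<open>n\<close>, which decays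
  exponentially.\<close>

definition r where "r n = 2 * real n * q ^ n * c n"

lemma M_eq: "n > 0 \<Longrightarrow> M (int n) = D 1 * (real n + r n)"
proof -
  assume n: "n > 0"
  have "M (int n) = 2 * D 1 * (real n * c n) * ((1 + q ^ (2 * n)) / (2 * q ^ n))"
    unfolding M_def A_eq[OF n] sinh_cosh_y0 ..
  also have "\<dots> = D 1 * (real n + r n)"
    using q_bounds q_pow_less[of "2 * n"] n
    by (simp add: c_def r_def field_simps) (simp add: power2_eq_square power_mult mult.commute[of 2] algebra_simps)
  finally show ?thesis .
qed

lemma summable_n_pow: "summable (\<lambda>n. real n * q ^ n)"
proof -
  have "summable (\<lambda>n. real (Suc n) * q ^ n)"
    using geometric_deriv_sums[of q] q_bounds by (auto simp: sums_iff)
  then have "summable (\<lambda>n. q * (real (Suc n) * q ^ n))" by (rule summable_mult)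
  then have "summable (\<lambda>n. real (Suc n) * q ^ Suc n)" by (simp add: mult_ac)
  then show ?thesis by (subst summable_Suc_iff[symmetric])
qed

lemma r_bounds: "0 \<le> r n" "r n \<le> 2 / (1 - q) * (real n * q ^ n)"
proof -
  consider "n = 0" | "n > 0" by blast
  then have "0 \<le> r n \<and> r n \<le> 2 / (1 - q) * (real n * q ^ n)"
  proof cases
    case 2
    have "q ^ n * c n \<le> 1 * (q ^ n / (1 - q))"
      using c_bounds[OF 2] q_pow_less(2)[OF 2] by (intro mult_mono) auto
    then have "2 * real n * (q ^ n * c n) \<le> 2 * real n * (1 * (q ^ n / (1 - q)))" by (intro mult_left_mono) auto
    then show ?thesis using c_bounds[OF 2] q_bounds by (simp add: r_def mult.assoc)
  qed (simp add: r_def)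
  then show "0 \<le> r n" "r n \<le> 2 / (1 - q) * (real n * q ^ n)" by auto
qed

lemma summable_r: "summable r"
  by (rule summable_comparison_test'[OF summable_mult[OF summable_n_pow, of "2 / (1 - q)"], of 0])
    (use r_bounds in auto)

definition B where "B n = M (int n) - (M (int n + 1) + M (int n - 1)) / 2"

text \<open>The second difference kills the linear part of \<open>M\<close>, and the exponentially
  small \<open>r\<close> remains.\<close>

lemma summable_B: "summable (\<lambda>n. \<bar>B (Suc n)\<bar>)"
\<comment> \<open>The comparison starts at 1: \<open>B 1\<close> involves \<open>M 0\<close>, to
  which \<open>M_eq\<close> does not apply.\<close>
proof (rule summable_comparison_test'[of "\<lambda>n. \<bar>D 1\<bar> * (r (Suc n) + (r (Suc (Suc n)) + r n) / 2)" 1])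
  show "summable (\<lambda>n. \<bar>D 1\<bar> * (r (Suc n) + (r (Suc (Suc n)) + r n) / 2))"
    using summable_r summable_ignore_initial_segment[OF summable_r, of 1] summable_ignore_initial_segment[OF summable_r, of 2]
    by (intro summable_mult summable_add summable_divide) (simp_all add: numeral_2_eq_2)
  fix n :: nat assume "1 \<le> n"
  have "B (Suc n) = M (int (Suc n)) - (M (int (Suc (Suc n))) + M (int n)) / 2"
    by (simp add: B_def add.commute)
  also have "\<dots> = D 1 * (r (Suc n) - (r (Suc (Suc n)) + r n) / 2)"
    using \<open>1 \<le> n\<close> by (subst (1 2 3) M_eq) (auto simp: field_simps)
  finally have "B (Suc n) = D 1 * (r (Suc n) - (r (Suc (Suc n)) + r n) / 2)" .
  moreover have "\<bar>r (Suc n) - (r (Suc (Suc n)) + r n) / 2\<bar> \<le> r (Suc n) + (r (Suc (Suc n)) + r n) / 2"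
  proof -
    define x where "x = (r (Suc (Suc n)) + r n) / 2"
    have "0 \<le> x" "0 \<le> r (Suc n)" using r_bounds(1) by (auto simp: x_def)
    then show ?thesis unfolding x_def[symmetric] by simp
  qed
  ultimately show "norm \<bar>B (Suc n)\<bar> \<le> \<bar>D 1\<bar> * (r (Suc n) + (r (Suc (Suc n)) + r n) / 2)"
    by (simp add: abs_mult mult_left_mono)
qed

text \<open>Second differences telescope to increments of \<open>M\<close>, and the increments at
  infinity tend to \<open>D 1\<close>.\<close>

lemma sums_B: "(\<lambda>n. B (Suc n)) sums ((M 1 - M 0 - D 1) / 2)"
proof -
  have part: "(\<Sum>n<N. B (Suc n)) = ((M 1 - M 0) - (M (int (Suc N)) - M (int N))) / 2" for N
    by (induction N) (auto simp: B_def field_simps)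
  have "(\<lambda>n. r n) \<longlonglongrightarrow> 0" using summable_LIMSEQ_zero[OF summable_r] .
  then have "(\<lambda>N. ((M 1 - M 0) - D 1 * (1 + r (Suc N) - r N)) / 2) \<longlonglongrightarrow> ((M 1 - M 0) - D 1 * (1 + 0 - 0)) / 2"
    by (intro tendsto_intros LIMSEQ_Suc) auto
  moreover have "eventually (\<lambda>N. ((M 1 - M 0) - D 1 * (1 + r (Suc N) - r N)) / 2 = (\<Sum>n<N. B (Suc n))) sequentially"
    using eventually_gt_at_top[of 0]
  proof eventually_elim
    case (elim N)
    then show ?case unfolding part by (subst (1 2) M_eq) (auto simp: algebra_simps)
  qed
  ultimately show ?thesis
    unfolding sums_def by (auto elim: Lim_transform_eventually)
qed

text \<open>Fills the removable singularity: near 0, \<open>X f\<close> is asymptotic to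
  \<open>pi f / KK\<close>, so \<open>1 - cos (X f)\<close> behaves like
  \<open>pi\<^sup>2 f\<^sup>2 / (2 KK\<^sup>2)\<close>.\<close>

definition bb0 where "bb0 f = (if f = 0 then - pi\<^sup>2 / (2 * KK\<^sup>2) else bb f)"

lemma cont_bb0: "continuous_on {0..pi/2} bb0"
proof -
  \<comment> \<open>Half angles make \<open>bb0\<close> a multiple of the square of a quotient whose
    limit at 0 is a ratio of derivatives.\<close>
  define R where "R f = (if f = 0 then pi / (2 * KK) else sin (X f / 2) / sin f)" for f
  have eq: "bb0 f = - 2 * (cos f)\<^sup>2 * (R f)\<^sup>2" for f
    using cos_double_sin[of "X f / 2"] by (simp add: bb0_def bb_def R_def power_divide power2_eq_square)
  have "isCont R f" if f: "f \<in> {0..pi/2}" for f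
  proof (cases "f = 0")
    case True
    have "((\<lambda>f. sin (X f / 2)) has_real_derivative pi / (2 * KK)) (at 0)"
      by (auto intro!: derivative_eq_intros simp: \<sigma>_def P_def)
    then have 1: "((\<lambda>h. sin (X h / 2) / h) \<longlongrightarrow> pi / (2 * KK)) (at 0)"
      by (simp add: has_field_derivative_iff)
    have "(sin has_real_derivative 1) (at 0)" by (auto intro!: derivative_eq_intros)
    then have 2: "((\<lambda>h::real. sin h / h) \<longlongrightarrow> 1) (at 0)"
      by (simp add: has_field_derivative_iff)
    have "((\<lambda>h. (sin (X h / 2) / h) / (sin h / h)) \<longlongrightarrow> pi / (2 * KK) / 1) (at 0)"
      by (intro tendsto_intros 1 2) simp
    moreover have "eventually (\<lambda>h. (sin (X h / 2) / h) / (sin h / h) = R h) (at 0)"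
      by (auto simp: R_def eventually_at_filter)
    ultimately have "(R \<longlongrightarrow> R 0) (at 0)"
      by (auto simp: R_def elim: Lim_transform_eventually)
    then show ?thesis using True by (simp add: isCont_def)
  next
    case False
    then have "0 < f" "f < pi" using f pi_gt_zero by auto
    then have "sin f \<noteq> 0" using sin_gt_zero[of f] by simp
    moreover have "isCont X f" using DERIV_isCont[OF DERIV_X[OF DERIV_ident]] by blast
    ultimately have "isCont (\<lambda>f. sin (X f / 2) / sin f) f"
      by (intro continuous_intros) auto
    moreover have "eventually (\<lambda>h. R h = sin (X h / 2) / sin h) (nhds f)"
      using t1_space_nhds[OF False] by (auto simp: R_def elim!: eventually_mono)
    ultimately show ?thesis by (subst isCont_cong)
  qed
  then have "continuous_on {0..pi/2} R" by (simp add: continuous_at_imp_continuous_on)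
  then show ?thesis unfolding eq[abs_def] by (intro continuous_intros)
qed

text \<open>\<open>bb0\<close> agrees with its absolutely convergent cosine series, since both are
  continuous with the same coefficients. At the pole, \<open>f = 0\<close>, all cosines are 1 and
  the series can be summed.\<close>

lemma D_1: "D 1 = pi\<^sup>2 / (2 * KK)"
proof -
  define e where "e n = (if n = 0 then B 0 / KK else 2 * B n / KK)" for n
  have se: "summable (\<lambda>n. \<bar>e (Suc n)\<bar>)"
  proof -
    have "summable (\<lambda>n. 2 / KK * \<bar>B (Suc n)\<bar>)" by (rule summable_mult[OF summable_B])
    then show ?thesis using KK_pos by (simp add: e_def abs_mult abs_divide)
  qed
  let ?T = "\<lambda>f. e 0 + (\<Sum>n. e (Suc n) * cos (real (Suc n) * X f))"
  have cT: "continuous_on {0..pi/2} ?T" by (rule J_cos_series(1)[OF se])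
  have "bb0 0 - ?T 0 = 0"
  proof (rule cos_coefficients_zero[of "\<lambda>f. bb0 f - ?T f" 0])
    show "continuous_on {0..pi/2} (\<lambda>f. bb0 f - ?T f)" by (intro continuous_on_diff cont_bb0 cT)
    fix m :: nat
    have "J (\<lambda>f. (bb0 f - ?T f) * cos (real m * X f)) = J (\<lambda>f. bb0 f * cos (real m * X f)) - J (\<lambda>f. ?T f * cos (real m * X f))"
      unfolding left_diff_distrib by (rule J_diff) (intro continuous_intros cont_bb0 cT)+
    also have "J (\<lambda>f. bb0 f * cos (real m * X f)) = J (\<lambda>f. bb f * cos (of_int (int m) * X f))"
      unfolding J_open by (rule integral_cong) (auto simp: bb0_def)
    also have "\<dots> = B m" unfolding J_limits B_def ..
    also have "J (\<lambda>f. ?T f * cos (real m * X f)) = B m"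
      unfolding J_cos_series(2)[OF se] by (simp add: e_def)
    finally show "J (\<lambda>f. (bb0 f - ?T f) * cos (real m * X f)) = 0" by simp
  qed simp
  then have "bb0 0 = ?T 0" by simp
  also have "(\<Sum>n. e (Suc n) * cos (real (Suc n) * X 0)) = 2 / KK * ((M 1 - M 0 - D 1) / 2)"
    using sums_unique[OF sums_mult[OF sums_B, of "2 / KK"]] by (simp add: e_def)
  finally have "bb0 0 = e 0 + 2 / KK * ((M 1 - M 0 - D 1) / 2)" .
  \<comment> \<open>\<open>M\<close> is even in \<open>n\<close>. Hence \<open>M 0\<close> and
    \<open>M 1\<close> cancel in the value at the pole, and \<open>- D 1 / KK\<close> is
    left.\<close>
  moreover have "B 0 = M 0 - M 1"
    by (simp add: B_def M_def A_def)
  ultimately have "- pi\<^sup>2 / (2 * KK\<^sup>2) = - D 1 / KK"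
    by (simp add: bb0_def e_def field_simps)
  then show ?thesis by (simp add: field_simps power2_eq_square)
qed

lemma A_closed_form: "n > 0 \<Longrightarrow> A (int n) = pi\<^sup>2 / KK * (real n * c n)"
  by (simp add: A_eq D_1)

section \<open>Sine coefficients of \<open>Z\<close> and \<open>Y\<close>\<close>

lemma sin_coefficient:
  assumes du: "\<And>t. (u has_real_derivative u' t / \<sigma> t) (at t)" and c: "continuous_on {0..pi/2} u'"
    and "u 0 = 0" "u (pi/2) = 0" "n > 0"
  shows "J (\<lambda>t. u t * sin (real n * X t)) = KK / (real n * pi) * J (\<lambda>t. u' t * cos (real n * X t))"
proof -
  have "J (\<lambda>t. u' t * cos (of_int (int n) * X t)) = - J (\<lambda>t. u t * (- of_int (int n) * pi / KK * sin (of_int (int n) * X t)))"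
    by (rule J_parts[OF DERIV_subset[OF du] DERIV_trig_X(2) c]) (use assms in \<open>auto intro!: continuous_intros\<close>)
  also have "\<dots> = - J (\<lambda>t. (- real n * pi / KK) * (u t * sin (real n * X t)))"
    by (simp add: mult_ac)
  finally show ?thesis using \<open>n > 0\<close> unfolding J_cmult by (simp add: field_simps)
qed

text \<open>The elliptic derivative of \<open>Z\<close> is \<open>P\<close> minus a constant, and
  the constant is orthogonal to \<open>cos (n X)\<close> for positive \<open>n\<close>.\<close>

lemma Z_coefficient: "n > 0 \<Longrightarrow> J (\<lambda>t. Z t * sin (real n * X t)) = pi * c n"
proof -
  assume n: "n > 0"
  have cP: "continuous_on {0..pi/2} P" by (rule continuous_on_subset[OF cont_P_UNIV(1)]) auto
  have "J (\<lambda>t. (P t - EE / KK) * cos (real n * X t)) = J (\<lambda>t. P t * cos (of_int (int n) * X t)) - J (\<lambda>t. EE / KK * cos (of_int (int n) * X t))"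
    unfolding left_diff_distrib of_int_of_nat_eq by (rule J_diff) (intro continuous_intros cP)+
  also have "\<dots> = A (int n)" using n by (simp only: J_cmult J_cos_X A_def) simp
  finally have "J (\<lambda>t. (P t - EE / KK) * cos (real n * X t)) = pi\<^sup>2 / KK * (real n * c n)"
    using A_closed_form[OF n] by simp
  then have "J (\<lambda>t. Z t * sin (real n * X t)) = KK / (real n * pi) * (pi\<^sup>2 / KK * (real n * c n))"
    using n by (subst sin_coefficient[OF DERIV_Z]) (auto intro!: continuous_intros cP)
  then show ?thesis using n by (simp add: field_simps power2_eq_square)
qed

text \<open>\<open>\<tau>\<close> is the amplitude of the half-period shift: \<open>F(\<pi>/2 - \<tau> t) = K - F(t)\<close>.\<close>

definition \<tau> where "\<tau> = primitive (\<lambda>t. k' / P t)"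

lemma DERIV_tau [derivative_intros]:
  "(g has_real_derivative g') (at x within S) \<Longrightarrow> ((\<lambda>x. \<tau> (g x)) has_real_derivative k' / P (g x) * g') (at x within S)"
  unfolding \<tau>_def by (rule DERIV_primitive_chain) (auto intro!: continuous_intros)

text \<open>The right-hand sides form a unit vector that rotates with the angular velocity of
  \<tau>. Its inner product with \<open>(sin \<tau>, cos \<tau>)\<close> is constantly 1, so the two
  vectors coincide.\<close>

lemma sin_cos_tau: "sin (\<tau> t) = k' * sin t / \<sigma> t" "cos (\<tau> t) = cos t / \<sigma> t"
proof -
  let ?S = "\<lambda>t. k' * sin t / \<sigma> t" and ?C = "\<lambda>t. cos t / \<sigma> t"
  have Yp: "Y t = k\<^sup>2 * sin t * cos t / \<sigma> t" for t by (simp add: Y_def)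
  have PS: "P t = \<sigma> t * \<sigma> t" for t by (simp add: sigma_sq[symmetric] power2_eq_square)
  have ss: "\<sigma> t * \<sigma> t = 1 - k\<^sup>2 * (sin t)\<^sup>2" for t by (simp add: PS[symmetric] P_def)
  have dS: "(?S has_real_derivative k' / P t * ?C t) (at t)" for t
  proof -
    have "(?S has_real_derivative (k' * cos t * \<sigma> t - k' * sin t * - Y t) / (\<sigma> t * \<sigma> t)) (at t)"
      by (auto intro!: derivative_eq_intros)
    moreover have "(k' * cos t * \<sigma> t - k' * sin t * - Y t) * \<sigma> t = k' * cos t"
    proof -
      have "(k' * cos t * \<sigma> t - k' * sin t * - Y t) * \<sigma> t = k' * cos t * (\<sigma> t * \<sigma> t + k\<^sup>2 * (sin t)\<^sup>2)"
        by (simp add: Yp field_simps power2_eq_square)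
      then show ?thesis by (simp add: ss)
    qed
    then have "(k' * cos t * \<sigma> t - k' * sin t * - Y t) / (\<sigma> t * \<sigma> t) = k' / P t * ?C t"
      by (simp add: PS field_simps)
    ultimately show ?thesis by simp
  qed
  have dC: "(?C has_real_derivative - (k' / P t * ?S t)) (at t)" for t
  proof -
    have "(?C has_real_derivative (- sin t * \<sigma> t - cos t * - Y t) / (\<sigma> t * \<sigma> t)) (at t)"
      by (auto intro!: derivative_eq_intros)
    moreover have "(- sin t * \<sigma> t - cos t * - Y t) * \<sigma> t = - (k'\<^sup>2 * sin t)"
    proof -
      have "(- sin t * \<sigma> t - cos t * - Y t) * \<sigma> t = - sin t * (\<sigma> t * \<sigma> t - k\<^sup>2 * (cos t)\<^sup>2)"
        by (simp add: Yp field_simps power2_eq_square)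
      then show ?thesis unfolding ss by (simp add: k'_sq cos_squared_eq algebra_simps)
    qed
    then have "(- sin t * \<sigma> t - cos t * - Y t) / (\<sigma> t * \<sigma> t) = - (k'\<^sup>2 * sin t) / (\<sigma> t * \<sigma> t * \<sigma> t)"
      by (metis mult_divide_mult_cancel_right sigma_nz(1))
    then have "(- sin t * \<sigma> t - cos t * - Y t) / (\<sigma> t * \<sigma> t) = - (k' / P t * ?S t)"
      by (simp add: PS power2_eq_square mult_ac)
    ultimately show ?thesis by simp
  qed
  have "((\<lambda>t. cos (\<tau> t) * ?C t + sin (\<tau> t) * ?S t) has_real_derivative 0) (at t)" for t
    by (rule DERIV_cong[OF DERIV_add[OF DERIV_mult[OF _ dC] DERIV_mult[OF _ dS]]])
      (auto intro!: derivative_eq_intros simp: algebra_simps)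
  then have "cos (\<tau> t) * ?C t + sin (\<tau> t) * ?S t = cos (\<tau> 0) * ?C 0 + sin (\<tau> 0) * ?S 0"
    by (intro DERIV_isconst_all) auto
  also have "\<dots> = 1" by (simp add: \<tau>_def \<sigma>_def P_def)
  finally have w: "cos (\<tau> t) * ?C t + sin (\<tau> t) * ?S t = 1" .
  have "(?S t)\<^sup>2 + (?C t)\<^sup>2 = ((1 - k\<^sup>2) * (sin t)\<^sup>2 + (cos t)\<^sup>2) / P t"
    by (simp add: power_divide power_mult_distrib k'_sq sigma_sq add_divide_distrib)
  also have "(1 - k\<^sup>2) * (sin t)\<^sup>2 + (cos t)\<^sup>2 = P t" by (simp add: P_def cos_squared_eq algebra_simps)
  finally have 1: "(?S t)\<^sup>2 + (?C t)\<^sup>2 = 1" by simp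
  have "(sin (\<tau> t) - ?S t)\<^sup>2 + (cos (\<tau> t) - ?C t)\<^sup>2 =
    ((sin (\<tau> t))\<^sup>2 + (cos (\<tau> t))\<^sup>2) + ((?S t)\<^sup>2 + (?C t)\<^sup>2) - 2 * (cos (\<tau> t) * ?C t + sin (\<tau> t) * ?S t)"
    unfolding power2_diff by argo
  also have "\<dots> = 0" unfolding w 1 by simp
  finally show "sin (\<tau> t) = k' * sin t / \<sigma> t" "cos (\<tau> t) = cos t / \<sigma> t"
    by (simp_all add: sum_power2_eq_zero_iff)
qed

text \<open>A larger value would make \<open>cos \<tau>\<close>, hence \<open>cos\<close>, vanish
  before pi/2; a smaller one would make \<open>cos \<tau>\<close> positive at pi/2, where
  \<open>cos\<close> vanishes.\<close>

lemma tau_end: "\<tau> (pi/2) = pi/2"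
proof -
  have cont: "isCont \<tau> x" for x using DERIV_isCont[OF DERIV_tau[OF DERIV_ident]] by blast
  have t0: "\<tau> 0 = 0" by (simp add: \<tau>_def)
  have "\<tau> 0 < \<tau> (pi/2)"
  proof (rule DERIV_pos_imp_increasing[of 0 "pi/2" \<tau>])
    show "\<exists>y. (\<tau> has_real_derivative y) (at x) \<and> 0 < y" for x
      using P_bounds(3)[of x] k'_pos by (intro exI[of _ "k' / P x * 1"] conjI DERIV_tau DERIV_ident) simp
  qed simp
  then have pos: "0 < \<tau> (pi/2)" by (simp add: t0)
  have "\<not> \<tau> (pi/2) > pi/2"
  proof
    assume "\<tau> (pi/2) > pi/2"
    then obtain x where x: "0 \<le> x" "x \<le> pi/2" "\<tau> x = pi/2"
      using IVT[of \<tau> 0 "pi/2" "pi/2"] cont t0 by auto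
    then have "x < pi/2" using \<open>\<tau> (pi/2) > pi/2\<close> by (cases "x = pi/2") auto
    then have "cos x > 0" using x by (intro cos_gt_zero_pi) auto
    then show False using sin_cos_tau(2)[of x] x(3) by simp
  qed
  moreover have "\<not> \<tau> (pi/2) < pi/2"
  proof
    assume "\<tau> (pi/2) < pi/2"
    then have "cos (\<tau> (pi/2)) > 0" using pos by (intro cos_gt_zero_pi) auto
    then show False by (simp add: sin_cos_tau)
  qed
  ultimately show ?thesis by simp
qed

text \<open>In elliptic terms: \<open>dn (K - u) = k' / dn u\<close>.\<close>

lemma sigma_shift: "P (pi/2 - \<tau> t) = k'\<^sup>2 / P t" "\<sigma> (pi/2 - \<tau> t) = k' / \<sigma> t"
proof -
  have "P (pi/2 - \<tau> t) = 1 - k\<^sup>2 * ((cos t)\<^sup>2 / P t)"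
    by (simp add: P_def[of "pi/2 - \<tau> t"] sin_diff sin_cos_tau power_divide sigma_sq)
  also have "\<dots> = k'\<^sup>2 / P t"
    by (simp add: field_simps k'_sq) (simp add: P_def cos_squared_eq algebra_simps)
  finally show "P (pi/2 - \<tau> t) = k'\<^sup>2 / P t" .
  then show "\<sigma> (pi/2 - \<tau> t) = k' / \<sigma> t"
    using k'_pos by (simp add: \<sigma>_def real_sqrt_divide)
qed

lemma X_shift: "X (pi/2 - \<tau> t) = pi - X t"
proof -
  have "((\<lambda>t. X (pi/2 - \<tau> t) + X t) has_real_derivative 0) (at t)" for t
    using k'_pos by (auto intro!: derivative_eq_intros simp: sigma_shift)
      (simp add: sigma_sq[symmetric] power2_eq_square)
  then have "X (pi/2 - \<tau> t) + X t = X (pi/2 - \<tau> 0) + X 0" by (intro DERIV_isconst_all) auto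
  then show ?thesis by (simp add: \<tau>_def)
qed

text \<open>The integrand is \<open>dn\<^sup>2\<close> reflected to \<open>K - u\<close>; the
  reflection sends \<open>X\<close> to \<open>pi - X\<close>, which produces the sign.\<close>

lemma J_shifted: "J (\<lambda>t. k'\<^sup>2 / P t * cos (real n * X t)) = (- 1) ^ n * A (int n)"
proof -
  let ?f = "\<lambda>t. P t * cos (real n * X t) / \<sigma> t"
  let ?g = "\<lambda>t. pi/2 - \<tau> t"
  have dg: "(?g has_real_derivative - (k' / P x)) (at x within {0..pi/2})" for x
    by (auto intro!: derivative_eq_intros)
  have cP: "continuous_on S P" for S by (rule continuous_on_subset[OF cont_P_UNIV(1)]) auto
  have rng: "?g ` {0..pi/2} \<subseteq> {0..pi/2}"
  proof -
    have mono: "\<tau> x \<le> \<tau> y" if "x \<le> y" for x y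
    proof (rule DERIV_nonneg_imp_nondecreasing[OF that])
      show "\<exists>z. (\<tau> has_real_derivative z) (at u) \<and> 0 \<le> z" for u
        using P_bounds(3)[of u] k'_pos by (intro exI[of _ "k' / P u * 1"] conjI DERIV_tau DERIV_ident) simp
    qed
    have "\<tau> 0 = 0" by (simp add: \<tau>_def)
    then show ?thesis using mono[of 0] mono[of _ "pi/2"] tau_end by fastforce
  qed
  \<comment> \<open>The substitution reverses orientation: the forward integral is over an empty
    interval, and minus the other one remains.\<close>
  have "((\<lambda>t. - (k' / P t) *\<^sub>R ?f (?g t)) has_integral (integral {?g 0..?g (pi/2)} ?f - integral {?g (pi/2)..?g 0} ?f)) {0..pi/2}"
    by (rule has_integral_substitution_general[of "{}", OF _ _ rng])
      (auto intro!: continuous_intros cP dg DERIV_continuous_on[OF dg])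
  moreover have "integral {?g 0..?g (pi/2)} ?f - integral {?g (pi/2)..?g 0} ?f = - A (int n)"
    by (simp add: tau_end \<tau>_def[THEN fun_cong, of 0] A_def J_def)
  moreover have "- (k' / P t) *\<^sub>R ?f (?g t) = - ((- 1) ^ n * (k'\<^sup>2 / P t * cos (real n * X t) / \<sigma> t))" for t
  proof -
    have "cos (real n * (pi - X t)) = (- 1) ^ n * cos (real n * X t)"
      by (simp add: right_diff_distrib cos_diff)
    then show ?thesis
      unfolding sigma_shift X_shift using k'_pos
      by (simp add: field_simps power2_eq_square sigma_sq[symmetric])
  qed
  ultimately have "((\<lambda>t. - ((- 1) ^ n * (k'\<^sup>2 / P t * cos (real n * X t) / \<sigma> t))) has_integral - A (int n)) {0..pi/2}"
    by simp
  from has_integral_mult_right[OF this, of "- ((- 1) ^ n)"]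
  have "((\<lambda>t. k'\<^sup>2 / P t * cos (real n * X t) / \<sigma> t) has_integral (- 1) ^ n * A (int n)) {0..pi/2}"
    by (simp flip: power_add mult.assoc power_mult_distrib)
  then show ?thesis unfolding J_def by (rule integral_unique)
qed

text \<open>The elliptic derivative of \<open>Y\<close> is \<open>dn\<^sup>2\<close> minus its
  reflection, which links its coefficients to those already known.\<close>

lemma DERIV_Y: "(Y has_real_derivative (P t - k'\<^sup>2 / P t) / \<sigma> t) (at t)"
proof -
  have PS: "P t = \<sigma> t * \<sigma> t" by (simp add: sigma_sq[symmetric] power2_eq_square)
  have ss: "\<sigma> t * \<sigma> t = 1 - k\<^sup>2 * (sin t)\<^sup>2" by (simp add: PS[symmetric] P_def)
  have "(Y has_real_derivative (k\<^sup>2 * ((cos t)\<^sup>2 - (sin t)\<^sup>2) * \<sigma> t - k\<^sup>2 * sin t * cos t * - Y t) / (\<sigma> t * \<sigma> t)) (at t)"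
    unfolding Y_def[abs_def] by (auto intro!: derivative_eq_intros simp: Y_def algebra_simps power2_eq_square)
  note D = this
  have "(k\<^sup>2 * ((cos t)\<^sup>2 - (sin t)\<^sup>2) * \<sigma> t - k\<^sup>2 * sin t * cos t * - Y t) * \<sigma> t
      = k\<^sup>2 * ((cos t)\<^sup>2 - (sin t)\<^sup>2) * (\<sigma> t * \<sigma> t) + k\<^sup>2 * k\<^sup>2 * (sin t)\<^sup>2 * (cos t)\<^sup>2"
    by (simp add: Y_def field_simps power2_eq_square)
  also have "\<dots> = (\<sigma> t * \<sigma> t) * (\<sigma> t * \<sigma> t) - (1 - k\<^sup>2)"
    unfolding ss cos_squared_eq by algebra
  finally have *: "(k\<^sup>2 * ((cos t)\<^sup>2 - (sin t)\<^sup>2) * \<sigma> t - k\<^sup>2 * sin t * cos t * - Y t) * \<sigma> t = P t * P t - k'\<^sup>2"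
    by (simp add: PS k'_sq)
  have "(k\<^sup>2 * ((cos t)\<^sup>2 - (sin t)\<^sup>2) * \<sigma> t - k\<^sup>2 * sin t * cos t * - Y t) / (\<sigma> t * \<sigma> t) =
     ((k\<^sup>2 * ((cos t)\<^sup>2 - (sin t)\<^sup>2) * \<sigma> t - k\<^sup>2 * sin t * cos t * - Y t) * \<sigma> t) / (P t * \<sigma> t)"
    by (simp add: PS)
  also have "\<dots> = (P t - k'\<^sup>2 / P t) / \<sigma> t"
    unfolding * by (simp add: field_simps)
  finally show ?thesis using D by simp
qed

text \<open>The reflection cancels the even frequencies and doubles the odd ones.\<close>

lemma Y_coefficient: "n > 0 \<Longrightarrow> J (\<lambda>t. Y t * sin (real n * X t)) = (1 - (- 1) ^ n) * pi * c n"
proof -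
  assume n: "n > 0"
  have cP: "continuous_on {0..pi/2} P" by (rule continuous_on_subset[OF cont_P_UNIV(1)]) auto
  have "J (\<lambda>t. (P t - k'\<^sup>2 / P t) * cos (real n * X t)) = J (\<lambda>t. P t * cos (real n * X t)) - J (\<lambda>t. k'\<^sup>2 / P t * cos (real n * X t))"
    unfolding left_diff_distrib by (rule J_diff) (intro continuous_intros cP, simp)+
  also have "\<dots> = (1 - (- 1) ^ n) * A (int n)" unfolding J_shifted by (simp add: A_def algebra_simps)
  finally have "J (\<lambda>t. (P t - k'\<^sup>2 / P t) * cos (real n * X t)) = (1 - (- 1) ^ n) * (pi\<^sup>2 / KK * (real n * c n))"
    using A_closed_form[OF n] by simp
  then have "J (\<lambda>t. Y t * sin (real n * X t)) = KK / (real n * pi) * ((1 - (- 1) ^ n) * (pi\<^sup>2 / KK * (real n * c n)))"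
    using n by (subst sin_coefficient[OF DERIV_Y]) (auto intro!: continuous_intros cP simp: Y_def)
  moreover have "KK / (real n * pi) * (w * (pi\<^sup>2 / KK * (real n * x))) = w * pi * x" for w x
    using n by (simp add: field_simps power2_eq_square)
  ultimately show ?thesis by (simp only:)
qed

lemma summable_c: "summable (\<lambda>n. \<bar>c (Suc n)\<bar>)"
proof (rule summable_comparison_test'[of "\<lambda>n. q / (1 - q) * q ^ n" 0])
  show "summable (\<lambda>n. q / (1 - q) * q ^ n)" using q_bounds by (intro summable_mult summable_geometric) auto
  show "norm \<bar>c (Suc n)\<bar> \<le> q / (1 - q) * q ^ n" for n
    using c_bounds[of "Suc n"] by simp
qed

text \<open>The coefficients carry \<open>2 / KK\<close> because the squared sines integrate to
  \<open>KK / 2\<close>; equality of all sine coefficients then identifies the two continuous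
  functions.\<close>

lemma Z_series: "t \<in> {0<..<pi/2} \<Longrightarrow> Z t = (\<Sum>n. 2 * pi / KK * c (Suc n) * sin (real (Suc n) * X t))"
proof -
  assume t: "t \<in> {0<..<pi/2}"
  have s: "summable (\<lambda>n. \<bar>2 * pi / KK * c (Suc n)\<bar>)"
    using summable_mult[OF summable_c, of "2 * pi / KK"] KK_pos by (simp add: abs_mult)
  let ?T = "\<lambda>t. \<Sum>n. 2 * pi / KK * c (Suc n) * sin (real (Suc n) * X t)"
  have cT: "continuous_on {0..pi/2} ?T" by (rule J_sin_series(1)[OF s, of "\<lambda>t. 0"]) simp
  have "Z t - ?T t = 0"
  proof (rule sin_coefficients_zero[of "\<lambda>t. Z t - ?T t", OF _ _ t])
    show "continuous_on {0..pi/2} (\<lambda>t. Z t - ?T t)" by (intro continuous_on_diff cont_Z cT)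
    fix m :: nat assume m: "m > 0"
    have sc: "continuous_on {0..pi/2} (\<lambda>t. sin (real m * X t))" by (intro continuous_intros)
    have "(\<lambda>n. 2 * pi / KK * c (Suc n) * J (\<lambda>f. sin (real m * X f) * sin (real (Suc n) * X f))) sums J (\<lambda>f. sin (real m * X f) * ?T f)"
      by (rule J_sin_series(2)[OF s sc])
    moreover have "2 * pi / KK * c (Suc n) * J (\<lambda>f. sin (real m * X f) * sin (real (Suc n) * X f)) =
        (if n = m - 1 then pi * c m else 0)" for n
    proof -
      have "int m = int (Suc n) \<longleftrightarrow> Suc n = m" "int m \<noteq> - int (Suc n)" by linarith+
      then have "J (\<lambda>f. sin (real m * X f) * sin (real (Suc n) * X f)) = (if Suc n = m then KK / 2 else 0)"
        using J_sin_sin[of "int m" "int (Suc n)"] unfolding of_int_of_nat_eq by (cases "Suc n = m") simp_all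
      then show ?thesis using m by auto
    qed
    ultimately have "(\<lambda>n. if n = m - 1 then pi * c m else 0) sums J (\<lambda>f. sin (real m * X f) * ?T f)" by simp
    then have "J (\<lambda>f. sin (real m * X f) * ?T f) = pi * c m"
      using sums_single[of "m - 1" "\<lambda>n. pi * c m"] sums_unique2 by blast
    moreover have "J (\<lambda>t. (Z t - ?T t) * sin (real m * X t)) = J (\<lambda>t. Z t * sin (real m * X t)) - J (\<lambda>f. sin (real m * X f) * ?T f)"
      unfolding left_diff_distrib mult.commute[of "suminf _"] by (rule J_diff) (intro continuous_intros cont_Z cT)+
    ultimately show "J (\<lambda>t. (Z t - ?T t) * sin (real m * X t)) = 0" by (simp add: Z_coefficient m)
  qed
  then show ?thesis by simp
qed

text \<open>The integrand is \<open>(Z - 2 Y) Z\<close>, and only the factor \<open>Z\<close> is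
  expanded. The weight \<open>1 - 2 (1 - (-1)^n) = 2 (-1)^n - 1\<close> is 1 for even and -3 for odd
  frequencies, the source of the constants 2 and -6.\<close>

lemma mean_Z_Y_sums:
  "(\<lambda>n. 2 * pi\<^sup>2 / KK\<^sup>2 * ((2 * (- 1) ^ Suc n - 1) * (c (Suc n))\<^sup>2)) sums mean (\<lambda>t. (Z t)\<^sup>2 - 2 * Y t * Z t)"
proof -
  have s: "summable (\<lambda>n. \<bar>2 * pi / KK * c (Suc n)\<bar>)"
    using summable_mult[OF summable_c, of "2 * pi / KK"] KK_pos by (simp add: abs_mult)
  have cY: "continuous_on {0..pi/2} Y" by (rule continuous_on_subset[OF cont_P_UNIV(2)]) auto
  have g: "continuous_on {0..pi/2} (\<lambda>t. Z t - 2 * Y t)" by (intro continuous_intros cont_Z cY)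
  have co: "J (\<lambda>t. (Z t - 2 * Y t) * sin (real (Suc n) * X t)) = pi * c (Suc n) * (2 * (- 1) ^ Suc n - 1)" for n
  proof -
    have "J (\<lambda>t. (Z t - 2 * Y t) * sin (real (Suc n) * X t)) = J (\<lambda>t. Z t * sin (real (Suc n) * X t)) - J (\<lambda>t. 2 * (Y t * sin (real (Suc n) * X t)))"
      unfolding left_diff_distrib mult.assoc by (rule J_diff) (intro continuous_intros cont_Z cY)+
    then show ?thesis by (simp only: J_cmult Z_coefficient Y_coefficient zero_less_Suc) (simp add: algebra_simps)
  qed
  have "(\<lambda>n. 2 * pi / KK * c (Suc n) * J (\<lambda>t. (Z t - 2 * Y t) * sin (real (Suc n) * X t))) sums
     J (\<lambda>t. (Z t - 2 * Y t) * (\<Sum>n. 2 * pi / KK * c (Suc n) * sin (real (Suc n) * X t)))"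
    by (rule J_sin_series(2)[OF s g])
  also have "J (\<lambda>t. (Z t - 2 * Y t) * (\<Sum>n. 2 * pi / KK * c (Suc n) * sin (real (Suc n) * X t))) = J (\<lambda>t. (Z t)\<^sup>2 - 2 * Y t * Z t)"
    unfolding J_open
  proof (rule integral_cong)
    fix t :: real assume "t \<in> {0<..<pi/2}"
    then show "(Z t - 2 * Y t) * (\<Sum>n. 2 * pi / KK * c (Suc n) * sin (real (Suc n) * X t)) / \<sigma> t = ((Z t)\<^sup>2 - 2 * Y t * Z t) / \<sigma> t"
      by (subst Z_series[symmetric]) (simp_all add: algebra_simps power2_eq_square)
  qed
  finally have "(\<lambda>n. 2 * pi / KK * c (Suc n) * (pi * c (Suc n) * (2 * (- 1) ^ Suc n - 1)) / KK) sums (J (\<lambda>t. (Z t)\<^sup>2 - 2 * Y t * Z t) / KK)"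
    unfolding co by (rule sums_divide)
  moreover have "2 * pi / KK * x * (pi * x * w) / KK = 2 * pi\<^sup>2 / KK\<^sup>2 * (w * x\<^sup>2)" for x w
    by (simp add: power2_eq_square field_simps)
  ultimately show ?thesis by (simp only: mean_J)
qed

lemma summable_c2: "summable (\<lambda>j. (c (2 * (j + 1)))\<^sup>2)" "summable (\<lambda>j. (c (2 * j + 1))\<^sup>2)"
proof -
  have "(c n)\<^sup>2 \<le> (1 / (1 - q))\<^sup>2 * q ^ j" if "j < n" for n j
  proof -
    have "q ^ n \<le> q ^ j" using q_bounds that by (intro power_decreasing) auto
    then have "c n \<le> q ^ j / (1 - q)"
      using c_bounds(2)[of n] divide_right_mono[of "q ^ n" "q ^ j" "1 - q"] that q_bounds by linarith
    then have "(c n)\<^sup>2 \<le> (q ^ j / (1 - q))\<^sup>2" using c_bounds(1)[of n] that by (intro power_mono) auto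
    also have "\<dots> = (1 / (1 - q))\<^sup>2 * (q ^ j * q ^ j)" by (simp add: power_divide power2_eq_square)
    also have "\<dots> \<le> (1 / (1 - q))\<^sup>2 * (q ^ j * 1)"
      using q_bounds by (intro mult_left_mono) (auto intro: power_le_one)
    finally show ?thesis by simp
  qed
  then have b: "norm ((c n)\<^sup>2) \<le> (1 / (1 - q))\<^sup>2 * q ^ j" if "j < n" for n j using that by simp
  have s: "summable (\<lambda>j. (1 / (1 - q))\<^sup>2 * q ^ j)" using q_bounds by (intro summable_mult summable_geometric) auto
  show "summable (\<lambda>j. (c (2 * (j + 1)))\<^sup>2)" "summable (\<lambda>j. (c (2 * j + 1))\<^sup>2)"
    by (rule summable_comparison_test'[OF s, of 0], rule b, simp)+
qed

lemma mean_Z_Y: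
  "mean (\<lambda>t. (Z t)\<^sup>2 - 2 * Y t * Z t) = 2 * pi\<^sup>2 / KK\<^sup>2 * (\<Sum>j. (c (2 * (j + 1)))\<^sup>2) - 6 * pi\<^sup>2 / KK\<^sup>2 * (\<Sum>j. (c (2 * j + 1))\<^sup>2)"
proof -
  have "(\<lambda>j. 2 * pi\<^sup>2 / KK\<^sup>2 * (c (2 * (j + 1)))\<^sup>2) sums (2 * pi\<^sup>2 / KK\<^sup>2 * (\<Sum>j. (c (2 * (j + 1)))\<^sup>2))"
    "(\<lambda>j. - (6 * pi\<^sup>2 / KK\<^sup>2) * (c (2 * j + 1))\<^sup>2) sums (- (6 * pi\<^sup>2 / KK\<^sup>2) * (\<Sum>j. (c (2 * j + 1))\<^sup>2))"
    by (intro sums_mult summable_sums summable_c2)+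
  \<comment> \<open>The summation index is one less than the frequency, so even indices carry the
    odd frequencies.\<close>
  from sums_if[OF this]
  have "(\<lambda>n. if even n then - (6 * pi\<^sup>2 / KK\<^sup>2) * (c (2 * (n div 2) + 1))\<^sup>2 else 2 * pi\<^sup>2 / KK\<^sup>2 * (c (2 * ((n - 1) div 2 + 1)))\<^sup>2)
    sums (2 * pi\<^sup>2 / KK\<^sup>2 * (\<Sum>j. (c (2 * (j + 1)))\<^sup>2) + - (6 * pi\<^sup>2 / KK\<^sup>2) * (\<Sum>j. (c (2 * j + 1))\<^sup>2))" .
  moreover have "(if even n then - (6 * pi\<^sup>2 / KK\<^sup>2) * (c (2 * (n div 2) + 1))\<^sup>2 else 2 * pi\<^sup>2 / KK\<^sup>2 * (c (2 * ((n - 1) div 2 + 1)))\<^sup>2)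
    = 2 * pi\<^sup>2 / KK\<^sup>2 * ((2 * (- 1) ^ Suc n - 1) * (c (Suc n))\<^sup>2)" for n
  proof (cases "even n")
    case False
    then obtain m where "n = 2 * m + 1" by (auto elim: oddE)
    then show ?thesis by simp
  qed (auto elim!: evenE)
  ultimately show ?thesis
    using sums_unique2[OF mean_Z_Y_sums] by simp
qed

end

theorem mainTheorem2:
  fixes k :: real
  assumes "0 \<le> k" and "k < 1"
  shows "(\<lambda>l. Lam k l - (gamma1 k * l + gamma2 k / 2 * l\<^sup>2)) \<in> o[at 0](\<lambda>l. l\<^sup>2)"
proof -
  interpret modulus k using assms by unfold_locales
  let ?S = "2 * pi\<^sup>2 / KK\<^sup>2 * (\<Sum>j. (nome k ^ (2*(j+1)) / (1 - nome k ^ (4*(j+1))))\<^sup>2)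
     - 6 * pi\<^sup>2 / KK\<^sup>2 * (\<Sum>j. (nome k ^ (2*j+1) / (1 - nome k ^ (4*j+2)))\<^sup>2)"
  have "mean (\<lambda>t. (Z t)\<^sup>2 - 2 * Y t * Z t) = ?S"
  proof (cases "k = 0")
    \<comment> \<open>Without a pole nothing has to be expanded: \<open>h1\<close> and with it
      \<open>Z\<close> vanish identically, and the nome 0 makes both series vanish, as all exponents
      are positive.\<close>
    case True
    have "h1 = (\<lambda>t. 0)" unfolding h1_def[abs_def] using True by simp
    then have "(mean h1 - h1 t) / \<sigma> t = 0" for t by (simp add: mean_const)
    then have "Z t = 0" for t by (simp add: Z_def sol_def primitive_def)
    then have "mean (\<lambda>t. (Z t)\<^sup>2 - 2 * Y t * Z t) = 0" using mean_const[of 0] by simp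
    moreover have "nome k = 0" using True by (simp add: nome_def)
    ultimately show ?thesis by simp
  next
    case False
    then interpret modulus_pos k using assms by unfold_locales simp
    have "2 * (2 * (j + 1)) = 4 * (j + 1)" "2 * (2 * j + 1) = 4 * j + 2" for j :: nat by simp_all
    then show ?thesis unfolding mean_Z_Y q_nome c_def by (simp only:)
  qed
  from Lam_expansion[OF this]
  have "(\<lambda>l. Lam k l - ((2 * (EE / KK) - 1) * l + (3/2 - k\<^sup>2 - EE / KK + ?S) * l\<^sup>2)) \<in> o[at 0](\<lambda>l. l\<^sup>2)" .
  moreover have "2 * (EE / KK) - 1 = gamma1 k"
    unfolding gamma1_def KK_def EE_def ..
  moreover have "3/2 - k\<^sup>2 - EE / KK + ?S = gamma2 k / 2"
    unfolding gamma2_def KK_def EE_def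
    by (simp only: add_diff_eq nonzero_mult_div_cancel_left[OF numeral_neq_zero])
  ultimately show ?thesis by (simp only:)
qed

end
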